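(* Let $F_\omega$ be the free group with countably infinite basis $X_\omega=\{x_1,x_2,\dots\}$. The homomorphism $\Psi:\mathrm{BF}(\mathcal E;\mathcal S)\to\mathrm{Aut}(F_\omega)$, $[f]\mapsto\alpha_f$, defined in the context, is surjective.
   Context: **Big free groups.** For a set $\Lambda$ with a fixed-point-free involution $\lambda\mapsto\lambda^{-1}$, let $\mathcal T(\Lambda)$ be the set of all maps $f:S\to\Lambda$ with $S$ totally ordered and $f^{-1}(\lambda)$ finite for every $\lambda\in\Lambda$; $f:S\to\Lambda$ and $f':S'\to\Lambda$ are identified if $f=f'\circ\varphi$ for an order-preserving bijection $\varphi:S\to S'$. Write $f\searrow g$ if there are $T\subseteq S$ with $g=f|_{S\setminus T}$ and an involution $*$ on $T$ such that for all $t\in T$: $f(t^* )=f(t)^{-1}$, $[t,t^*]\subseteq T$, and $([t,t^*])^*=[t,t^*]$, where $[s,s']=\{x\in S\mid s\le x\le s'\}$. Let $\approx$ be the equivalence relation generated by $\searrow$; $\mathrm{BF}(\Lambda)=\mathcal T(\Lambda)/\!\approx$ is a group under concatenation. For $f:S\to\Lambda$ let $\bar f:\bar S\to\Lambda$, $\bar f(s)=f(s)^{-1}$, where $\bar S$ is $S$ with reversed order. A subset $\mathcal S\subseteq\mathcal T(\Lambda)$ is admissible if it is closed under concatenation, under $f\mapsto\bar f$, and under $f\searrow g$; then $\mathrm{BF}(\Lambda;\mathcal S)=\mathcal S/\!\approx$ is a subgroup of $\mathrm{BF}(\Lambda)$. **The map $\Psi$.** Write $X=X_\omega$, $X^{\pm}=X\cup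 X^{-1}$. Automorphisms act on the right: $w(\varphi\psi)=(w\varphi)\psi$. For $x,y\in X^\pm$, $y\ne x^{\pm1}$, $E_{xy}$ is the automorphism of $F_\omega$ with $x\mapsto xy$ fixing all elements of $X^\pm\setminus\{x,x^{-1}\}$. $\mathcal E$ is the set of all $E_{xy}$, with free involution $E_{xy}^{-1}=E_{xy^{-1}}$. For $f:S\to\mathcal E$ write $f(s)=E_{f_1(s)f_2(s)}$. Let $\mathcal S_0=\{f\in\mathcal T(\mathcal E)\mid f_1^{-1}(x)\text{ is finite for each }x\in X^\pm\}$; let $\mathcal S_1$ be the set of $f:S\to\mathcal E$ in $\mathcal T(\mathcal E)$ for which there is no injective order-preserving $\varphi:\mathbb N\to S$ with $f_1(\varphi(n+1))=(f_2(\varphi(n)))^{\pm1}$ for all $n$; $\mathcal S=\{f\mid f\in\mathcal S_0,\ f\in\mathcal S_1,\ \bar f\in\mathcal S_1\}$ (an admissible set). For $f:S\to\mathcal E$ in $\mathcal S$ and $x\in X^\pm$ put $A_0=\{x,x^{-1}\}$, $s_1=\min f_1^{-1}(A_0)$, $A_k=A_{k-1}\cup\{f_2(s_k),f_2(s_k)^{-1}\}$, $s_{k+1}=\min\{s\in S\mid s>s_k,\ f_1(s)\in A_k\}$, as long as the relevant sets are non-empty; this stops after finitely many steps with a finite set $\{s_1<\dots<s_m\}$ (possibly empty). Define $x\alpha_f=x\,f(s_1)f(s_2)\cdots f(s_m)$. Then $\alpha_f\in\mathrm{Aut}(F_\omega)$ and $\Psi([f])=\alpha_f$ is a well-defined homomorphism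 $\mathrm{BF}(\mathcal E;\mathcal S)\to\mathrm{Aut}(F_\omega)$. *)

theory Defs
  imports "HOL-Algebra.Bij" "HOL-Library.Countable_Set"
begin

section \<open>Free groups\<close>

text \<open>The letter \<open>(a, True)\<close> is the basis element \<open>a\<close>, and \<open>(a, False)\<close> is its formal inverse.
  So \<open>'a letter\<close> is the set \<open>X\<^sup>\<plusminus>\<close> for the basis \<open>X\<close> indexed by the type \<open>'a\<close>.\<close>

type_synonym 'a letter = "'a \<times> bool"

definition linv :: "'a letter \<Rightarrow> 'a letter" where
  "linv x = (fst x, \<not> snd x)"

definition reduced :: "'a letter list \<Rightarrow> bool" where
  "reduced w \<longleftrightarrow> successively (\<lambda>x y. y \<noteq> linv x) w"

fun cons_reduce :: "'a letter \<Rightarrow> 'a letter list \<Rightarrow> 'a letter list" where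
  "cons_reduce x [] = [x]"
| "cons_reduce x (y # w) = (if y = linv x then w else x # y # w)"

definition free_group :: "'a letter list monoid" where
  "free_group =
    \<lparr>carrier = {w. reduced w},
     mult = (\<lambda>u v. foldr cons_reduce u v),
     one = []\<rparr>"

text \<open>The multiplicative extension to words of a map that is defined on \<open>X\<^sup>\<plusminus>\<close> and is compatible
  with inverses.\<close>

definition free_ext :: "('b, 'm) monoid_scheme \<Rightarrow> ('a letter \<Rightarrow> 'b) \<Rightarrow> 'a letter list \<Rightarrow> 'b" where
  "free_ext H h w = foldr (\<lambda>x b. h x \<otimes>\<^bsub>H\<^esub> b) w \<one>\<^bsub>H\<^esub>"

text \<open>Automorphisms act on the right, so the product \<open>\<phi>\<psi>\<close> applies \<open>\<phi>\<close> first; the library's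
  \<^const>\<open>AutoGroup\<close> uses the opposite multiplication.\<close>

definition right_Aut :: "('a, 'm) monoid_scheme \<Rightarrow> ('a \<Rightarrow> 'a) monoid" where
  "right_Aut G = AutoGroup G \<lparr>mult := \<lambda>\<phi> \<psi>. \<psi> \<otimes>\<^bsub>AutoGroup G\<^esub> \<phi>\<rparr>"

abbreviation F_omega :: "nat letter list monoid" where
  "F_omega \<equiv> free_group"

lemma linv_linv [simp]: "linv (linv x) = x"
  by (simp add: linv_def)

lemma linv_neq [simp]: "linv x \<noteq> x" "x \<noteq> linv x"
  by (auto simp: linv_def prod_eq_iff)

lemma linv_eq_iff [simp]: "linv x = linv y \<longleftrightarrow> x = y"
  by (metis linv_linv)

lemma reduced_simps [simp]:
  "reduced []" "reduced [x]"
  "reduced (x # y # w) \<longleftrightarrow> y \<noteq> linv x \<and> reduced (y # w)"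
  by (simp_all add: reduced_def)

lemma reduced_ConsD: "reduced (x # w) \<Longrightarrow> reduced w"
  by (cases w) auto

lemma reduced_cons_reduce [simp]: "reduced w \<Longrightarrow> reduced (cons_reduce x w)"
  by (cases w) (auto dest: reduced_ConsD)

lemma cons_reduce_reduced: "reduced (x # w) \<Longrightarrow> cons_reduce x w = x # w"
  by (cases w) auto

lemma cons_reduce_linv [simp]:
  "reduced w \<Longrightarrow> cons_reduce x (cons_reduce (linv x) w) = w"
  by (cases w) (auto simp: cons_reduce_reduced)

lemma cons_reduce_linv' [simp]:
  "reduced w \<Longrightarrow> cons_reduce (linv x) (cons_reduce x w) = w"
  using cons_reduce_linv[of w "linv x"] by simp

lemma reduced_foldr [simp]: "reduced v \<Longrightarrow> reduced (foldr cons_reduce u v)"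
  by (induction u) auto

lemma foldr_cons_reduce_Nil: "reduced u \<Longrightarrow> foldr cons_reduce u [] = u"
proof (induction u)
  case (Cons x u)
  then show ?case
    using reduced_ConsD[of x u] by (simp add: cons_reduce_reduced)
qed simp

lemma foldr_cons_reduce:
  "reduced w \<Longrightarrow> foldr cons_reduce (cons_reduce x v) w = cons_reduce x (foldr cons_reduce v w)"
  by (cases v) auto

lemma foldr_cons_reduce_assoc:
  "reduced w \<Longrightarrow>
    foldr cons_reduce (foldr cons_reduce u v) w = foldr cons_reduce u (foldr cons_reduce v w)"
  by (induction u) (auto simp: foldr_cons_reduce)

lemma foldr_cons_reduce_inverse:
  "reduced v \<Longrightarrow> foldr cons_reduce (rev (map linv u)) (foldr cons_reduce u v) = v"
  by (induction u arbitrary: v) auto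

lemma reduced_inverse: "reduced u \<Longrightarrow> reduced (rev (map linv u))"
proof -
  assume "reduced u"
  then have "successively (\<lambda>x y. y \<noteq> linv x) u"
    by (simp add: reduced_def)
  then have "successively (\<lambda>x y. x \<noteq> linv y) u"
    by (rule successively_mono) (metis linv_linv)
  then show ?thesis
    by (simp add: reduced_def successively_map)
qed

lemma group_free_group: "group (free_group :: 'a letter list monoid)"
proof (rule groupI)
  fix u :: "'a letter list"
  assume u: "u \<in> carrier free_group"
  then have "rev (map linv u) \<otimes>\<^bsub>free_group\<^esub> u = \<one>\<^bsub>free_group\<^esub>"
    using foldr_cons_reduce_inverse[of "[]" u] by (simp add: free_group_def foldr_cons_reduce_Nil)
  with u show "\<exists>v\<in>carrier free_group. v \<otimes>\<^bsub>free_group\<^esub> u = \<one>\<^bsub>free_group\<^esub>"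
    using reduced_inverse[of u] by (auto simp: free_group_def)
qed (auto simp: free_group_def foldr_cons_reduce_assoc)

lemma free_ext_hom:
  assumes H: "group H" and h: "\<And>x. h x \<in> carrier H"
    and h_inv: "\<And>x. h (linv x) = inv\<^bsub>H\<^esub> (h x)"
  shows "free_ext H h \<in> hom free_group H"
    and "free_ext H h [x] = h x"
proof -
  interpret H: group H by (rule H)
  have closed: "free_ext H h w \<in> carrier H" for w
    by (induction w) (auto simp: free_ext_def h)
  have step: "free_ext H h (cons_reduce x w) = h x \<otimes>\<^bsub>H\<^esub> free_ext H h w" for x w
  proof (cases w)
    case (Cons y v)
    show ?thesis
    proof (cases "y = linv x")
      case True
      have "h x \<otimes>\<^bsub>H\<^esub> (inv\<^bsub>H\<^esub> (h x) \<otimes>\<^bsub>H\<^esub> free_ext H h v) = free_ext H h v"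
        by (simp add: H.m_assoc[symmetric] h closed)
      with True Cons show ?thesis
        by (simp add: free_ext_def h_inv)
    qed (simp add: Cons free_ext_def)
  qed (simp add: free_ext_def)
  have "free_ext H h (foldr cons_reduce u v) = free_ext H h u \<otimes>\<^bsub>H\<^esub> free_ext H h v" for u v
  proof (induction u)
    case Nil
    show ?case using closed[of v] by (simp add: free_ext_def)
  next
    case (Cons x u)
    have "free_ext H h (x # u) = h x \<otimes>\<^bsub>H\<^esub> free_ext H h u"
      by (simp add: free_ext_def)
    with Cons show ?case
      by (simp add: step H.m_assoc h closed)
  qed
  then show "free_ext H h \<in> hom free_group H"
    using closed by (auto simp: hom_def free_group_def)
  show "free_ext H h [x] = h x"
    by (simp add: free_ext_def h)
qed


section \<open>Big free groups\<close>

text \<open>A map \<open>f : S \<rightarrow> \<Lambda>\<close> with \<open>S\<close> totally ordered is given by the reflexive order relation of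
  \<open>S\<close>, whose field is \<open>S\<close>, and a labelling function that is only relevant on \<open>S\<close>.\<close>

record ('s, 'l) oword =
  leq :: "'s rel"
  lab :: "'s \<Rightarrow> 'l"

abbreviation dom_of :: "('s, 'l) oword \<Rightarrow> 's set" where
  "dom_of f \<equiv> Field (leq f)"

definition owords :: "'l set \<Rightarrow> ('s, 'l) oword set" where
  "owords \<Lambda> = {f. Linear_order (leq f) \<and> lab f ` dom_of f \<subseteq> \<Lambda> \<and>
                  (\<forall>l\<in>\<Lambda>. finite {s \<in> dom_of f. lab f s = l})}"

definition oword_iso :: "('s, 'l) oword \<Rightarrow> ('t, 'l) oword \<Rightarrow> bool" where
  "oword_iso f g \<longleftrightarrow>
    (\<exists>\<phi>. bij_betw \<phi> (dom_of f) (dom_of g) \<and>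
         (\<forall>s\<in>dom_of f. \<forall>t\<in>dom_of f. (s, t) \<in> leq f \<longleftrightarrow> (\<phi> s, \<phi> t) \<in> leq g) \<and>
         (\<forall>s\<in>dom_of f. lab f s = lab g (\<phi> s)))"

text \<open>For countable \<open>\<Lambda>\<close> every domain \<open>S\<close> is countable, so that up to identification all elements
  of \<open>\<T>(\<Lambda>)\<close> have a subset of \<open>nat\<close> as domain, with an arbitrary total order on it.\<close>

lemma oword_iso_nat:
  fixes f :: "('s, 'l) oword"
  assumes f: "f \<in> owords \<Lambda>" and "countable \<Lambda>"
  shows "\<exists>g :: (nat, 'l) oword. g \<in> owords \<Lambda> \<and> oword_iso f g"
proof -
  let ?S = "dom_of f"
  have "?S = (\<Union>l\<in>\<Lambda>. {s \<in> ?S. lab f s = l})"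
    using f by (auto simp: owords_def)
  moreover have "countable (\<Union>l\<in>\<Lambda>. {s \<in> ?S. lab f s = l})"
    using f \<open>countable \<Lambda>\<close> by (intro countable_UN) (auto simp: owords_def countable_finite)
  ultimately have "countable ?S"
    by simp
  then obtain e :: "'s \<Rightarrow> nat" where e: "inj_on e ?S"
    by (auto simp: countable_def)
  define g :: "(nat, 'l) oword"
    where "g = \<lparr>leq = map_prod e e ` leq f, lab = (\<lambda>n. lab f (inv_into ?S e n))\<rparr>"
  have dom: "dom_of g = e ` ?S"
    unfolding g_def Field_def by force
  have leq: "(e s, e t) \<in> leq g \<longleftrightarrow> (s, t) \<in> leq f" if "s \<in> ?S" "t \<in> ?S" for s t
  proof
    assume "(e s, e t) \<in> leq g"
    then obtain s' t' where "(s', t') \<in> leq f" "e s = e s'" "e t = e t'"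
      by (auto simp: g_def)
    moreover from this have "s' \<in> ?S" "t' \<in> ?S"
      by (auto simp: FieldI1 FieldI2)
    ultimately show "(s, t) \<in> leq f"
      using that e by (metis inj_onD)
  qed (force simp: g_def)
  have lab: "lab g (e s) = lab f s" if "s \<in> ?S" for s
    using that e by (simp add: g_def)
  have lin: "Linear_order (leq f)"
    using f by (simp add: owords_def)
  have "Refl (leq g)"
    unfolding refl_on_def dom using lin leq by (auto simp: order_on_defs refl_on_def)
  moreover have "trans (leq g)"
  proof (rule transI)
    fix x y z assume *: "(x, y) \<in> leq g" "(y, z) \<in> leq g"
    then have "x \<in> e ` ?S" "y \<in> e ` ?S" "z \<in> e ` ?S"
      using dom by (auto intro: FieldI1 FieldI2)
    then obtain r s t where "x = e r" "y = e s" "z = e t" "r \<in> ?S" "s \<in> ?S" "t \<in> ?S"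
      by auto
    with * leq lin show "(x, z) \<in> leq g"
      by (metis order_on_defs(1-3) transD)
  qed
  moreover have "antisym (leq g)"
  proof (rule antisymI)
    fix x y assume *: "(x, y) \<in> leq g" "(y, x) \<in> leq g"
    then have "x \<in> e ` ?S" "y \<in> e ` ?S"
      using dom by (auto intro: FieldI1 FieldI2)
    then obtain r s where "x = e r" "y = e s" "r \<in> ?S" "s \<in> ?S"
      by auto
    with * leq lin show "x = y"
      by (metis order_on_defs(2,3) antisymD)
  qed
  moreover have "Total (leq g)"
    unfolding total_on_def dom using lin leq by (fastforce simp: order_on_defs total_on_def)
  moreover have "leq g \<subseteq> dom_of g \<times> dom_of g"
    by (auto intro: FieldI1 FieldI2)
  ultimately have "Linear_order (leq g)"
    by (simp add: order_on_defs)
  moreover have "lab g ` dom_of g \<subseteq> \<Lambda>"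
    using f lab by (auto simp: dom owords_def)
  moreover have "finite {n \<in> dom_of g. lab g n = l}" if "l \<in> \<Lambda>" for l
  proof -
    have "{n \<in> dom_of g. lab g n = l} \<subseteq> e ` {s \<in> ?S. lab f s = l}"
      using lab by (auto simp: dom)
    moreover have "finite {s \<in> ?S. lab f s = l}"
      using f that by (simp add: owords_def)
    ultimately show ?thesis
      by (meson finite_imageI finite_subset)
  qed
  ultimately have "g \<in> owords \<Lambda>"
    by (simp add: owords_def)
  moreover have "oword_iso f g"
    unfolding oword_iso_def
    by (rule exI[of _ e]) (use e leq lab in \<open>auto simp: dom bij_betw_def\<close>)
  ultimately show ?thesis
    by blast
qed

definition oword_remove :: "('s, 'l) oword \<Rightarrow> 's set \<Rightarrow> ('s, 'l) oword" where
  "oword_remove f T = f\<lparr>leq := Restr (leq f) (dom_of f - T)\<rparr>"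

definition oword_interval :: "('s, 'l) oword \<Rightarrow> 's \<Rightarrow> 's \<Rightarrow> 's set" where
  "oword_interval f s t = {x. (s, x) \<in> leq f \<and> (x, t) \<in> leq f}"

text \<open>The relation \<open>f \<searrow> g\<close>; \<open>linverse\<close> is the fixed-point-free involution of \<open>\<Lambda>\<close>.\<close>

definition oword_cancel :: "('l \<Rightarrow> 'l) \<Rightarrow> ('s, 'l) oword \<Rightarrow> ('s, 'l) oword \<Rightarrow> bool" where
  "oword_cancel linverse f g \<longleftrightarrow>
    (\<exists>T \<subseteq> dom_of f. oword_iso g (oword_remove f T) \<and>
      (\<exists>star. (\<forall>t\<in>T. star t \<in> T \<and> star (star t) = t) \<and>
        (\<forall>t\<in>T. lab f (star t) = linverse (lab f t) \<and>
               oword_interval f t (star t) \<subseteq> T \<and>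
               star ` oword_interval f t (star t) = oword_interval f t (star t))))"

text \<open>The equivalence relation \<open>\<approx>\<close> on \<open>\<T>(\<Lambda>)\<close> generated by \<open>\<searrow>\<close>. Isomorphic words are
  equivalent because \<open>T = {}\<close> is allowed above.\<close>

definition oword_equiv :: "'l set \<Rightarrow> ('l \<Rightarrow> 'l) \<Rightarrow> ('s, 'l) oword rel" where
  "oword_equiv \<Lambda> linverse =
    (let R = {(f, g). f \<in> owords \<Lambda> \<and> g \<in> owords \<Lambda> \<and> oword_cancel linverse f g}
     in Restr ((R \<union> R\<inverse>)\<^sup>*) (owords \<Lambda>))"

definition oword_bar :: "('l \<Rightarrow> 'l) \<Rightarrow> ('s, 'l) oword \<Rightarrow> ('s, 'l) oword" where
  "oword_bar linverse f = \<lparr>leq = (leq f)\<inverse>, lab = (\<lambda>s. linverse (lab f s))\<rparr>"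

text \<open>Concatenation: the domain is the disjoint union of the two domains, with the first one
  embedded in the even and the second one in the odd numbers.\<close>

definition oword_concat :: "(nat, 'l) oword \<Rightarrow> (nat, 'l) oword \<Rightarrow> (nat, 'l) oword" where
  "oword_concat f g =
    \<lparr>leq = {(2 * s, 2 * t) | s t. (s, t) \<in> leq f} \<union>
           {(2 * s + 1, 2 * t + 1) | s t. (s, t) \<in> leq g} \<union>
           {(2 * s, 2 * t + 1) | s t. s \<in> dom_of f \<and> t \<in> dom_of g},
     lab = (\<lambda>n. if even n then lab f (n div 2) else lab g (n div 2))\<rparr>"

definition oword_empty :: "('s, 'l) oword" where
  "oword_empty = \<lparr>leq = {}, lab = (\<lambda>_. undefined)\<rparr>"

text \<open>The group \<open>BF(\<Lambda>;\<S>)\<close> of the classes \<open>[f]\<close> with \<open>f \<in> \<S>\<close>. Such a class may also contain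
  elements of \<open>\<T>(\<Lambda>)\<close> outside \<open>\<S>\<close>.\<close>

definition BF :: "'l set \<Rightarrow> ('l \<Rightarrow> 'l) \<Rightarrow> (nat, 'l) oword set \<Rightarrow> (nat, 'l) oword set monoid" where
  "BF \<Lambda> linverse \<S> =
    \<lparr>carrier = (\<lambda>f. oword_equiv \<Lambda> linverse `` {f}) ` \<S>,
     mult = (\<lambda>A B. \<Union>f\<in>A. \<Union>g\<in>B. oword_equiv \<Lambda> linverse `` {oword_concat f g}),
     one = oword_equiv \<Lambda> linverse `` {oword_empty}\<rparr>"


section \<open>Elementary automorphisms and the map \<open>\<Psi>\<close>\<close>

type_synonym xletter = "nat letter"

text \<open>\<open>x \<mapsto> xy\<close>, hence \<open>x\<^sup>-\<^sup>1 \<mapsto> y\<^sup>-\<^sup>1x\<^sup>-\<^sup>1\<close>; all other elements of \<open>X\<^sup>\<plusminus>\<close> are fixed.\<close>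

definition elem_aut :: "xletter \<Rightarrow> xletter \<Rightarrow> xletter list \<Rightarrow> xletter list" where
  "elem_aut x y =
    restrict (free_ext F_omega
      (\<lambda>z. if z = x then [x, y] else if z = linv x then [linv y, linv x] else [z]))
      (carrier F_omega)"

text \<open>The automorphism \<open>E\<^sub>x\<^sub>y\<close> is encoded by the pair \<open>(x, y)\<close>, which it determines by
  \<open>inj_on_elem_aut\<close> below; its inverse is \<open>E\<^sub>x\<^sub>z\<close> with \<open>z = y\<^sup>-\<^sup>1\<close>.\<close>

type_synonym elem = "xletter \<times> xletter"

definition elems :: "elem set" where
  "elems = {(x, y). y \<noteq> x \<and> y \<noteq> linv x}"

definition elem_inv :: "elem \<Rightarrow> elem" where
  "elem_inv = (\<lambda>(x, y). (x, linv y))"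

lemma countable_elems: "countable elems"
  by simp

lemma elem_aut_inverse:
  assumes "(x, y) \<in> elems" "w \<in> carrier F_omega"
  shows "elem_aut x (linv y) (elem_aut x y w) = w"
    and "elem_aut x y \<in> auto F_omega"
proof -
  interpret F: group F_omega by (rule group_free_group)
  have hom: "elem_aut x z \<in> hom F_omega F_omega"
    and letter: "elem_aut x z [v] =
      (if v = x then [x, z] else if v = linv x then [linv z, linv x] else [v])"
    if xz: "(x, z) \<in> elems" for z v
  proof -
    let ?h = "\<lambda>v. if v = x then [x, z] else if v = linv x then [linv z, linv x] else [v]"
    have red: "?h v \<in> carrier F_omega" for v
      using xz by (auto simp: elems_def free_group_def)
    have "?h (linv v) \<otimes>\<^bsub>F_omega\<^esub> ?h v = \<one>\<^bsub>F_omega\<^esub>" for v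
      using xz by (auto simp: elems_def free_group_def)
    then have inv: "?h (linv v) = inv\<^bsub>F_omega\<^esub> (?h v)" for v
      by (intro F.inv_equality[symmetric] red)
    note ext = free_ext_hom[OF group_free_group, of ?h, OF red inv]
    have *: "free_ext F_omega ?h \<in> hom F_omega F_omega" "free_ext F_omega ?h [v] = ?h v"
      by (rule ext(1), rule ext(2))
    then show "elem_aut x z \<in> hom F_omega F_omega"
      unfolding elem_aut_def by (auto simp: hom_def Pi_iff)
    from * show "elem_aut x z [v] = ?h v"
      by (simp add: elem_aut_def free_group_def)
  qed
  have inverse: "elem_aut x (linv z) (elem_aut x z w) = w"
    if xz: "(x, z) \<in> elems" and w: "w \<in> carrier F_omega" for z w
  proof -
    have xz': "(x, linv z) \<in> elems"
      using xz by (auto simp: elems_def)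
    let ?k = "elem_aut x (linv z) \<circ> elem_aut x z"
    have k: "?k \<in> hom F_omega F_omega"
      using hom[OF xz] hom[OF xz'] by (rule hom_compose)
    have kv: "?k [v] = [v]" for v
    proof -
      have split: "elem_aut x (linv z) [a, b] =
          elem_aut x (linv z) [a] \<otimes>\<^bsub>F_omega\<^esub> elem_aut x (linv z) [b]" if "b \<noteq> linv a" for a b
      proof -
        have "elem_aut x (linv z) ([a] \<otimes>\<^bsub>F_omega\<^esub> [b]) =
              elem_aut x (linv z) [a] \<otimes>\<^bsub>F_omega\<^esub> elem_aut x (linv z) [b]"
          using hom[OF xz'] by (intro hom_mult) (auto simp: free_group_def)
        with that show ?thesis
          by (simp add: free_group_def)
      qed
      have "z \<noteq> x" "z \<noteq> linv x"
        using xz by (auto simp: elems_def)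
      moreover from this have "linv z \<noteq> x" "linv z \<noteq> linv x" "linv x \<noteq> linv (linv z)"
        by (metis linv_linv)+
      moreover have "?k [v] = elem_aut x (linv z) (elem_aut x z [v])"
        by simp
      ultimately show ?thesis
        unfolding letter[OF xz]
        by (cases "v = x"; cases "v = linv x")
          (simp_all add: split letter[OF xz'], simp_all add: free_group_def)
    qed
    show ?thesis
      using w
    proof (induction w)
      case Nil
      show ?case
        using hom_one[OF k group_free_group group_free_group] by (simp add: free_group_def)
    next
      case (Cons a w)
      then have "reduced w" "a # w = [a] \<otimes>\<^bsub>F_omega\<^esub> w"
        by (auto simp: free_group_def cons_reduce_reduced dest: reduced_ConsD)
      moreover from this have "?k ([a] \<otimes>\<^bsub>F_omega\<^esub> w) = ?k [a] \<otimes>\<^bsub>F_omega\<^esub> ?k w"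
        by (intro hom_mult[OF k]) (auto simp: free_group_def)
      ultimately show ?case
        using Cons kv by (simp add: free_group_def)
    qed
  qed
  show "elem_aut x (linv y) (elem_aut x y w) = w"
    by (rule inverse[OF assms])
  have xy': "(x, linv y) \<in> elems"
    using assms(1) by (auto simp: elems_def)
  have closed: "elem_aut x z u \<in> carrier F_omega"
    if "(x, z) \<in> elems" "u \<in> carrier F_omega" for z u
    using hom[OF that(1)] that(2) by (auto simp: hom_def)
  have "bij_betw (elem_aut x y) (carrier F_omega) (carrier F_omega)"
    by (rule bij_betwI[where g = "elem_aut x (linv y)"])
      (use inverse[OF assms(1)] inverse[OF xy'] closed[OF assms(1)] closed[OF xy'] in auto)
  then show "elem_aut x y \<in> auto F_omega"
    using hom[OF assms(1)] by (simp add: auto_def Bij_def elem_aut_def)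
qed

lemma inj_on_elem_aut: "inj_on (\<lambda>(x, y). elem_aut x y) elems"
proof -
  have letter: "elem_aut x z [v] =
      (if v = x then [x, z] else if v = linv x then [linv z, linv x] else [v])"
    if "(x, z) \<in> elems" for x z v
    using that by (auto simp: elem_aut_def free_ext_def free_group_def elems_def)
  have eq: "x = x' \<and> y = y'"
    if "(x, y) \<in> elems" "(x', y') \<in> elems" "elem_aut x y = elem_aut x' y'" for x y x' y'
  proof -
    have "y \<noteq> x"
      using that(1) by (simp add: elems_def)
    moreover have "[x, y] =
        (if x = x' then [x', y'] else if x = linv x' then [linv y', linv x'] else [x])"
      using letter[OF that(1), of x] letter[OF that(2), of x] that(3) by simp
    ultimately show ?thesis
      by (metis list.inject list.discI)
  qed
  show ?thesis
  proof (rule inj_onI)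
    fix p q
    assume "p \<in> elems" "q \<in> elems" "(case p of (x, y) \<Rightarrow> elem_aut x y) = (case q of (x, y) \<Rightarrow> elem_aut x y)"
    then show "p = q"
      using eq[of "fst p" "snd p" "fst q" "snd q"] by (simp add: case_prod_beta prod_eqI)
  qed
qed

abbreviation lab1 :: "('s, elem) oword \<Rightarrow> 's \<Rightarrow> xletter" where
  "lab1 f s \<equiv> fst (lab f s)"

abbreviation lab2 :: "('s, elem) oword \<Rightarrow> 's \<Rightarrow> xletter" where
  "lab2 f s \<equiv> snd (lab f s)"

definition S_0 :: "('s, elem) oword set" where
  "S_0 = {f \<in> owords elems. \<forall>x. finite {s \<in> dom_of f. lab1 f s = x}}"

definition S_1 :: "('s, elem) oword set" where
  "S_1 = {f \<in> owords elems.
    \<not> (\<exists>\<phi> :: nat \<Rightarrow> 's. inj \<phi> \<and> range \<phi> \<subseteq> dom_of f \<and>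
        (\<forall>m n. m \<le> n \<longrightarrow> (\<phi> m, \<phi> n) \<in> leq f) \<and>
        (\<forall>n. lab1 f (\<phi> (Suc n)) \<in> {lab2 f (\<phi> n), linv (lab2 f (\<phi> n))}))}"

definition SS :: "('s, elem) oword set" where
  "SS = {f. f \<in> S_0 \<and> f \<in> S_1 \<and> oword_bar elem_inv f \<in> S_1}"

definition least_wrt :: "'s rel \<Rightarrow> 's set \<Rightarrow> 's" where
  "least_wrt r C = (THE s. s \<in> C \<and> (\<forall>t\<in>C. (s, t) \<in> r))"

text \<open>\<open>trace f x k\<close> is the pair of \<open>A\<^sub>k\<close> and \<open>[s\<^sub>1, \<dots>, s\<^sub>k]\<close>, and it stays constant from the first
  stage on at which there is no candidate for the next position.\<close>

primrec trace :: "('s, elem) oword \<Rightarrow> xletter \<Rightarrow> nat \<Rightarrow> xletter set \<times> 's list" where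
  "trace f x 0 = ({x, linv x}, [])"
| "trace f x (Suc k) =
    (let (A, ss) = trace f x k;
         C = {s \<in> dom_of f. lab1 f s \<in> A \<and>
                (ss \<noteq> [] \<longrightarrow> (last ss, s) \<in> leq f \<and> s \<noteq> last ss)};
         s = least_wrt (leq f) C
     in if C = {} then (A, ss) else (A \<union> {lab2 f s, linv (lab2 f s)}, ss @ [s]))"

definition positions :: "('s, elem) oword \<Rightarrow> xletter \<Rightarrow> 's list" where
  "positions f x = snd (trace f x (LEAST k. trace f x (Suc k) = trace f x k))"

definition alpha_letter :: "('s, elem) oword \<Rightarrow> xletter \<Rightarrow> xletter list" where
  "alpha_letter f x = fold (\<lambda>s. elem_aut (lab1 f s) (lab2 f s)) (positions f x) [x]"

definition alpha :: "('s, elem) oword \<Rightarrow> xletter list \<Rightarrow> xletter list" where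
  "alpha f = restrict (free_ext F_omega (alpha_letter f)) (carrier F_omega)"

abbreviation BF_E :: "(nat, elem) oword set monoid" where
  "BF_E \<equiv> BF elems elem_inv SS"

text \<open>\<open>\<Psi>([f]) = \<alpha>\<^sub>f\<close> for \<open>f \<in> \<S>\<close>: the common value of \<open>\<alpha>\<close> on the representatives of the class
  that lie in \<open>\<S>\<close>.\<close>

definition Psi :: "(nat, elem) oword set \<Rightarrow> xletter list \<Rightarrow> xletter list" where
  "Psi C = the_elem (alpha ` (C \<inter> SS))"

end

(*
  Surjectivity. Let \<theta> be an automorphism of F_omega. Nielsen reduction of the first few images of
  \<theta>, relative to an initial part of the basis that \<theta> fixes, gives a finite product L of
  elementary automorphisms such that L \<theta> fixes a longer initial part of the basis, and L only
  changes letters that were not fixed before. Applying this alternately to \<theta>_k and to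
  \<theta>_(k+1) = (L_k \<theta>_k)^-1 yields
    \<theta> = \<theta>_0 = L_0^-1 L_2^-1 ... L_2K^-1 \<theta>_(2K+2) L_(2K+1) ... L_3 L_1,
  which converges to the product over a word of order type \<omega> + \<omega>^*. Block k+2 only changes
  letters that do not occur in block k, so a chain as in the definition of S_1 cannot pass from
  block k to a block beyond k+1; together with the order of the blocks this makes chains finite in
  both directions.

  Well-definedness. The value of \<alpha>_f on a given word equals the finite product over the part of f
  with labels in any sufficiently large finite set. For a fixed finite set of labels that is closed
  under inverses, this product is invariant under cancellation, even for words outside SS, and it is
  multiplicative; this avoids normal forms in the big free group.
*)
theory Submission
  imports Defs Complex_Main "HOL-Library.Nat_Bijection"
begin

section \<open>Words in the free group\<close>

text \<open>Why the automorphism is inverted at every step: \<open>L k\<close> is known only after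
  its goal \<open>n (Suc k)\<close> has been set, so it may bring in letters of index at least
  \<open>n (Suc k)\<close>, and block \<open>k + 1\<close> may change these. Peeling factors off one
  side only would line up all blocks in a single sequence, and nothing would prevent a chain from
  running through every block. Inverting sends blocks of opposite parity to opposite ends.
  Neighbours at the same end then differ by two, and \<open>n (Suc (Suc k))\<close> is still free
  when \<open>L k\<close> is found, so it can be put above every letter of \<open>L k\<close>. Why
  Nielsen reduction is relative: first labels have to grow from block to block, both for
  \<open>S_0\<close> and for the chains, so transvections that change already fixed letters are
  forbidden. A minimal system is therefore minimal only among the allowed transvections; for the
  fixed letters the cancellation bounds come from their images having length one.\<close>

abbreviation wmul :: "'a letter list \<Rightarrow> 'a letter list \<Rightarrow> 'a letter list" where
  "wmul u v \<equiv> foldr cons_reduce u v"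

abbreviation winv :: "'a letter list \<Rightarrow> 'a letter list" where
  "winv u \<equiv> rev (map linv u)"

lemma free_group_simps [simp]:
  "carrier free_group = {w. reduced w}" "mult free_group u v = wmul u v" "one free_group = []"
  by (simp_all add: free_group_def)

lemma fst_linv [simp]: "fst (linv x) = fst x"
  by (simp add: linv_def)

lemma letter_cases: "fst x = fst y \<Longrightarrow> x = y \<or> x = linv y"
  by (cases x; cases y) (auto simp: linv_def)

lemma winv_winv [simp]: "winv (winv u) = u"
  by (simp add: rev_map comp_def)

lemma winv_append [simp]: "winv (u @ v) = winv v @ winv u"
  by simp

lemma reduced_winv [simp]: "reduced (rev (map linv u)) \<longleftrightarrow> reduced u"
  using reduced_inverse[of u] reduced_inverse[of "winv u"] winv_winv[of u] by metis

lemma reduced_append_iff: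
  "reduced (u @ v) \<longleftrightarrow> reduced u \<and> reduced v \<and> (u \<noteq> [] \<longrightarrow> v \<noteq> [] \<longrightarrow> hd v \<noteq> linv (last u))"
  unfolding reduced_def successively_append_iff by blast

lemma wmul_reduced: "reduced (u @ v) \<Longrightarrow> wmul u v = u @ v"
proof (induction u)
  case (Cons x u)
  then show ?case
    using reduced_ConsD[of x "u @ v"] by (simp add: cons_reduce_reduced)
qed simp

lemma set_cons_reduce: "set (cons_reduce x w) \<subseteq> insert x (set w)"
  by (cases w) auto

lemma set_wmul: "set (wmul u v) \<subseteq> set u \<union> set v"
  by (induction u) (use set_cons_reduce in fastforce)+

lemma length_cons_reduce: "length (cons_reduce x w) \<le> Suc (length w)"
  by (cases w) auto

lemma wmul_length: "length (wmul u v) \<le> length u + length v"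
proof (induction u)
  case (Cons x u)
  then show ?case
    using length_cons_reduce[of x "wmul u v"] by simp
qed simp

lemma wmul_append_eq: "length (wmul u v) = length u + length v \<Longrightarrow> wmul u v = u @ v"
proof (induction u)
  case (Cons x u)
  have "length (wmul u v) = length u + length v"
    using Cons.prems length_cons_reduce[of x "wmul u v"] wmul_length[of u v] by simp
  then have "wmul u v = u @ v"
    by (rule Cons.IH)
  with Cons.prems have "length (cons_reduce x (u @ v)) = Suc (length (u @ v))"
    by simp
  then have "cons_reduce x (u @ v) = x # (u @ v)"
    by (cases "u @ v") (simp_all split: if_splits)
  with \<open>wmul u v = u @ v\<close> show ?case
    by simp
qed simp

lemma wmul_cancel:
  assumes "reduced (d @ w)"
  shows "wmul (u @ winv d) (d @ w) = wmul u w"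
proof -
  have "wmul d w = d @ w" "reduced w"
    using assms wmul_reduced reduced_append_iff by blast+
  then show ?thesis
    using foldr_cons_reduce_inverse[of w d] by simp
qed

lemma wmul_winv_self [simp]: "reduced u \<Longrightarrow> wmul (winv u) u = []" "reduced u \<Longrightarrow> wmul u (winv u) = []"
proof -
  have *: "wmul (winv u) u = []" if "reduced u" for u :: "'a letter list"
    using wmul_cancel[of u "[]" "[]"] that by simp
  show "reduced u \<Longrightarrow> wmul (winv u) u = []" by (rule *)
  show "reduced u \<Longrightarrow> wmul u (winv u) = []" using *[of "winv u"] by simp
qed

lemma winv_unique: "reduced u \<Longrightarrow> reduced v \<Longrightarrow> wmul u v = [] \<Longrightarrow> v = winv u"
  by (metis foldr_cons_reduce_Nil foldr_cons_reduce_inverse reduced_winv)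

lemma winv_wmul:
  assumes "reduced u" "reduced v"
  shows "winv (wmul u v) = wmul (winv v) (winv u)"
proof -
  have "wmul (winv v) (winv u) = wmul (wmul (winv v) (winv u)) []"
    using assms by (simp add: foldr_cons_reduce_Nil)
  have "wmul (wmul u v) (wmul (winv v) (winv u)) = wmul u (wmul v (wmul (winv v) (winv u)))"
    using assms by (simp add: foldr_cons_reduce_assoc del: foldr_append)
  also have "\<dots> = wmul u (winv u)"
    using foldr_cons_reduce_inverse[of "winv u" "winv v"] assms by simp
  also have "\<dots> = []"
    using assms by simp
  finally show ?thesis
    using winv_unique[of "wmul u v" "wmul (winv v) (winv u)"] assms by simp
qed

text \<open>The last letter of \<open>u\<close> is matched against the first of \<open>v\<close>
  until they no longer cancel; that \<open>d\<close> is the largest piece that disappears is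
  recorded by \<open>reduced (A @ B)\<close>.\<close>

lemma cancellation_decomposition:
  assumes "reduced u" "reduced v"
  obtains A d B where "u = A @ winv d" "v = d @ B" "reduced (A @ B)" "wmul u v = A @ B"
proof -
  have "\<exists>A d B. u = A @ winv d \<and> v = d @ B \<and> reduced (A @ B)"
    using assms
  proof (induction u arbitrary: v rule: rev_induct)
    case (snoc x u)
    show ?case
    proof (cases "v \<noteq> [] \<and> hd v = linv x")
      case True
      then obtain w where v: "v = linv x # w"
        by (cases v) auto
      then obtain A d B where "u = A @ winv d" "w = d @ B" "reduced (A @ B)"
        using snoc.IH[of w] snoc.prems reduced_append_iff reduced_ConsD by metis
      then have "u @ [x] = A @ winv (linv x # d)" "v = (linv x # d) @ B" "reduced (A @ B)"
        using v by simp_all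
      then show ?thesis by blast
    next
      case False
      then have "reduced ((u @ [x]) @ v)"
        using snoc.prems by (subst reduced_append_iff) auto
      then show ?thesis
        by (intro exI[of _ "u @ [x]"] exI[of _ "[]"] exI[of _ v]) simp
    qed
  qed (auto intro: exI[of _ "[]"])
  then obtain A d B where *: "u = A @ winv d" "v = d @ B" "reduced (A @ B)"
    by blast
  then have "wmul u v = A @ B"
    using wmul_cancel[of d B A] wmul_reduced[of A B] assms by simp
  with * that show ?thesis by blast
qed

text \<open>Look at the centre: for even length the two middle letters would be adjacent inverses,
  for odd length the middle letter would be its own inverse.\<close>

lemma winv_eq_self:
  assumes "reduced e" "winv e = e"
  shows "e = []"
proof (rule ccontr)
  assume "e \<noteq> []"
  let ?n = "length e"
  have nth: "e ! i = linv (e ! (?n - 1 - i))" if "i < ?n" for i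
  proof -
    have "winv e ! i = linv (e ! (?n - 1 - i))"
      using that by (simp add: rev_nth)
    then show ?thesis by (simp only: assms(2))
  qed
  show False
  proof (cases "even ?n")
    case True
    then obtain m where m: "?n = 2 * m"
      by (elim evenE)
    moreover have "0 < ?n"
      using \<open>e \<noteq> []\<close> by simp
    ultimately have "Suc (m - 1) < ?n" "?n - 1 - (m - 1) = Suc (m - 1)"
      by linarith+
    then have "e ! (m - 1) = linv (e ! Suc (m - 1))"
      using nth[of "m - 1"] by simp
    moreover have "e ! Suc (m - 1) \<noteq> linv (e ! (m - 1))"
      using assms(1) \<open>Suc (m - 1) < ?n\<close> by (auto simp: reduced_def successively_conv_nth)
    ultimately show False by (metis linv_linv)
  next
    case False
    then obtain m where "?n = 2 * m + 1"
      by (elim oddE)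
    then show False
      using nth[of m] by simp
  qed
qed

text \<open>A reduced word loses at most half of itself against its own copy: the excess
  \<open>e\<close> of \<open>d\<close> over \<open>A\<close> would sit in the middle of
  \<open>u\<close> and equal its own inverse.\<close>

lemma square_cancellation:
  assumes "reduced u" "u = A @ winv d" "u = d @ B"
  shows "length d \<le> length A"
proof (rule ccontr)
  assume *: "\<not> ?thesis"
  then obtain e where d: "d = A @ e"
    using assms by (metis append_eq_append_conv_if append_take_drop_id not_le order_less_imp_le)
  then have "winv d = e @ B" using assms by simp
  then have "d = winv B @ winv e" by (metis winv_append winv_winv)
  moreover have "length A = length B"
    using arg_cong[OF assms(2), of length] arg_cong[OF assms(3), of length] by simp
  ultimately have "e = winv e"
    using d by simp
  moreover have "reduced e"
    using assms d by (simp add: reduced_append_iff)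
  ultimately have "e = []"
    using winv_eq_self[of e] by simp
  with * d show False by simp
qed

section \<open>Products of elementary automorphisms\<close>

lemma elem_aut_letter:
  assumes "(x, y) \<in> elems"
  shows "elem_aut x y [v] = (if v = x then [x, y] else if v = linv x then [linv y, linv x] else [v])"
  using assms by (auto simp: elem_aut_def free_ext_def elems_def)

lemma elem_aut_iso:
  assumes "(x, y) \<in> elems"
  shows "elem_aut x y \<in> iso F_omega F_omega"
  using elem_aut_inverse(2)[of x y "[]"] assms by (simp add: iso_def auto_def Bij_def)

definition elem_prod :: "elem list \<Rightarrow> xletter list \<Rightarrow> xletter list" where
  "elem_prod L = fold (\<lambda>(x, y). elem_aut x y) L"

definition elems_inv :: "elem list \<Rightarrow> elem list" where
  "elems_inv L = rev (map elem_inv L)"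

lemma elem_prod_simps [simp]:
  "elem_prod [] w = w" "elem_prod ((x, y) # L) w = elem_prod L (elem_aut x y w)" "elem_prod (L @ L') w = elem_prod L' (elem_prod L w)"
  by (simp_all add: elem_prod_def)

lemma elem_inv_in_elems [simp]: "elem_inv e \<in> elems \<longleftrightarrow> e \<in> elems"
  by (cases e) (auto simp: elem_inv_def elems_def linv_def prod_eq_iff)

lemma elem_inv_simps [simp]:
  "elem_inv (elem_inv e) = e" "elem_inv e \<noteq> e" "e \<noteq> elem_inv e" "fst (elem_inv e) = fst e"
  "snd (elem_inv e) = linv (snd e)"
  by (cases e; simp add: elem_inv_def)+

lemma elems_inv_elems_inv [simp]: "elems_inv (elems_inv L) = L"
  by (simp add: elems_inv_def rev_map comp_def)

lemma elems_inv_elems [simp]: "set (elems_inv L) \<subseteq> elems \<longleftrightarrow> set L \<subseteq> elems"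
  by (auto simp: elems_inv_def)

lemma elem_prod_iso: "set L \<subseteq> elems \<Longrightarrow> elem_prod L \<in> iso F_omega F_omega"
proof (induction L)
  case (Cons e L)
  obtain x y where e: "e = (x, y)" by (cases e)
  have "elem_prod (e # L) = elem_prod L \<circ> elem_aut x y" by (simp add: fun_eq_iff e)
  moreover have "elem_prod L \<circ> elem_aut x y \<in> iso F_omega F_omega"
    using iso_set_trans[OF elem_aut_iso[of x y], of "elem_prod L" F_omega] Cons e by simp
  ultimately show ?case
    by (simp only: e)
qed (auto simp: iso_def hom_def bij_betw_def inj_on_def)

lemma iso_word:
  assumes "th \<in> iso F_omega F_omega"
  shows "reduced w \<Longrightarrow> reduced (th w)"
    and "reduced u \<Longrightarrow> reduced w \<Longrightarrow> th (wmul u w) = wmul (th u) (th w)"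
    and "th [] = []"
  using assms hom_one[OF _ group_free_group group_free_group, of th]
  by (auto simp: iso_def hom_def)

lemmas elem_prod_word = iso_word[OF elem_prod_iso]

lemma elem_prod_inverse:
  assumes "set L \<subseteq> elems" "reduced w"
  shows "elem_prod (elems_inv L) (elem_prod L w) = w"
  using assms
proof (induction L arbitrary: w)
  case (Cons e L)
  obtain x y where e: "e = (x, y)" by (cases e)
  then have "(x, y) \<in> elems" "reduced (elem_aut x y w)"
    using Cons.prems iso_word(1)[OF elem_aut_iso] by auto
  moreover from this have "elem_aut x (linv y) (elem_aut x y w) = w"
    using elem_aut_inverse(1)[of x y w] Cons.prems by simp
  ultimately show ?case
    using Cons by (simp add: e elems_inv_def elem_inv_def)
qed (simp add: elems_inv_def)

lemma elem_prod_inverse':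
  assumes "set L \<subseteq> elems" "reduced w"
  shows "elem_prod L (elem_prod (elems_inv L) w) = w"
  using elem_prod_inverse[of "elems_inv L" w] assms by simp

lemma word_hom_letters:
  assumes hom: "h \<in> hom F_omega F_omega" "k \<in> hom F_omega F_omega"
    and "reduced w" "\<And>x. x \<in> set w \<Longrightarrow> h [x] = k [x]"
  shows "h w = k w"
  using assms(3,4)
proof (induction w)
  case Nil
  show ?case
    using hom[THEN hom_one, OF group_free_group group_free_group] by simp
next
  case (Cons a w)
  then have "reduced w" "a # w = wmul [a] w"
    by (auto simp: cons_reduce_reduced dest: reduced_ConsD)
  moreover have "h (wmul [a] w) = wmul (h [a]) (h w)" "k (wmul [a] w) = wmul (k [a]) (k w)"
    using hom \<open>reduced w\<close> by (auto simp: hom_def simp del: foldr.simps)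
  moreover have "h w = k w" "h [a] = k [a]"
    using Cons.IH \<open>reduced w\<close> Cons.prems(2) by auto
  ultimately show ?case
    by metis
qed

lemma hom_winv:
  assumes h: "h \<in> hom F_omega F_omega" and w: "reduced w"
  shows "h (winv w) = winv (h w)"
proof -
  have "wmul (h w) (h (winv w)) = h (wmul w (winv w))"
    using hom_mult[OF h, of w "winv w"] w by simp
  also have "\<dots> = []"
    using hom_one[OF h group_free_group group_free_group] w by simp
  finally show ?thesis
    using hom_in_carrier[OF h, of w] hom_in_carrier[OF h, of "winv w"] w
    by (intro winv_unique) auto
qed

lemma hom_linv: "h \<in> hom F_omega F_omega \<Longrightarrow> h [linv x] = winv (h [x])"
  using hom_winv[of h "[x]"] by simp

text \<open>Basis indices are compared because an elementary automorphism moves its first label and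
  the inverse of it alike.\<close>

lemma elem_prod_fix:
  assumes "set L \<subseteq> elems" "reduced w" "\<And>e x. e \<in> set L \<Longrightarrow> x \<in> set w \<Longrightarrow> fst (fst e) \<noteq> fst x"
  shows "elem_prod L w = w"
  using assms
proof (induction L)
  case (Cons e L)
  obtain a b where e: "e = (a, b)" by (cases e)
  then have ab: "(a, b) \<in> elems" using Cons.prems by auto
  have "elem_aut a b w = id w"
  proof (rule word_hom_letters[where h = "elem_aut a b" and k = id])
    show "elem_aut a b \<in> hom F_omega F_omega"
      using elem_aut_iso[OF ab] by (simp add: iso_def)
    show "elem_aut a b [x] = id [x]" if "x \<in> set w" for x
      using Cons.prems(3)[of e x] that ab by (auto simp: elem_aut_letter e)
  qed (use Cons in \<open>auto simp: hom_def\<close>)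
  with Cons e show ?case by simp
qed simp

lemma set_elem_aut:
  assumes "(x, y) \<in> elems" "reduced w"
  shows "set (elem_aut x y w) \<subseteq> set w \<union> {y, linv y}"
  using assms(2)
proof (induction w)
  case Nil
  then show ?case using iso_word(3)[OF elem_aut_iso[OF assms(1)]] by simp
next
  case (Cons a w)
  then have w: "reduced w" "a # w = wmul [a] w"
    by (auto simp: cons_reduce_reduced dest: reduced_ConsD)
  then have "elem_aut x y (a # w) = wmul (elem_aut x y [a]) (elem_aut x y w)"
    using iso_word(2)[OF elem_aut_iso[OF assms(1)], of "[a]" w] by simp
  then have "set (elem_aut x y (a # w)) \<subseteq> set (elem_aut x y [a]) \<union> set (elem_aut x y w)"
    using set_wmul by metis
  moreover have "set (elem_aut x y [a]) \<subseteq> {a, y, linv y}"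
    by (auto simp: elem_aut_letter[OF assms(1)])
  ultimately show ?case
    using Cons.IH[OF w(1)] by auto
qed

text \<open>Only second labels enter: the letters that an elementary automorphism inserts are its
  second label and the inverse of that.\<close>

lemma elem_prod_bounded:
  assumes "set L \<subseteq> elems" "reduced w" "\<And>e. e \<in> set L \<Longrightarrow> fst (snd e) < n" "\<And>x. x \<in> set w \<Longrightarrow> fst x < n"
    "x \<in> set (elem_prod L w)"
  shows "fst x < n"
  using assms
proof (induction L arbitrary: w)
  case (Cons e L)
  obtain a b where e: "e = (a, b)" by (cases e)
  then have ab: "(a, b) \<in> elems" "fst b < n" using Cons.prems(1) Cons.prems(3)[of e] by auto
  show ?case
  proof (rule Cons.IH)
    show "reduced (elem_aut a b w)"
      using iso_word(1)[OF elem_aut_iso[OF ab(1)]] Cons.prems by simp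
    show "fst z < n" if "z \<in> set (elem_aut a b w)" for z
      using that set_elem_aut[OF ab(1) Cons.prems(2)] Cons.prems(4) ab(2) by fastforce
  qed (use Cons.prems e in auto)
qed simp

section \<open>Relative Nielsen reduction\<close>

definition letter_code :: "xletter \<Rightarrow> nat" where
  "letter_code x = 2 * fst x + of_bool (snd x)"

lemma letter_code_inject [simp]: "letter_code x = letter_code y \<longleftrightarrow> x = y"
proof
  assume *: "letter_code x = letter_code y"
  then have "letter_code x div 2 = letter_code y div 2" "letter_code x mod 2 = letter_code y mod 2" by simp_all
  then show "x = y"
    by (cases x; cases y) (auto simp: letter_code_def of_bool_def split: if_splits)
qed simp

primrec weight :: "nat \<Rightarrow> xletter list \<Rightarrow> nat" where
  "weight b [] = 0"
| "weight b (x # w) = letter_code x * b ^ length w + weight b w"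

lemma weight_append: "weight b (u @ v) = weight b u * b ^ length v + weight b v"
  by (induction u) (auto simp: algebra_simps power_add)

lemma weight_less: "(\<And>x. x \<in> set w \<Longrightarrow> letter_code x < b) \<Longrightarrow> weight b w < b ^ length w"
proof (induction w)
  case (Cons x w)
  have "weight b (x # w) < (letter_code x + 1) * b ^ length w"
    using Cons.IH Cons.prems by simp
  also have "\<dots> \<le> b * b ^ length w"
    by (rule mult_right_mono) (use Cons.prems[of x] in auto)
  finally show ?case by simp
qed simp

lemma weight_inject:
  assumes "length u = length v" "\<And>x. x \<in> set u \<union> set v \<Longrightarrow> letter_code x < b" "weight b u = weight b v"
  shows "u = v"
  using assms
proof (induction u v rule: list_induct2)
  case (Cons x u y v)
  have less: "weight b u < b ^ length v" "weight b v < b ^ length v"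
    using weight_less[of u b] weight_less[of v b] Cons by auto
  have "weight b (x # u) div b ^ length v = letter_code x" "weight b (y # v) div b ^ length v = letter_code y"
    "weight b (x # u) mod b ^ length v = weight b u" "weight b (y # v) mod b ^ length v = weight b v"
  proof -
    define B where "B = b ^ length v"
    have "B \<noteq> 0" using less by (metis B_def less_nat_zero_code)
    then show "weight b (x # u) div b ^ length v = letter_code x" "weight b (y # v) div b ^ length v = letter_code y"
      "weight b (x # u) mod b ^ length v = weight b u" "weight b (y # v) mod b ^ length v = weight b v"
      using less Cons.hyps by (simp_all flip: B_def)
  qed
  with Cons show ?case
    by auto
qed simp

text \<open>Nielsen's tie-break: among systems of minimal total length one minimizes the initial halves.
  The weights are numerals to a base that exceeds all occurring letters, so that on words of equal
  length they decide lexicographically.\<close>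

definition half :: "'b list \<Rightarrow> 'b list" where
  "half w = take ((length w + 1) div 2) w"

definition letters_upto :: "nat \<Rightarrow> xletter set" where
  "letters_upto M = {x. fst x \<le> M}"

lemma finite_letters_upto [simp]: "finite (letters_upto M)"
proof -
  have "letters_upto M = {..M} \<times> UNIV"
    by (auto simp: letters_upto_def)
  then show ?thesis by simp
qed

lemma linv_letters_upto [simp]: "linv x \<in> letters_upto M \<longleftrightarrow> x \<in> letters_upto M"
  by (simp add: letters_upto_def)

definition len_weight :: "nat \<Rightarrow> (xletter list \<Rightarrow> xletter list) \<Rightarrow> nat" where
  "len_weight M th = (\<Sum>x\<in>letters_upto M. length (th [x]))"

text \<open>As the sum runs over letters and their inverses, the initial half of each image and the
  inverse of its final half are both weighed.\<close>

definition half_weight :: "nat \<Rightarrow> nat \<Rightarrow> (xletter list \<Rightarrow> xletter list) \<Rightarrow> nat" where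
  "half_weight b M th = (\<Sum>x\<in>letters_upto M. weight b (half (th [x])))"

text \<open>An injective endomorphism seen through finitely many generators: letters below
  \<open>n\<close> are frozen, \<open>M\<close> bounds the generators in play, and \<open>b\<close>
  exceeds the codes of all letters in their images. A transvection among generators up to
  \<open>M\<close> with unfrozen first label preserves all this, so the reduction can be iterated
  with the same three parameters.\<close>

locale relative_mono =
  fixes th :: "xletter list \<Rightarrow> xletter list" and n M b :: nat
  assumes th_mon: "th \<in> mon F_omega F_omega"
    and th_fix: "fst x < n \<Longrightarrow> th [x] = [x]"
    and th_code: "x \<in> letters_upto M \<Longrightarrow> y \<in> set (th [x]) \<Longrightarrow> letter_code y < b"
begin

lemma th_hom: "th \<in> hom F_omega F_omega"
  using th_mon by (simp add: mon_def)

lemma th_reduced [simp]: "reduced w \<Longrightarrow> reduced (th w)"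
  using hom_in_carrier[OF th_hom, of w] by simp

lemma th_mult: "reduced u \<Longrightarrow> reduced w \<Longrightarrow> th (wmul u w) = wmul (th u) (th w)"
  using hom_mult[OF th_hom, of u w] by simp

lemma th_Nil [simp]: "th [] = []"
  using hom_one[OF th_hom group_free_group group_free_group] by simp

lemma th_eq_Nil: "reduced w \<Longrightarrow> th w = [] \<Longrightarrow> w = []"
  using th_mon th_Nil by (auto simp: mon_def dest!: inj_onD[of th _ w "[]"])

lemma th_linv: "th [linv x] = winv (th [x])"
  by (rule hom_linv[OF th_hom])

lemma th_letter_nonempty [simp]: "th [x] \<noteq> []"
  using th_eq_Nil[of "[x]"] by auto

lemma th_cons: "reduced (x # w) \<Longrightarrow> th (x # w) = wmul (th [x]) (th w)"
  using th_mult[of "[x]" w] by (simp add: cons_reduce_reduced reduced_ConsD)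

lemma transvection_letters:
  assumes "(a, c) \<in> elems"
  shows "th (elem_aut a c [x]) =
    (if x = a then wmul (th [a]) (th [c]) else if x = linv a then winv (wmul (th [a]) (th [c]))
     else th [x])"
proof -
  have *: "th [a, c] = wmul (th [a]) (th [c])"
    using th_cons[of a "[c]"] assms by (simp add: elems_def)
  moreover have "th [linv c, linv a] = winv (th [a, c])"
    using hom_winv[OF th_hom, of "[a, c]"] assms by (simp add: elems_def)
  ultimately show ?thesis
    by (simp add: elem_aut_letter[OF assms])
qed

lemma relative_mono_transvection:
  assumes "(a, c) \<in> elems" "n \<le> fst a" "fst a \<le> M" "fst c \<le> M"
  shows "relative_mono (th \<circ> elem_aut a c) n M b"
proof
  have iso: "elem_aut a c \<in> iso F_omega F_omega" by (rule elem_aut_iso[OF assms(1)])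
  then show "th \<circ> elem_aut a c \<in> mon F_omega F_omega"
    using th_mon by (auto simp: mon_def iso_def bij_betw_def intro!: hom_compose comp_inj_on)
  show "(th \<circ> elem_aut a c) [x] = [x]" if "fst x < n" for x
    using that assms(2) by (auto simp: transvection_letters[OF assms(1)] th_fix)
  show "letter_code y < b" if x: "x \<in> letters_upto M" and y: "y \<in> set ((th \<circ> elem_aut a c) [x])" for x y
  proof (cases "x = a \<or> x = linv a")
    case True
    have letters: "a \<in> letters_upto M" "c \<in> letters_upto M"
      using assms by (auto simp: letters_upto_def)
    have "winv (wmul (th [a]) (th [c])) = wmul (winv (th [c])) (winv (th [a]))"
      by (rule winv_wmul) simp_all
    then have "y \<in> set (wmul (th [a]) (th [c])) \<or> y \<in> set (wmul (th [linv c]) (th [linv a]))"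
      using True y by (auto simp: transvection_letters[OF assms(1)] th_linv simp del: set_rev split: if_splits)
    then have "y \<in> set (th [a]) \<union> set (th [c]) \<union> set (th [linv a]) \<union> set (th [linv c])"
      using set_wmul by blast
    then show ?thesis
      using th_code letters linv_letters_upto by blast
  qed (use y x th_code in \<open>auto simp: transvection_letters[OF assms(1)]\<close>)
qed

text \<open>Only the images of \<open>a\<close> and its inverse change. Old and new terms are added
  on opposite sides to avoid truncated subtraction, and \<open>g\<close> is left open so that the
  identity serves both length and half weight.\<close>

lemma sum_transvection:
  fixes g :: "xletter list \<Rightarrow> nat"
  assumes "(a, c) \<in> elems" "fst a \<le> M"
  shows "(\<Sum>x\<in>letters_upto M. g ((th \<circ> elem_aut a c) [x])) + g (th [a]) + g (winv (th [a])) =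
    (\<Sum>x\<in>letters_upto M. g (th [x])) + g (wmul (th [a]) (th [c])) + g (winv (wmul (th [a]) (th [c])))"
proof -
  let ?X = "letters_upto M - {a, linv a}"
  have X: "letters_upto M = insert a (insert (linv a) ?X)"
    using assms by (auto simp: letters_upto_def)
  have split: "(\<Sum>x\<in>letters_upto M. h x) = h a + (h (linv a) + (\<Sum>x\<in>?X. h x))" for h :: "xletter \<Rightarrow> nat"
    by (subst X) (simp add: sum.insert)
  have "(\<Sum>x\<in>?X. g ((th \<circ> elem_aut a c) [x])) = (\<Sum>x\<in>?X. g (th [x]))"
    by (rule sum.cong) (auto simp: transvection_letters[OF assms(1)])
  then show ?thesis
    unfolding split by (simp add: transvection_letters[OF assms(1)] th_linv)
qed

end

text \<open>Local minimality, as left over when a well-founded descent cannot continue: total length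
  counts first and the half weight breaks ties.\<close>

locale nielsen_reduced = relative_mono +
  assumes minimal: "(a, c) \<in> elems \<Longrightarrow> n \<le> fst a \<Longrightarrow> fst a \<le> M \<Longrightarrow> fst c \<le> M \<Longrightarrow>
    (th \<circ> elem_aut a c, th) \<notin> measures [len_weight M, half_weight b M]"
begin

lemma length_le_product:
  assumes "(a, c) \<in> elems" "n \<le> fst a" "fst a \<le> M" "fst c \<le> M"
  shows "length (th [a]) \<le> length (wmul (th [a]) (th [c]))"
  using minimal[OF assms] sum_transvection[OF assms(1,3), of length]
  by (auto simp: len_weight_def in_measures)

lemma half_weight_le_product:
  assumes "(a, c) \<in> elems" "n \<le> fst a" "fst a \<le> M" "fst c \<le> M"
    and "th [a] = u" "wmul (th [a]) (th [c]) = w" "length u = length w"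
  shows "weight b (half u) + weight b (half (winv u)) \<le> weight b (half w) + weight b (half (winv w))"
  using minimal[OF assms(1-4)] sum_transvection[OF assms(1,3), of length]
    sum_transvection[OF assms(1,3), of "\<lambda>w. weight b (half w)"] assms(7)
  unfolding assms(6) unfolding assms(5) by (auto simp: len_weight_def half_weight_def in_measures)

text \<open>If \<open>a\<close> may be changed, minimality says that \<open>A @ B\<close> is not
  shorter than \<open>A @ winv d\<close>. If \<open>a\<close> is frozen, its image is one letter, so
  a violation would make \<open>A\<close> and \<open>B\<close> empty and the product trivial,
  against injectivity. If \<open>a = c\<close>, there is no transvection and the bound for squares
  takes over.\<close>

lemma length_cancellation:
  assumes "fst a \<le> M" "fst c \<le> M" "c \<noteq> linv a"
    and "th [a] = A @ winv d" "th [c] = d @ B" "reduced (A @ B)"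
  shows "length d \<le> length B"
proof (cases "fst a = fst c")
  case True
  with assms letter_cases[of c a] have "a = c" by auto
  moreover have "length d \<le> length A"
    using square_cancellation[OF th_reduced assms(4), of B] assms(5) \<open>a = c\<close> by simp
  moreover have "length A = length B"
    using arg_cong[OF assms(4), of length] arg_cong[OF assms(5), of length] \<open>a = c\<close> by simp
  ultimately show ?thesis by simp
next
  case False
  then have ac: "(a, c) \<in> elems" by (auto simp: elems_def)
  have "reduced (d @ B)"
    using th_reduced[of "[c]"] assms(5) by simp
  then have prod: "wmul (th [a]) (th [c]) = A @ B"
    using wmul_cancel[of d B A] wmul_reduced[OF assms(6)] assms(4,5) by simp
  show ?thesis
  proof (cases "n \<le> fst a")
    case True
    then have "length (th [a]) \<le> length (A @ B)"
      using length_le_product[OF ac True assms(1,2)] by (simp only: prod)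
    then show ?thesis
      using assms(4) by simp
  next
    case False
    show ?thesis
    proof (rule ccontr)
      assume "\<not> ?thesis"
      moreover have "length A + length d = 1"
        using arg_cong[OF assms(4), of length] th_fix[of a] False by simp
      ultimately have "length A = 0" "length B = 0" by linarith+
      then have "A = []" "B = []" by simp_all
      then have "th [a, c] = []"
        using th_cons[of a "[c]"] prod ac \<open>A = []\<close> \<open>B = []\<close> by (simp add: elems_def)
      then show False
        using th_eq_Nil[of "[a, c]"] ac by (simp add: elems_def)
    qed
  qed
qed

text \<open>Inverting the product exchanges the two factors and hence the two remainders.\<close>

lemma length_cancellation':
  assumes "fst a \<le> M" "fst c \<le> M" "c \<noteq> linv a"
    and "th [a] = A @ winv d" "th [c] = d @ B" "reduced (A @ B)"
  shows "length d \<le> length A"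
proof -
  have "reduced (winv B @ winv A)"
    using assms(6) reduced_winv[of "A @ B"] by simp
  moreover have "th [linv c] = winv B @ winv d" "th [linv a] = d @ winv A"
    using assms(4,5) winv_winv[of d] by (simp_all add: th_linv del: winv_winv)
  moreover have "linv a \<noteq> linv (linv c)"
    using assms(3) by auto
  ultimately show ?thesis
    using length_cancellation[of "linv c" "linv a" "winv B" d "winv A"] assms(1,2) by simp
qed

text \<open>Replacing \<open>c\<close> by the product of \<open>a\<close> and \<open>c\<close> turns
  the image \<open>q @ B\<close> into \<open>p @ B\<close>, and minimality of length excludes
  further cancellation. If \<open>p\<close> weighed less than \<open>q\<close>, the initial half
  would become lighter while the final half stays the same.\<close>

lemma half_cancellation_weight:
  assumes "fst a \<le> M" "fst c \<le> M" "c \<noteq> linv a"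
    and a: "th [a] = p @ winv q" and c: "th [c] = q @ B"
    and len: "length p = length q" "length q \<le> length B"
  shows "\<not> weight b p < weight b q"
proof
  assume less: "weight b p < weight b q"
  then have "p \<noteq> q" "q \<noteq> []" by auto
  have "fst a \<noteq> fst c"
  proof
    assume "fst a = fst c"
    with assms letter_cases[of c a] have "a = c" by auto
    with a c have "p @ winv q = q @ B" by simp
    with len have "p = q" by simp
    with \<open>p \<noteq> q\<close> show False by simp
  qed
  \<comment> \<open>Transvections multiply on the right, so multiplying \<open>c\<close> by
    \<open>a\<close> on the left is a transvection of the inverse letters.\<close>
  then have ca: "(linv c, linv a) \<in> elems"
    by (auto simp: elems_def)
  \<comment> \<open>A frozen \<open>c\<close> has an image of length one, but \<open>q\<close> is
    non-empty and \<open>B\<close> is at least as long.\<close>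
  have "n \<le> fst c"
  proof (rule ccontr)
    assume "\<not> ?thesis"
    then have "length (q @ B) = 1"
      using th_fix[of c] c by simp
    with len \<open>q \<noteq> []\<close> show False by (cases q) auto
  qed
  then have ca': "n \<le> fst (linv c)" "fst (linv c) \<le> M" "fst (linv a) \<le> M"
    using assms by simp_all
  let ?P = "wmul (th [linv c]) (th [linv a])"
  have qB: "reduced (q @ B)"
    using th_reduced[of "[c]"] c by simp
  have "?P = winv (wmul (th [a]) (th [c]))"
    using winv_wmul[of "th [a]" "th [c]"] by (simp add: th_linv)
  also have "wmul (th [a]) (th [c]) = wmul p B"
    using wmul_cancel[OF qB, of p] a c by simp
  finally have P: "?P = winv (wmul p B)" .
  moreover have "length (th [linv c]) \<le> length ?P"
    by (rule length_le_product[OF ca ca'])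
  ultimately have "length (wmul p B) = length p + length B"
    using wmul_length[of p B] c len by (simp add: th_linv)
  then have pB: "wmul p B = p @ B"
    by (rule wmul_append_eq)
  have "weight b (half (winv B @ winv q)) + weight b (half (q @ B))
      \<le> weight b (half (winv B @ winv p)) + weight b (half (p @ B))"
  proof -
    have "th [linv c] = winv (q @ B)" "?P = winv (p @ B)"
      using P pB c th_linv by simp_all
    then show ?thesis
      using half_weight_le_product[OF ca ca', of "winv (q @ B)" "winv (p @ B)"] len(1)
        winv_winv[of "q @ B"] winv_winv[of "p @ B"] by (simp del: winv_winv)
  qed
  \<comment> \<open>Since \<open>B\<close> is at least as long as \<open>q\<close>, both initial
    halves lie inside \<open>winv B\<close>.\<close>
  moreover have "half (winv B @ winv q) = half (winv B @ winv p)"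
    using len by (auto simp: half_def)
  moreover define k where "k = (length q + length B + 1) div 2 - length q"
  have "half (q @ B) = q @ take k B" "half (p @ B) = p @ take k B"
    using len by (auto simp: half_def k_def)
  ultimately have "weight b (q @ take k B) \<le> weight b (p @ take k B)"
    by simp
  moreover have "weight b p * b ^ length (take k B) < weight b q * b ^ length (take k B)"
  proof -
    have "letter_code (hd q) < b"
      using th_code[of c "hd q"] c \<open>q \<noteq> []\<close> assms(2) by (simp add: letters_upto_def)
    then show ?thesis using less by simp
  qed
  ultimately show False
    unfolding weight_append by linarith
qed

text \<open>The weight comparison, applied from both sides, forces \<open>p\<close> and
  \<open>q\<close> to have equal weight, hence to be equal; then the image of \<open>c\<close> would
  be trivial. So two neighbours cannot use up a factor half by half.\<close>

lemma no_half_cancellation: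
  assumes "fst a \<le> M" "fst c \<le> M" "fst e \<le> M" "c \<noteq> linv a" "e \<noteq> linv c"
    and a: "th [a] = A @ winv p" and c: "th [c] = p @ winv q" and e: "th [e] = q @ B"
    and len: "length p = length q" "length q \<le> length B" "length p \<le> length A"
  shows False
proof -
  have "\<not> weight b p < weight b q"
    using half_cancellation_weight[OF assms(2,3,5) c e len(1,2)] .
  moreover have "\<not> weight b q < weight b p"
  proof (rule half_cancellation_weight)
    show "th [linv c] = q @ winv p" "th [linv a] = p @ winv A"
      using a c winv_winv[of p] winv_winv[of q] by (simp_all add: th_linv del: winv_winv)
  qed (use assms in auto)
  ultimately have "weight b p = weight b q" by simp
  moreover have "letter_code x < b" if "x \<in> set p \<union> set q" for x
    using th_code[of c x] th_code[of e x] that c e assms(2,3) by (auto simp: letters_upto_def)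
  ultimately have "p = q"
    using weight_inject[OF len(1)] by blast
  then have "th [c] = wmul p (winv p)" "reduced p"
    using c th_reduced[of "[c]"] wmul_reduced[of p "winv q"] by (auto simp: reduced_append_iff)
  then show False
    by simp
qed

text \<open>The induction has to remember the left end: \<open>t\<close> is the surviving part of
  the image of \<open>x\<close>, \<open>d\<close> the part that meets the next letter, and
  \<open>reduced (t @ B)\<close> says that this cancellation is maximal. Prepending another letter
  then consumes only a proper prefix of \<open>t\<close>.\<close>

lemma reduced_product_structure:
  assumes "reduced (x # v)" "\<And>y. y \<in> set (x # v) \<Longrightarrow> fst y \<le> M"
  shows "\<exists>t d A. th [x] = t @ winv d \<and> t \<noteq> [] \<and> th (x # v) = t @ A \<and> length v \<le> length A \<and>
    (v = [] \<longrightarrow> d = []) \<and> (v \<noteq> [] \<longrightarrow> (\<exists>B. th [hd v] = d @ B \<and> reduced (t @ B)))"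
  using assms
proof (induction v arbitrary: x)
  case Nil
  then show ?case
    by (intro exI[of _ "th [x]"] exI[of _ "[]"]) simp
next
  case (Cons c v)
  have c: "c \<noteq> linv x" "reduced (c # v)" "fst x \<le> M" "fst c \<le> M"
    using Cons.prems by auto
  obtain t d A where t: "th [c] = t @ winv d" "t \<noteq> []" "th (c # v) = t @ A" "length v \<le> length A"
    "v = [] \<longrightarrow> d = []" "v \<noteq> [] \<longrightarrow> (\<exists>B. th [hd v] = d @ B \<and> reduced (t @ B))"
    using Cons.IH[OF c(2)] Cons.prems(2) by (metis list.set_intros(2))
  obtain A' d' B' where A': "th [x] = A' @ winv d'" "th [c] = d' @ B'" "reduced (A' @ B')"
    by (rule cancellation_decomposition[of "th [x]" "th [c]"]) simp_all
  have le: "length d' \<le> length A'" "length d' \<le> length B'"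
    using length_cancellation'[OF c(3,4,1) A'] length_cancellation[OF c(3,4,1) A'] by auto
  have dt: "length d \<le> length t"
  proof (cases v)
    case (Cons e v')
    then obtain B where "th [e] = d @ B" "reduced (t @ B)"
      using t(6) by auto
    then show ?thesis
      using length_cancellation'[of c e t d B] t(1) c(2,4) Cons Cons.prems(2) by auto
  qed (simp add: t(5))
  have sum: "length t + length d = length d' + length B'"
    using arg_cong[OF t(1), of length] arg_cong[OF A'(2), of length] by simp
  \<comment> \<open>Each neighbour takes at most half of the image of \<open>c\<close>; if nothing
    were left in between, each would take exactly half.\<close>
  have "length d' < length t"
  proof (rule ccontr)
    assume "\<not> ?thesis"
    then have eq: "length d' = length t" "length d = length t"
      using dt sum le by linarith+
    then have td: "t = d'"
      using append_eq_append_conv[of t d' "winv d" B'] t(1) A'(2) by simp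
    have "v \<noteq> []"
      using eq t(2,5) by auto
    then obtain e v' where v: "v = e # v'"
      by (cases v) simp
    then obtain B where B: "th [e] = d @ B" "reduced (t @ B)"
      using t(6) by auto
    have e: "fst e \<le> M" "e \<noteq> linv c"
      using v c(2) Cons.prems(2) by simp_all
    have "length d \<le> length B"
      by (rule length_cancellation[OF c(4) e t(1) B])
    moreover have "length t = length d" "length t \<le> length A'"
      using eq le by simp_all
    ultimately show False
      using no_half_cancellation[OF c(3,4) e(1) c(1) e(2) _ t(1) B(1)] A'(1) td by blast
  qed
  \<comment> \<open>\<open>m\<close> is the middle of the image of \<open>c\<close> that survives on
    both sides; being non-empty, it pays for the letter \<open>c\<close> in the length
    count.\<close>
  then obtain m where m: "t = d' @ m" "m \<noteq> []" "B' = m @ winv d"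
    using t(1) A'(2) by (auto simp: append_eq_append_conv2)
  have "reduced (t @ A)"
    using th_reduced[OF c(2)] t(3) by simp
  moreover from this have "reduced (m @ A)"
    using m(1) by (simp add: reduced_append_iff)
  moreover have "reduced (A' @ m)"
    using A'(3) m(2,3) by (auto simp: reduced_append_iff)
  ultimately have red: "reduced (A' @ m @ A)"
    using m(2) by (auto simp: reduced_append_iff)
  have "th (x # c # v) = wmul (A' @ winv d') (d' @ m @ A)"
    using th_cons[OF Cons.prems(1)] A'(1) t(3) m(1) by simp
  also have "\<dots> = A' @ m @ A"
    using wmul_cancel[of d' "m @ A" A'] wmul_reduced[OF red] \<open>reduced (t @ A)\<close> m(1) by simp
  finally have "th (x # c # v) = A' @ m @ A" .
  moreover have "A' \<noteq> []"
    using A'(1) le(1) th_letter_nonempty[of x] by auto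
  moreover have "length (c # v) \<le> length (m @ A)"
    using m(2) t(4) by (cases m) auto
  ultimately show ?case
    using A' by (intro exI[of _ A'] exI[of _ d'] exI[of _ "m @ A"]) auto
qed

text \<open>Every letter leaves at least one letter behind. The reduction ends with this: a word
  whose image is one letter has length at most one.\<close>

lemma length_le_image:
  assumes "reduced v" "\<And>y. y \<in> set v \<Longrightarrow> fst y \<le> M"
  shows "length v \<le> length (th v)"
proof (cases v)
  case (Cons x v')
  then obtain t d A where "t \<noteq> []" "th v = t @ A" "length v' \<le> length A"
    using reduced_product_structure[of x v'] assms by auto
  then show ?thesis
    using Cons by (cases t) auto
qed simp

end

text \<open>After \<open>x\<close> has gone to \<open>xy\<close>, the automorphism that multiplies
  \<open>linv y\<close> by \<open>x\<close> on the right sends \<open>y\<close> to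
  \<open>linv x\<close> times \<open>y\<close>, so \<open>xy\<close> becomes
  \<open>y\<close>.\<close>

lemma letter_transitive:
  assumes "n \<le> fst x" "n \<le> fst y"
  shows "\<exists>L. set L \<subseteq> elems \<and> (\<forall>e\<in>set L. n \<le> fst (fst e)) \<and> elem_prod L [x] = [y]"
proof -
  have distinct: "\<exists>L. set L \<subseteq> elems \<and> (\<forall>e\<in>set L. n \<le> fst (fst e)) \<and> elem_prod L [x] = [y]"
    if "n \<le> fst x" "n \<le> fst y" "fst x \<noteq> fst y" for x y :: xletter
  proof -
    have elems: "(x, y) \<in> elems" "(linv y, x) \<in> elems"
      using that by (auto simp: elems_def)
    have "y \<noteq> linv x"
      using that(3) by auto
    then have "elem_aut (linv y) x [x, y] = wmul (elem_aut (linv y) x [x]) (elem_aut (linv y) x [y])"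
      using iso_word(2)[OF elem_aut_iso[OF elems(2)], of "[x]" "[y]"] by simp
    also have "\<dots> = [y]"
      using that by (auto simp: elem_aut_letter[OF elems(2)])
    finally have "elem_prod [(x, y), (linv y, x)] [x] = [y]"
      by (simp add: elem_aut_letter[OF elems(1)])
    then show ?thesis
      using elems that by (intro exI[of _ "[(x, y), (linv y, x)]"]) auto
  qed
  show ?thesis
  proof (cases "fst x = fst y")
    case True
    \<comment> \<open>Letters over the same basis element are connected through a third letter,
      unfrozen because its index is larger.\<close>
    define z :: xletter where "z = (Suc (fst x), True)"
    obtain L L' where "set L \<subseteq> elems" "\<forall>e\<in>set L. n \<le> fst (fst e)" "elem_prod L [x] = [z]"
      "set L' \<subseteq> elems" "\<forall>e\<in>set L'. n \<le> fst (fst e)" "elem_prod L' [z] = [y]"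
      using distinct[of x z] distinct[of z y] assms True by (auto simp: z_def)
    then show ?thesis
      by (intro exI[of _ "L @ L'"]) auto
  qed (use distinct assms in blast)
qed

text \<open>Each transvection that lowers the measure is absorbed into \<open>L\<close>, while the
  preimage \<open>v\<close> of \<open>a\<close> is pulled back by the inverse transvection. At a
  minimal stage \<open>v\<close> is a single unfrozen letter, and a product carrying
  \<open>a\<close> to this letter finishes.\<close>

lemma nielsen_reduction:
  assumes "relative_mono th n M b" "reduced v" "\<And>x. x \<in> set v \<Longrightarrow> fst x \<le> M" "th v = [a]" "n \<le> fst a"
  shows "\<exists>L. set L \<subseteq> elems \<and> (\<forall>e\<in>set L. n \<le> fst (fst e)) \<and> th (elem_prod L [a]) = [a]"
  using assms(1-4)
proof (induction th arbitrary: v rule: wf_induct_rule[OF wf_measures[of "[len_weight M, half_weight b M]"]])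
  case (1 th)
  interpret relative_mono th n M b by (rule 1)
  show ?case
  proof (cases "nielsen_reduced th n M b")
    case True
    interpret nielsen_reduced th n M b by (rule True)
    have "length v \<le> 1"
      using length_le_image[of v] 1 by simp
    then obtain x where v: "v = [x]"
      using 1(5) th_Nil by (cases v) auto
    \<comment> \<open>A frozen \<open>x\<close> would be its own image, hence equal to the unfrozen
      \<open>a\<close>.\<close>
    have "n \<le> fst x"
      using th_fix[of x] 1(5) v assms(5) by (cases "fst x < n") auto
    then obtain L where "set L \<subseteq> elems" "\<forall>e\<in>set L. n \<le> fst (fst e)" "elem_prod L [a] = [x]"
      using letter_transitive[OF assms(5)] by blast
    then show ?thesis
      using 1(5) v by auto
  next
    case False
    then obtain p q where pq: "(p, q) \<in> elems" "n \<le> fst p" "fst p \<le> M" "fst q \<le> M"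
      and less: "(th \<circ> elem_aut p q, th) \<in> measures [len_weight M, half_weight b M]"
      using relative_mono_axioms by (auto simp: nielsen_reduced_def nielsen_reduced_axioms_def)
    have pq': "(p, linv q) \<in> elems"
      using elem_inv_in_elems[of "(p, q)"] pq(1) by (simp add: elem_inv_def)
    let ?v = "elem_aut p (linv q) v"
    have "reduced ?v"
      using iso_word(1)[OF elem_aut_iso[OF pq']] 1 by simp
    moreover have "fst x \<le> M" if "x \<in> set ?v" for x
      using set_elem_aut[OF pq' 1(3)] that pq 1(4) by fastforce
    moreover have "elem_aut p q ?v = v"
      using elem_aut_inverse(1)[OF pq', of v] 1 by simp
    ultimately obtain L where L: "set L \<subseteq> elems" "\<forall>e\<in>set L. n \<le> fst (fst e)"
      "(th \<circ> elem_aut p q) (elem_prod L [a]) = [a]"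
      using 1(1)[OF less relative_mono_transvection[OF pq], of ?v] 1(5) by auto
    then show ?thesis
      using pq by (intro exI[of _ "L @ [(p, q)]"]) auto
  qed
qed

text \<open>One basis element at a time: surjectivity supplies a preimage of the next one, and
  Nielsen reduction at level \<open>N\<close> brings it into place without disturbing the letters
  below.\<close>

lemma extend_fixed_letters:
  assumes th: "th \<in> iso F_omega F_omega" and fixed: "\<And>x. fst x < n \<Longrightarrow> th [x] = [x]" and "n \<le> N"
  shows "\<exists>L. set L \<subseteq> elems \<and> (\<forall>e\<in>set L. n \<le> fst (fst e)) \<and> (\<forall>x. fst x < N \<longrightarrow> th (elem_prod L [x]) = [x])"
  using \<open>n \<le> N\<close>
proof (induction N rule: dec_induct)
  case base
  then show ?case
    using fixed by (intro exI[of _ "[]"]) simp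
next
  case (step N)
  then obtain L where L: "set L \<subseteq> elems" "\<forall>e\<in>set L. n \<le> fst (fst e)"
    "\<forall>x. fst x < N \<longrightarrow> th (elem_prod L [x]) = [x]"
    by blast
  define th' where "th' = th \<circ> elem_prod L"
  have th': "th' \<in> iso F_omega F_omega"
    unfolding th'_def by (rule iso_set_trans[OF elem_prod_iso[OF L(1)] th])
  define a :: xletter where "a = (N, True)"
  have "[a] \<in> th' ` carrier F_omega"
    using th' by (simp add: iso_def bij_betw_def)
  then obtain v where v: "reduced v" "th' v = [a]"
    by auto
  \<comment> \<open>The preimage decides which generators take part, and their images decide the
    numeral base.\<close>
  define M where "M = Max (insert 0 (fst ` set v))"
  have M: "fst x \<le> M" if "x \<in> set v" for x
    unfolding M_def by (rule Max_ge) (use that in auto)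
  define C where "C = letter_code ` (\<Union>x\<in>letters_upto M. set (th' [x]))"
  have C: "letter_code y < Suc (Max (insert 0 C))" if "x \<in> letters_upto M" "y \<in> set (th' [x])" for x y
    unfolding less_Suc_eq_le by (rule Max_ge) (use that in \<open>auto simp: C_def\<close>)
  have "relative_mono th' N M (Suc (Max (insert 0 C)))"
  proof
    show "th' \<in> mon F_omega F_omega"
      using th' by (simp add: iso_def mon_def bij_betw_def)
  qed (use L C in \<open>auto simp: th'_def\<close>)
  then obtain L' where L': "set L' \<subseteq> elems" "\<forall>e\<in>set L'. N \<le> fst (fst e)" "th' (elem_prod L' [a]) = [a]"
    using nielsen_reduction[of th' N M _ v a] v M unfolding a_def by (metis fst_conv order_refl)
  have "th' (elem_prod L' [x]) = [x]" if "fst x < Suc N" for x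
  proof (cases "fst x < N")
    case True
    then have "elem_prod L' [x] = [x]"
      using L' by (intro elem_prod_fix) auto
    with L(3) True show ?thesis by (simp only: th'_def o_apply)
  next
    case False
    then have "x = a \<or> x = linv a"
      using that letter_cases[of x a] by (simp add: a_def)
    moreover have "th' \<circ> elem_prod L' \<in> hom F_omega F_omega"
      using iso_set_trans[OF elem_prod_iso[OF L'(1)] th'] by (simp add: iso_def)
    ultimately show ?thesis
      using L'(3) hom_linv[of "th' \<circ> elem_prod L'" a] by auto
  qed
  moreover have "\<forall>e\<in>set (L' @ L). n \<le> fst (fst e)"
    using L L' step.hyps by fastforce
  ultimately show ?case
    using L L' by (intro exI[of _ "L' @ L"]) (auto simp: th'_def)
qed

section \<open>Finite parts of ordered words\<close>

abbreviation strictly :: "'s rel \<Rightarrow> 's \<Rightarrow> 's \<Rightarrow> bool" where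
  "strictly r s t \<equiv> (s, t) \<in> r \<and> s \<noteq> t"

lemma Linear_orderD:
  assumes "Linear_order r"
  shows "antisym r" "trans r" "s \<in> Field r \<Longrightarrow> (s, s) \<in> r"
    and "s \<in> Field r \<Longrightarrow> t \<in> Field r \<Longrightarrow> s \<noteq> t \<Longrightarrow> (s, t) \<in> r \<or> (t, s) \<in> r"
  using assms by (auto simp: order_on_defs refl_on_def total_on_def)

lemma strictly_sorted_distinct: "sorted_wrt (strictly r) l \<Longrightarrow> distinct l"
  by (induction l) auto

lemma strictly_sorted_unique:
  assumes "antisym r" "sorted_wrt (strictly r) l" "sorted_wrt (strictly r) l'" "set l = set l'"
  shows "l = l'"
  using assms(2-)
proof (induction l arbitrary: l')
  case (Cons s l)
  then obtain t l'' where l': "l' = t # l''"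
    by (cases l') auto
  have "s = t"
  proof (rule ccontr)
    assume "s \<noteq> t"
    then have "t \<in> set l" "s \<in> set l''"
      using Cons.prems(3) l' by auto
    then have "(s, t) \<in> r" "(t, s) \<in> r"
      using Cons.prems l' by auto
    with \<open>s \<noteq> t\<close> assms(1) show False
      by (auto dest: antisymD)
  qed
  moreover have "s \<notin> set l" "t \<notin> set l''"
    using strictly_sorted_distinct[OF Cons.prems(1)] strictly_sorted_distinct[OF Cons.prems(2)] l' by auto
  ultimately have "set l = set l''"
    using Cons.prems(3) l' by auto
  with Cons l' \<open>s = t\<close> show ?case by auto
qed simp

lemma strictly_sorted_exists:
  assumes r: "Linear_order r" and "finite D" "D \<subseteq> Field r"
  shows "\<exists>l. set l = D \<and> sorted_wrt (strictly r) l"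
  using assms(2,3)
proof (induction D rule: finite_induct)
  case (insert a D)
  then obtain l where l: "set l = D" "sorted_wrt (strictly r) l"
    by blast
  let ?l = "filter (\<lambda>s. (s, a) \<in> r) l @ [a] @ filter (\<lambda>s. (s, a) \<notin> r) l"
  have "a \<noteq> s" "(s, a) \<in> r \<or> (a, s) \<in> r" if "s \<in> set l" for s
    using Linear_orderD(4)[OF r, of s a] that insert l by auto
  then have "sorted_wrt (strictly r) ?l"
    using l(2) Linear_orderD(1,2)[OF r]
    by (auto simp: sorted_wrt_append sorted_wrt_filter dest: antisymD transD)
  moreover have "set ?l = insert a D"
    using l(1) by auto
  ultimately show ?case by blast
qed simp

lemma least_wrt_in:
  assumes r: "Linear_order r" and "finite C" "C \<noteq> {}" "C \<subseteq> Field r"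
  shows "least_wrt r C \<in> C" "\<And>t. t \<in> C \<Longrightarrow> (least_wrt r C, t) \<in> r"
proof -
  obtain l where l: "set l = C" "sorted_wrt (strictly r) l"
    using strictly_sorted_exists[OF r assms(2,4)] by blast
  then obtain s l' where s: "l = s # l'"
    using assms(3) by (cases l) auto
  then have "s \<in> C \<and> (\<forall>t\<in>C. (s, t) \<in> r)"
    using l Linear_orderD(3)[OF r, of s] assms(4) by auto
  moreover from this have "s' = s" if "s' \<in> C \<and> (\<forall>t\<in>C. (s', t) \<in> r)" for s'
    using that Linear_orderD(1)[OF r] by (auto dest: antisymD)
  ultimately have "least_wrt r C = s"
    unfolding least_wrt_def by (rule the_equality)
  with \<open>s \<in> C \<and> _\<close> show "least_wrt r C \<in> C" "\<And>t. t \<in> C \<Longrightarrow> (least_wrt r C, t) \<in> r"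
    by auto
qed

section \<open>The positions that determine the image of a letter\<close>

text \<open>Split off from \<open>S_1\<close> so that the increasing direction alone can drive
  termination and the reversed word falls under the same predicate.\<close>

definition no_chain :: "('s, elem) oword \<Rightarrow> bool" where
  "no_chain f \<longleftrightarrow> \<not> (\<exists>\<phi> :: nat \<Rightarrow> 's. inj \<phi> \<and> range \<phi> \<subseteq> dom_of f \<and>
        (\<forall>m n. m \<le> n \<longrightarrow> (\<phi> m, \<phi> n) \<in> leq f) \<and>
        (\<forall>n. lab1 f (\<phi> (Suc n)) \<in> {lab2 f (\<phi> n), linv (lab2 f (\<phi> n))}))"

lemma S_1_iff: "f \<in> S_1 \<longleftrightarrow> f \<in> owords elems \<and> no_chain f"
  by (simp add: S_1_def no_chain_def)

text \<open>The selection rule of \<open>trace\<close>, run along a finite increasing list instead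
  of by repeated minima.\<close>

primrec relevant :: "('s, elem) oword \<Rightarrow> xletter set \<Rightarrow> 's list \<Rightarrow> 's list" where
  "relevant f A [] = []"
| "relevant f A (s # l) =
    (if lab1 f s \<in> A then s # relevant f (A \<union> {lab2 f s, linv (lab2 f s)}) l else relevant f A l)"

text \<open>\<open>A\<close> always contains the letters of the current image, so a skipped position
  acts trivially on it.\<close>

lemma elem_prod_relevant:
  assumes "lab f ` set l \<subseteq> elems" "reduced w" "set w \<subseteq> A" "\<And>a. a \<in> A \<Longrightarrow> linv a \<in> A"
  shows "elem_prod (map (lab f) (relevant f A l)) w = elem_prod (map (lab f) l) w"
  using assms
proof (induction l arbitrary: w A)
  case (Cons s l)
  obtain a b where ab: "lab f s = (a, b)" by (cases "lab f s")
  then have elem: "(a, b) \<in> elems" using Cons.prems(1) by auto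
  show ?case
  proof (cases "a \<in> A")
    case True
    have "elem_prod (map (lab f) (relevant f (A \<union> {b, linv b}) l)) (elem_aut a b w) =
        elem_prod (map (lab f) l) (elem_aut a b w)"
    proof (rule Cons.IH)
      show "reduced (elem_aut a b w)"
        using iso_word(1)[OF elem_aut_iso[OF elem]] Cons.prems by simp
      show "set (elem_aut a b w) \<subseteq> A \<union> {b, linv b}"
        using set_elem_aut[OF elem Cons.prems(2)] Cons.prems(3) by auto
    qed (use Cons.prems in auto)
    with True ab show ?thesis by simp
  next
    case False
    have "fst a \<noteq> fst x" if "x \<in> set w" for x
      using letter_cases[of a x] False that Cons.prems(3,4) by blast
    then have "elem_prod [(a, b)] w = w"
      using elem Cons.prems(2) by (intro elem_prod_fix) auto
    with False ab Cons show ?thesis by simp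
  qed
qed simp

declare trace.simps(2) [simp del]

locale finitary_word =
  fixes f :: "('s, elem) oword"
  assumes S_0: "f \<in> S_0" and no_chain: "no_chain f"
begin

lemma linear: "Linear_order (leq f)"
  using S_0 by (simp add: S_0_def owords_def)

lemmas order = Linear_orderD[OF linear]

lemma lab_elems: "s \<in> dom_of f \<Longrightarrow> lab f s \<in> elems"
  using S_0 by (auto simp: S_0_def owords_def)

lemma finite_lab1: "finite A \<Longrightarrow> finite {s \<in> dom_of f. lab1 f s \<in> A}"
proof -
  assume "finite A"
  have "finite {s \<in> dom_of f. lab1 f s = x}" for x
    using S_0 unfolding S_0_def by blast
  moreover have "{s \<in> dom_of f. lab1 f s \<in> A} = (\<Union>x\<in>A. {s \<in> dom_of f. lab1 f s = x})"
    by auto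
  ultimately show "finite {s \<in> dom_of f. lab1 f s \<in> A}"
    using \<open>finite A\<close> by simp
qed

definition links :: "'s rel" where
  "links = {(s, t). strictly (leq f) s t \<and> lab1 f t \<in> {lab2 f s, linv (lab2 f s)}}"

lemma wf_links: "wf (links\<inverse>)"
  unfolding wf_iff_no_infinite_down_chain
proof
  assume "\<exists>\<phi>. \<forall>i. (\<phi> (Suc i), \<phi> i) \<in> links\<inverse>"
  then obtain \<phi> where \<phi>: "\<And>i. (\<phi> i, \<phi> (Suc i)) \<in> links"
    by auto
  then have Suc: "strictly (leq f) (\<phi> i) (\<phi> (Suc i))"
    "lab1 f (\<phi> (Suc i)) \<in> {lab2 f (\<phi> i), linv (lab2 f (\<phi> i))}" for i
    by (auto simp: links_def)
  have dom: "\<phi> i \<in> dom_of f" for i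
    using Suc(1)[of i] by (auto intro: FieldI1)
  have mono: "(\<phi> m, \<phi> n) \<in> leq f" if "m \<le> n" for m n
    using that
  proof (induction n rule: dec_induct)
    case (step n)
    with Suc(1)[of n] order(2) show ?case by (auto dest: transD)
  qed (simp add: order(3) dom)
  have "\<phi> m \<noteq> \<phi> n" if "m < n" for m n
    using mono[of "Suc m" n] Suc(1)[of m] that order(1) by (auto dest: antisymD)
  then have "inj \<phi>"
    by (metis injI linorder_neqE_nat)
  with no_chain Suc(2) mono dom show False
    unfolding no_chain_def by blast
qed

text \<open>Koenig's lemma: by \<open>S_0\<close> each position has finitely many successors, and by
  the chain condition the link relation terminates.\<close>

lemma finite_reachable: "finite (links\<^sup>* `` {s})"
proof (induction s rule: wf_induct_rule[OF wf_links])
  case (1 s)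
  have "links\<^sup>* `` {s} \<subseteq> insert s (\<Union>t\<in>links `` {s}. links\<^sup>* `` {t})"
    by (auto elim: converse_rtranclE)
  moreover have "links `` {s} \<subseteq> {t \<in> dom_of f. lab1 f t \<in> {lab2 f s, linv (lab2 f s)}}"
    by (auto simp: links_def intro: FieldI2)
  then have "finite (links `` {s})"
    using finite_lab1 by (rule finite_subset) simp
  then have "finite (insert s (\<Union>t\<in>links `` {s}. links\<^sup>* `` {t}))"
    using 1 by auto
  ultimately show ?case
    by (rule finite_subset)
qed

definition candidates :: "xletter set \<Rightarrow> 's list \<Rightarrow> 's set" where
  "candidates A ss = {s \<in> dom_of f. lab1 f s \<in> A \<and> (ss \<noteq> [] \<longrightarrow> strictly (leq f) (last ss) s)}"

lemma trace_Suc: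
  assumes "trace f x k = (A, ss)"
  shows "trace f x (Suc k) = (if candidates A ss = {} then (A, ss)
    else let s = least_wrt (leq f) (candidates A ss)
      in (A \<union> {lab2 f s, linv (lab2 f s)}, ss @ [s]))"
proof -
  have "{s \<in> dom_of f. lab1 f s \<in> A \<and> (ss \<noteq> [] \<longrightarrow> (last ss, s) \<in> leq f \<and> s \<noteq> last ss)} =
      candidates A ss"
    by (auto simp: candidates_def)
  then show ?thesis
    by (simp only: trace.simps(2) assms Let_def prod.case)
qed

lemma least_candidate:
  assumes "finite A" "candidates A ss \<noteq> {}"
  shows "least_wrt (leq f) (candidates A ss) \<in> candidates A ss"
    and "t \<in> candidates A ss \<Longrightarrow> (least_wrt (leq f) (candidates A ss), t) \<in> leq f"
proof -
  have "finite (candidates A ss)"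
    using finite_lab1[OF assms(1)] by (rule rev_finite_subset) (auto simp: candidates_def)
  moreover have "candidates A ss \<subseteq> dom_of f"
    by (auto simp: candidates_def)
  ultimately show "least_wrt (leq f) (candidates A ss) \<in> candidates A ss"
    "t \<in> candidates A ss \<Longrightarrow> (least_wrt (leq f) (candidates A ss), t) \<in> leq f"
    using least_wrt_in[OF linear _ assms(2)] by auto
qed

definition reachable :: "xletter \<Rightarrow> 's set" where
  "reachable x = links\<^sup>* `` {s \<in> dom_of f. lab1 f s \<in> {x, linv x}}"

text \<open>A new position owes its first label either to \<open>x\<close> or to the second label of
  an earlier position, to which it is then linked. So no stage leaves
  \<open>reachable x\<close>.\<close>

lemma trace_invariant:
  assumes "trace f x k = (A, ss)"
  shows "A = {x, linv x} \<union> (\<Union>s\<in>set ss. {lab2 f s, linv (lab2 f s)})"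
    and "sorted_wrt (strictly (leq f)) ss" "set ss \<subseteq> dom_of f" "set ss \<subseteq> reachable x"
proof -
  have "A = {x, linv x} \<union> (\<Union>s\<in>set ss. {lab2 f s, linv (lab2 f s)}) \<and>
    sorted_wrt (strictly (leq f)) ss \<and> set ss \<subseteq> dom_of f \<and> set ss \<subseteq> reachable x"
    using assms
  proof (induction k arbitrary: A ss)
    case (Suc k)
    obtain B us where us: "trace f x k = (B, us)" by (cases "trace f x k")
    note IH = Suc.IH[OF us]
    show ?case
    proof (cases "candidates B us = {}")
      case True
      then have "A = B" "ss = us"
        using Suc.prems trace_Suc[OF us] by simp_all
      then show ?thesis using IH by simp
    next
      case False
      define s where "s = least_wrt (leq f) (candidates B us)"
      have "finite B" using IH by auto
      then have s: "s \<in> candidates B us"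
        unfolding s_def using False by (rule least_candidate)
      have A: "A = B \<union> {lab2 f s, linv (lab2 f s)}" "ss = us @ [s]"
        using Suc.prems False by (simp_all add: trace_Suc[OF us] s_def Let_def)
      \<comment> \<open>\<open>trace\<close> compares with the last position only; sortedness
        extends this to all earlier ones.\<close>
      have above: "strictly (leq f) t s" if t: "t \<in> set us" for t
      proof -
        obtain vs z where vs: "us = vs @ [z]"
          using t by (cases us rule: rev_cases) auto
        then have "strictly (leq f) z s"
          using s by (simp add: candidates_def)
        moreover have "t = z \<or> strictly (leq f) t z"
          using IH t vs by (auto simp: sorted_wrt_append)
        ultimately show ?thesis
          using order(1,2) by (metis antisymD transD)
      qed
      have "s \<in> reachable x"
      proof (cases "lab1 f s \<in> {x, linv x}")
        case True
        then show ?thesis using s by (auto simp: reachable_def candidates_def)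
      next
        case False
        then obtain t where t: "t \<in> set us" "lab1 f s \<in> {lab2 f t, linv (lab2 f t)}"
          using s IH by (auto simp: candidates_def)
        then have "(t, s) \<in> links"
          using above by (auto simp: links_def)
        moreover have "t \<in> reachable x"
          using IH t(1) by blast
        ultimately show ?thesis
          unfolding reachable_def by (auto intro: rtrancl_into_rtrancl)
      qed
      moreover have "A = {x, linv x} \<union> (\<Union>s\<in>set ss. {lab2 f s, linv (lab2 f s)})"
        using conjunct1[OF IH] A by auto
      moreover have "sorted_wrt (strictly (leq f)) ss" "set ss \<subseteq> dom_of f"
        using IH s above by (simp_all add: A(2) sorted_wrt_append candidates_def)
      ultimately show ?thesis
        using IH A(2) by simp
    qed
  qed auto
  then show "A = {x, linv x} \<union> (\<Union>s\<in>set ss. {lab2 f s, linv (lab2 f s)})"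
    "sorted_wrt (strictly (leq f)) ss" "set ss \<subseteq> dom_of f" "set ss \<subseteq> reachable x"
    by auto
qed

lemma finite_trace: "trace f x k = (A, ss) \<Longrightarrow> finite A"
  by (drule trace_invariant(1)) simp

lemma trace_prefix: "j \<le> k \<Longrightarrow> \<exists>zs. snd (trace f x k) = snd (trace f x j) @ zs"
proof (induction k rule: dec_induct)
  case (step k)
  obtain A ss where ss: "trace f x k = (A, ss)" by (cases "trace f x k")
  obtain zs where "ss = snd (trace f x j) @ zs"
    using step.IH ss by auto
  then show ?case
    by (simp add: trace_Suc[OF ss] Let_def)
qed simp

text \<open>A run without end would list arbitrarily many distinct elements of the finite set
  \<open>reachable x\<close>.\<close>

lemma trace_stabilizes: "\<exists>k. trace f x (Suc k) = trace f x k"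
proof (rule ccontr)
  assume *: "\<not> ?thesis"
  have "length (snd (trace f x k)) = k" for k
  proof (induction k)
    case (Suc k)
    obtain A ss where ss: "trace f x k = (A, ss)" by (cases "trace f x k")
    then have "candidates A ss \<noteq> {}"
      using * trace_Suc[OF ss] ss by (metis (full_types))
    with Suc ss show ?case by (simp add: trace_Suc[OF ss] Let_def)
  qed simp
  moreover have "finite (reachable x)"
  proof -
    have "reachable x = (\<Union>s\<in>{s \<in> dom_of f. lab1 f s \<in> {x, linv x}}. links\<^sup>* `` {s})"
      by (auto simp: reachable_def)
    then show ?thesis
      using finite_lab1[of "{x, linv x}"] finite_reachable by auto
  qed
  moreover have "distinct (snd (trace f x k))" "set (snd (trace f x k)) \<subseteq> reachable x" for k
    using trace_invariant(2,4)[of x k "fst (trace f x k)" "snd (trace f x k)"]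
    by (simp_all add: strictly_sorted_distinct)
  ultimately have "k \<le> card (reachable x)" for k
    by (metis card_mono distinct_card)
  then show False
    using Suc_n_not_le_n by blast
qed

lemma trace_Suc_cong: "trace f x j = trace f x k \<Longrightarrow> trace f x (Suc j) = trace f x (Suc k)"
  by (simp only: trace.simps)

lemma trace_stable:
  assumes "trace f x (Suc k) = trace f x k" "k \<le> i"
  shows "trace f x i = trace f x k"
  using assms(2)
proof (induction i rule: dec_induct)
  case (step i)
  show ?case
    using trace_Suc_cong[OF step.IH] assms(1) by (rule trans)
qed (rule refl)

lemma positions_eq:
  assumes "trace f x (Suc k) = trace f x k"
  shows "positions f x = snd (trace f x k)"
proof -
  define K where "K = (LEAST k. trace f x (Suc k) = trace f x k)"
  have K: "trace f x (Suc K) = trace f x K"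
    unfolding K_def by (rule LeastI[of _ k]) (rule assms)
  have "K \<le> k"
    unfolding K_def by (rule Least_le) (rule assms)
  then have "trace f x k = trace f x K"
    by (rule trace_stable[OF K])
  then show ?thesis
    by (simp add: positions_def K_def)
qed

lemma positions_prefix: "\<exists>zs. positions f x = snd (trace f x j) @ zs"
proof -
  obtain k where k: "trace f x (Suc k) = trace f x k"
    using trace_stabilizes by blast
  have "trace f x (Suc (max j k)) = trace f x (max j k)"
    using trace_stable[OF k, of "Suc (max j k)"] trace_stable[OF k, of "max j k"] by simp
  then have "positions f x = snd (trace f x (max j k))"
    by (rule positions_eq)
  then show ?thesis
    using trace_prefix[of j "max j k" x] by simp
qed

lemma positions_sorted: "sorted_wrt (strictly (leq f)) (positions f x)" "set (positions f x) \<subseteq> dom_of f"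
proof -
  obtain k where k: "trace f x (Suc k) = trace f x k"
    using trace_stabilizes by blast
  then show "sorted_wrt (strictly (leq f)) (positions f x)" "set (positions f x) \<subseteq> dom_of f"
    using trace_invariant(2,3)[of x k "fst (trace f x k)" "snd (trace f x k)"]
    unfolding positions_eq[OF k] by simp_all
qed

text \<open>Stated from an arbitrary stage on, for the induction. The list \<open>l\<close> may
  leave gaps in the domain: it has to contain only the positions still to be chosen, and then the
  least candidate of the whole domain is also the first one in \<open>l\<close>.\<close>

lemma positions_relevant:
  assumes "trace f x k = (A, ss)" "set l \<subseteq> dom_of f" "sorted_wrt (strictly (leq f)) l"
    and "\<And>s. s \<in> set l \<Longrightarrow> ss \<noteq> [] \<Longrightarrow> strictly (leq f) (last ss) s"
    and "set (positions f x) \<subseteq> set ss \<union> set l"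
  shows "positions f x = ss @ relevant f A l"
  using assms
proof (induction l arbitrary: k A ss)
  case Nil
  define s where "s = least_wrt (leq f) (candidates A ss)"
  have "candidates A ss = {}"
  proof (rule ccontr)
    assume "candidates A ss \<noteq> {}"
    then have *: "trace f x (Suc k) = (A \<union> {lab2 f s, linv (lab2 f s)}, ss @ [s])"
      by (simp add: trace_Suc[OF Nil.prems(1)] s_def Let_def)
    \<comment> \<open>A further candidate would be chosen, but all positions already lie in
      \<open>ss\<close> and none occurs twice.\<close>
    then obtain zs where "positions f x = ss @ [s] @ zs"
      using positions_prefix[of x "Suc k"] by auto
    then show False
      using Nil.prems(5) strictly_sorted_distinct[OF positions_sorted(1), of x] by auto
  qed
  then have "trace f x (Suc k) = trace f x k"
    by (simp add: trace_Suc[OF Nil.prems(1)] Nil.prems(1))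
  then show ?case
    using positions_eq[of x k] Nil.prems(1) by simp
next
  case (Cons s l)
  define s' where "s' = least_wrt (leq f) (candidates A ss)"
  have next_position: "trace f x (Suc k) = (A \<union> {lab2 f s', linv (lab2 f s')}, ss @ [s'])"
    "s' \<in> candidates A ss" "\<exists>zs. positions f x = ss @ [s'] @ zs" "s' \<in> set (s # l)"
    if "candidates A ss \<noteq> {}"
  proof -
    show *: "trace f x (Suc k) = (A \<union> {lab2 f s', linv (lab2 f s')}, ss @ [s'])"
      using that by (simp add: trace_Suc[OF Cons.prems(1)] s'_def Let_def)
    show "s' \<in> candidates A ss"
      unfolding s'_def by (rule least_candidate[OF finite_trace[OF Cons.prems(1)] that])
    show **: "\<exists>zs. positions f x = ss @ [s'] @ zs"
      using positions_prefix[of x "Suc k"] * by auto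
    then show "s' \<in> set (s # l)"
      using Cons.prems(5) strictly_sorted_distinct[OF positions_sorted(1), of x] by auto
  qed
  show ?case
  proof (cases "lab1 f s \<in> A")
    case True
    then have s: "s \<in> candidates A ss"
      using Cons.prems(2,4) by (auto simp: candidates_def)
    then have "(s', s) \<in> leq f" "s' \<in> set (s # l)"
      using least_candidate(2)[OF finite_trace[OF Cons.prems(1)], of ss s] next_position
      by (auto simp: s'_def)
    then have "s' = s"
      using Cons.prems(3) order(1) by (auto dest: antisymD)
    then have "positions f x = (ss @ [s]) @ relevant f (A \<union> {lab2 f s, linv (lab2 f s)}) l"
      using Cons.prems next_position(1) s by (intro Cons.IH[of "Suc k"]) auto
    with True show ?thesis by simp
  next
    case False
    \<comment> \<open>A rejected \<open>s\<close> precedes the next chosen position, so it cannot be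
      chosen later.\<close>
    have "s \<in> set ss" if "s \<in> set (positions f x)"
    proof (cases "candidates A ss = {}")
      case True
      then have "trace f x (Suc k) = trace f x k"
        by (simp add: trace_Suc[OF Cons.prems(1)] Cons.prems(1))
      then show ?thesis
        using positions_eq[of x k] Cons.prems(1) that by simp
    next
      case False
      with next_position obtain zs where zs: "positions f x = ss @ [s'] @ zs" "s' \<in> set (s # l)"
        "s' \<in> candidates A ss"
        by blast
      then have "strictly (leq f) s s'"
        using Cons.prems(3) \<open>lab1 f s \<notin> A\<close> by (auto simp: candidates_def)
      moreover have "strictly (leq f) s' t" if "t \<in> set zs" for t
        using positions_sorted(1)[of x] zs(1) that by (auto simp: sorted_wrt_append)
      ultimately show ?thesis
        using that zs(1) order(1) by (auto dest: antisymD)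
    qed
    then have "positions f x = ss @ relevant f A l"
      using Cons.prems by (intro Cons.IH[of k]) auto
    with False show ?thesis by simp
  qed
qed

lemma alpha_letter_finite:
  assumes "set l \<subseteq> dom_of f" "sorted_wrt (strictly (leq f)) l" "set (positions f x) \<subseteq> set l"
  shows "alpha_letter f x = elem_prod (map (lab f) l) [x]"
proof -
  have "alpha_letter f x = elem_prod (map (lab f) (positions f x)) [x]"
    by (simp add: alpha_letter_def elem_prod_def fold_map comp_def case_prod_beta)
  also have "positions f x = relevant f {x, linv x} l"
    using positions_relevant[of x 0 "{x, linv x}" "[]" l] assms by simp
  also have "elem_prod (map (lab f) \<dots>) [x] = elem_prod (map (lab f) l) [x]"
    using assms(1) lab_elems by (intro elem_prod_relevant) auto
  finally show ?thesis .
qed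

text \<open>Locality: on a given word any finite increasing list that covers the positions of its
  letters already computes \<open>alpha\<close>. A single list serves all letters, so the
  multiplicativity of finite products applies.\<close>

lemma alpha_finite:
  assumes "set l \<subseteq> dom_of f" "sorted_wrt (strictly (leq f)) l" "reduced w"
    and "\<And>x. x \<in> set w \<Longrightarrow> set (positions f x) \<subseteq> set l"
  shows "alpha f w = elem_prod (map (lab f) l) w"
proof -
  have L: "set (map (lab f) l) \<subseteq> elems"
    using assms(1) lab_elems by auto
  have "free_ext F_omega (alpha_letter f) w = elem_prod (map (lab f) l) w"
    using assms(3,4)
  proof (induction w)
    case (Cons x w)
    then have w: "reduced w" "wmul [x] w = x # w"
      by (auto simp: cons_reduce_reduced dest: reduced_ConsD)
    have "free_ext F_omega (alpha_letter f) (x # w) =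
        wmul (alpha_letter f x) (free_ext F_omega (alpha_letter f) w)"
      by (simp add: free_ext_def)
    also have "\<dots> = wmul (elem_prod (map (lab f) l) [x]) (elem_prod (map (lab f) l) w)"
      using Cons w(1) alpha_letter_finite[OF assms(1,2), of x] by simp
    also have "\<dots> = elem_prod (map (lab f) l) (wmul [x] w)"
      using elem_prod_word(2)[OF L, of "[x]" w] w(1) by simp
    finally show ?case by (simp only: w(2))
  qed (use elem_prod_word(3)[OF L] in \<open>simp add: free_ext_def\<close>)
  then show ?thesis
    using assms(3) by (simp add: alpha_def)
qed

end

section \<open>Cancellation in finite products\<close>

text \<open>The last hypothesis is the noncrossing condition: what lies between two partners has its
  own partner there. A finite list keeps it even if most of the interval is missing, and adjacent
  partners act as an automorphism followed by its inverse.\<close>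

lemma noncrossing_cancellation:
  assumes "sorted_wrt (strictly r) l" "antisym r" "lb ` set l \<subseteq> elems" "reduced w"
    and "\<And>t. t \<in> set l \<Longrightarrow> t \<in> T \<Longrightarrow> star t \<in> set l \<and> star t \<in> T \<and> star (star t) = t \<and>
      lb (star t) = elem_inv (lb t)"
    and "\<And>t u. t \<in> set l \<Longrightarrow> t \<in> T \<Longrightarrow> u \<in> set l \<Longrightarrow> (t, u) \<in> r \<Longrightarrow> (u, star t) \<in> r \<Longrightarrow>
      u \<in> T \<and> (t, star u) \<in> r \<and> (star u, star t) \<in> r"
  shows "elem_prod (map lb l) w = elem_prod (map lb (filter (\<lambda>s. s \<notin> T) l)) w"
  using assms(1,3-)
proof (induction l rule: length_induct)
  case (1 l)
  note sorted = 1(2) and elems = 1(3) and star = 1(5) and between = 1(6)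
  have distinct: "distinct l"
    using sorted by (rule strictly_sorted_distinct)
  have less: "(l ! i, l ! j) \<in> r" "l ! i \<noteq> l ! j" if "i < j" "j < length l" for i j
    using sorted_wrt_nth_less[OF sorted that] by auto
  show ?case
  proof (cases "set l \<inter> T = {}")
    case True
    then have "filter (\<lambda>s. s \<notin> T) l = l"
      by (auto simp: filter_id_conv)
    then show ?thesis by simp
  next
    case False
    \<comment> \<open>The two members of a matched pair at minimal distance \<open>d\<close> are adjacent.\<close>
    define P where "P d \<longleftrightarrow> (\<exists>i. 0 < d \<and> i + d < length l \<and> l ! i \<in> T \<and> star (l ! i) = l ! (i + d))" for d
    have P: "P (j - i)" if "i < j" "j < length l" "l ! i \<in> T" "star (l ! i) = l ! j" for i j
      using that unfolding P_def by (intro exI[of _ i]) simp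
    have no_fix: "star t \<noteq> t" if "t \<in> set l" "t \<in> T" for t
      using star[OF that] elem_inv_simps(2)[of "lb t"] by metis
    obtain t where t: "t \<in> set l" "t \<in> T"
      using False by auto
    obtain i j where ij: "i < length l" "j < length l" "l ! i = t" "l ! j = star t"
      using t star[OF t] by (metis in_set_conv_nth)
    have "i \<noteq> j"
      using no_fix[OF t] ij by auto
    then have "P (j - i) \<or> P (i - j)"
      using P[of i j] P[of j i] ij t star[OF t] by (metis linorder_neqE_nat)
    then have ex: "\<exists>d. P d" by blast
    define d where "d = (LEAST d. P d)"
    have "P d" unfolding d_def using ex by (rule LeastI_ex)
    then obtain m where m: "0 < d" "m + d < length l" "l ! m \<in> T" "star (l ! m) = l ! (m + d)"
      unfolding P_def by blast
    have least: "d \<le> d'" if "P d'" for d'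
      unfolding d_def using that by (rule Least_le)
    have "d = 1"
    proof (rule ccontr)
      assume "d \<noteq> 1"
      with m(1) have "1 < d" by simp
      \<comment> \<open>The right neighbour of the first partner lies inside the interval, hence so
        does its own partner, and these two would be closer together.\<close>
      let ?u = "l ! Suc m"
      have u: "?u \<in> set l" "l ! m \<in> set l"
        using m(2) \<open>1 < d\<close> by simp_all
      have "(l ! m, ?u) \<in> r" "(?u, star (l ! m)) \<in> r"
        using less(1)[of m "Suc m"] less(1)[of "Suc m" "m + d"] m \<open>1 < d\<close> by simp_all
      then have uT: "?u \<in> T" "(l ! m, star ?u) \<in> r" "(star ?u, star (l ! m)) \<in> r"
        using between[OF u(2) m(3) u(1)] by simp_all
      obtain k where k: "k < length l" "l ! k = star ?u"
        using star[OF u(1) uT(1)] by (metis in_set_conv_nth)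
      have "\<not> k < m"
        using less[of k m] uT(2) k m(2) assms(2) by (auto dest: antisymD)
      moreover have "\<not> m + d < k"
        using less[of "m + d" k] uT(3) k m assms(2) by (auto dest: antisymD)
      moreover have "k \<noteq> m"
      proof
        assume "k = m"
        then have "star (l ! m) = ?u"
          using k(2) star[OF u(1) uT(1)] by simp
        then show False
          using m less(2)[of "Suc m" "m + d"] \<open>1 < d\<close> by simp
      qed
      moreover have "k \<noteq> m + d"
      proof
        assume "k = m + d"
        then have "star (star (l ! m)) = star (star ?u)"
          using k(2) m(4) by simp
        then have "l ! m = ?u"
          using star[OF u(1) uT(1)] star[OF u(2) m(3)] by simp
        then show False
          using less(2)[of m "Suc m"] m(2) \<open>1 < d\<close> by simp
      qed
      moreover have "k \<noteq> Suc m"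
        using no_fix[OF u(1) uT(1)] k(2) by auto
      ultimately have "Suc m < k" "k < m + d" by linarith+
      then have "P (k - Suc m)"
        using k uT(1) by (intro P) simp_all
      from least[OF this] \<open>k < m + d\<close> \<open>Suc m < k\<close> show False by linarith
    qed
    define t' where "t' = l ! m"
    have t': "t' \<in> T" "star t' = l ! Suc m" "t' \<in> set l"
      using m \<open>d = 1\<close> by (simp_all add: t'_def)
    define l1 l2 where "l1 = take m l" and "l2 = drop (Suc (Suc m)) l"
    have l: "l = l1 @ [t', star t'] @ l2"
      using m(2) \<open>d = 1\<close> t'(2) by (simp add: l1_def l2_def t'_def Cons_nth_drop_Suc)
    have removed: "set (l1 @ l2) = set l - {t', star t'}"
    proof -
      have "distinct (l1 @ [t', star t'] @ l2)"
        using distinct l by simp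
      then have "set (l1 @ l2) = set (l1 @ [t', star t'] @ l2) - {t', star t'}"
        by auto
      then show ?thesis
        using l by simp
    qed
    have starT: "star t' \<in> T" "lb (star t') = elem_inv (lb t')"
      using star[OF t'(3,1)] by simp_all
    obtain x y where xy: "lb t' = (x, y)" by (cases "lb t'")
    then have xy': "(x, y) \<in> elems" using elems t'(3) by auto
    have l1: "set (map lb l1) \<subseteq> elems"
      using elems l by auto
    have "elem_aut x (linv y) (elem_aut x y (elem_prod (map lb l1) w)) = elem_prod (map lb l1) w"
      using elem_prod_word(1)[OF l1 1(4)] by (intro elem_aut_inverse(1)[OF xy']) simp
    then have "elem_prod (map lb l) w = elem_prod (map lb (l1 @ l2)) w"
      using starT(2) xy by (subst l) (simp add: elem_inv_def)
    also have "\<dots> = elem_prod (map lb (filter (\<lambda>s. s \<notin> T) (l1 @ l2))) w"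
    proof (rule 1(1)[rule_format])
      show "length (l1 @ l2) < length l"
        by (subst l) simp
      show "sorted_wrt (strictly r) (l1 @ l2)"
        using sorted by (subst (asm) l) (auto simp: sorted_wrt_append)
      show "lb ` set (l1 @ l2) \<subseteq> elems"
        using elems removed by auto
      fix u assume u: "u \<in> set (l1 @ l2)" "u \<in> T"
      then have u': "u \<in> set l" "u \<noteq> t'" "u \<noteq> star t'"
        using removed by auto
      then have "star u \<noteq> t'" "star u \<noteq> star t'"
        using star[OF u'(1) u(2)] star[OF t'(3,1)] by metis+
      then show "star u \<in> set (l1 @ l2) \<and> star u \<in> T \<and> star (star u) = u \<and>
          lb (star u) = elem_inv (lb u)"
        using star[OF u'(1) u(2)] removed by auto
      show "v \<in> T \<and> (u, star v) \<in> r \<and> (star v, star u) \<in> r"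
        if "v \<in> set (l1 @ l2)" "(u, v) \<in> r" "(v, star u) \<in> r" for v
        using between[OF u'(1) u(2) _ that(2,3)] that(1) removed by blast
    qed (rule 1(4))
    also have "filter (\<lambda>s. s \<notin> T) (l1 @ l2) = filter (\<lambda>s. s \<notin> T) l"
      using t'(1) starT(1) by (subst l) simp
    finally show ?thesis .
  qed
qed

text \<open>Selection by label makes different words comparable, since an isomorphism renames
  positions but keeps labels.\<close>

definition label_part :: "('s, elem) oword \<Rightarrow> elem set \<Rightarrow> 's set" where
  "label_part f La = {s \<in> dom_of f. lab f s \<in> La}"

definition finite_product :: "('s, elem) oword \<Rightarrow> elem set \<Rightarrow> xletter list \<Rightarrow> xletter list" where
  "finite_product f La =
    elem_prod (map (lab f) (THE l. set l = label_part f La \<and> sorted_wrt (strictly (leq f)) l))"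

lemma owordsD:
  assumes "f \<in> owords elems"
  shows "Linear_order (leq f)" "s \<in> dom_of f \<Longrightarrow> lab f s \<in> elems"
  using assms by (auto simp: owords_def)

lemma finite_label_part:
  assumes "f \<in> owords elems" "finite La"
  shows "finite (label_part f La)"
proof -
  have "label_part f La \<subseteq> (\<Union>e\<in>La \<inter> elems. {s \<in> dom_of f. lab f s = e})"
    using owordsD(2)[OF assms(1)] by (auto simp: label_part_def)
  moreover have "finite (\<Union>e\<in>La \<inter> elems. {s \<in> dom_of f. lab f s = e})"
    using assms by (auto simp: owords_def)
  ultimately show ?thesis by (rule finite_subset)
qed

lemma finite_product_eq:
  assumes "f \<in> owords elems" "set l = label_part f La" "sorted_wrt (strictly (leq f)) l"
  shows "finite_product f La = elem_prod (map (lab f) l)"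
proof -
  have "(THE l. set l = label_part f La \<and> sorted_wrt (strictly (leq f)) l) = l"
    using assms(2,3) strictly_sorted_unique[OF Linear_orderD(1)[OF owordsD(1)[OF assms(1)]]]
    by (intro the_equality) auto
  then show ?thesis by (simp add: finite_product_def)
qed

lemma label_part_list:
  assumes "f \<in> owords elems" "finite La"
  obtains l where "set l = label_part f La" "sorted_wrt (strictly (leq f)) l"
    "finite_product f La = elem_prod (map (lab f) l)" "set (map (lab f) l) \<subseteq> elems" "set l \<subseteq> dom_of f"
proof -
  obtain l where l: "set l = label_part f La" "sorted_wrt (strictly (leq f)) l"
    using strictly_sorted_exists[OF owordsD(1)[OF assms(1)] finite_label_part[OF assms]]
    by (auto simp: label_part_def)
  have "set (map (lab f) l) \<subseteq> elems" "set l \<subseteq> dom_of f"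
    using l(1) owordsD(2)[OF assms(1)] by (auto simp: label_part_def)
  with that l finite_product_eq[OF assms(1) l] show ?thesis by blast
qed

lemma finite_product_iso:
  assumes "f \<in> owords elems" "finite La"
  shows "finite_product f La \<in> iso F_omega F_omega"
  using label_part_list[OF assms] elem_prod_iso by metis

text \<open>Closure of \<open>La\<close> under inverses makes the selected part stable under
  \<open>star\<close>: two partners are both selected or both left out.\<close>

lemma finite_product_cancel:
  assumes f: "f \<in> owords elems" and g: "g \<in> owords elems" and "oword_cancel elem_inv f g"
    and La: "finite La" "\<And>e. e \<in> La \<Longrightarrow> elem_inv e \<in> La" and w: "reduced w"
  shows "finite_product f La w = finite_product g La w"
proof -
  obtain T star \<phi> where T: "T \<subseteq> dom_of f"
    and star: "\<And>t. t \<in> T \<Longrightarrow> star t \<in> T \<and> star (star t) = t \<and> lab f (star t) = elem_inv (lab f t)"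
    and interval: "\<And>t. t \<in> T \<Longrightarrow> oword_interval f t (star t) \<subseteq> T \<and>
      star ` oword_interval f t (star t) = oword_interval f t (star t)"
    and \<phi>: "bij_betw \<phi> (dom_of g) (dom_of (oword_remove f T))"
      "\<And>s t. s \<in> dom_of g \<Longrightarrow> t \<in> dom_of g \<Longrightarrow>
        (s, t) \<in> leq g \<longleftrightarrow> (\<phi> s, \<phi> t) \<in> leq (oword_remove f T)"
      "\<And>s. s \<in> dom_of g \<Longrightarrow> lab g s = lab (oword_remove f T) (\<phi> s)"
    using assms(3) unfolding oword_cancel_def oword_iso_def by metis
  have dom: "dom_of (oword_remove f T) = dom_of f - T"
    using Linear_orderD(3)[OF owordsD(1)[OF f]] by (auto simp: oword_remove_def Field_def)
  obtain l where l: "set l = label_part f La" "sorted_wrt (strictly (leq f)) l"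
    "finite_product f La = elem_prod (map (lab f) l)" "set (map (lab f) l) \<subseteq> elems" "set l \<subseteq> dom_of f"
    using label_part_list[OF f La(1)] .
  obtain l' where l': "set l' = label_part g La" "sorted_wrt (strictly (leq g)) l'"
    "finite_product g La = elem_prod (map (lab g) l')" "set (map (lab g) l') \<subseteq> elems" "set l' \<subseteq> dom_of g"
    using label_part_list[OF g La(1)] .
  \<comment> \<open>The isomorphism carries the selected part of \<open>g\<close>, in order, onto
    what remains of the selected part of \<open>f\<close>.\<close>
  have "map \<phi> l' = filter (\<lambda>s. s \<notin> T) l"
  proof (rule strictly_sorted_unique)
    show "antisym (leq f)"
      by (rule Linear_orderD(1)[OF owordsD(1)[OF f]])
    show "sorted_wrt (strictly (leq f)) (filter (\<lambda>s. s \<notin> T) l)"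
      using l(2) by (rule sorted_wrt_filter)
    have "strictly (leq f) (\<phi> s) (\<phi> t)" if "strictly (leq g) s t" for s t
    proof -
      have "s \<in> dom_of g" "t \<in> dom_of g"
        using that by (auto intro: FieldI1 FieldI2)
      then show ?thesis
        using that \<phi>(2)[of s t] bij_betw_imp_inj_on[OF \<phi>(1)]
        by (auto simp: oword_remove_def dest: inj_onD)
    qed
    then show "sorted_wrt (strictly (leq f)) (map \<phi> l')"
      using l'(2) by (auto simp: sorted_wrt_map elim: sorted_wrt_mono_rel[rotated])
    have "\<phi> ` label_part g La = label_part f La - T"
      using bij_betw_imp_surj_on[OF \<phi>(1)] \<phi>(3) unfolding dom
      by (fastforce simp: label_part_def oword_remove_def)
    then show "set (map \<phi> l') = set (filter (\<lambda>s. s \<notin> T) l)"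
      using l(1) l'(1) by auto
  qed
  moreover have "map (lab g) l' = map (lab f) (map \<phi> l')"
    using \<phi>(3) l'(5) by (auto simp: oword_remove_def)
  moreover have "elem_prod (map (lab f) l) w = elem_prod (map (lab f) (filter (\<lambda>s. s \<notin> T) l)) w"
  proof (rule noncrossing_cancellation[where r = "leq f" and star = star, OF l(2) _ _ w])
    show "antisym (leq f)"
      by (rule Linear_orderD(1)[OF owordsD(1)[OF f]])
    show "lab f ` set l \<subseteq> elems"
      using l(4) by simp
    fix t assume t: "t \<in> set l" "t \<in> T"
    then show "star t \<in> set l \<and> star t \<in> T \<and> star (star t) = t \<and> lab f (star t) = elem_inv (lab f t)"
      using star[OF t(2)] La(2) T l(1) by (auto simp: label_part_def)
    show "u \<in> T \<and> (t, star u) \<in> leq f \<and> (star u, star t) \<in> leq f"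
      if "(t, u) \<in> leq f" "(u, star t) \<in> leq f" for u
    proof -
      have "u \<in> oword_interval f t (star t)"
        using that by (simp add: oword_interval_def)
      with interval[OF t(2)] have "u \<in> T" "star u \<in> oword_interval f t (star t)"
        by blast+
      then show ?thesis by (simp add: oword_interval_def)
    qed
  qed
  ultimately show ?thesis
    using l(3) l'(3) by simp
qed

lemma finite_product_equiv:
  assumes "(f, g) \<in> oword_equiv elems elem_inv"
    and La: "finite La" "\<And>e. e \<in> La \<Longrightarrow> elem_inv e \<in> La" and w: "reduced w"
  shows "finite_product f La w = finite_product g La w"
proof -
  let ?R = "{(f, g). f \<in> owords elems \<and> g \<in> owords elems \<and> oword_cancel elem_inv f g}"
  have "(f, g) \<in> (?R \<union> ?R\<inverse>)\<^sup>*"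
    using assms(1) by (auto simp: oword_equiv_def Let_def)
  then show ?thesis
  proof (induction rule: rtrancl_induct)
    case (step g h)
    then show ?case
      using finite_product_cancel[OF _ _ _ La w, of g h] finite_product_cancel[OF _ _ _ La w, of h g]
      by auto
  qed simp
qed

section \<open>From finite products back to \<open>alpha\<close>\<close>

lemma label_closure:
  assumes "finite La"
  obtains La' where "finite La'" "La \<subseteq> La'" "\<And>e. e \<in> La' \<Longrightarrow> elem_inv e \<in> La'"
proof
  show "finite (La \<union> elem_inv ` La)" "La \<subseteq> La \<union> elem_inv ` La" using assms by auto
qed (auto simp: image_iff)

context finitary_word
begin

lemma owords: "f \<in> owords elems"
  using S_0 by (simp add: S_0_def)

text \<open>\<open>La\<close> collects the labels of all positions of letters in \<open>W\<close>.
  Larger sets give the same value, so the sets found for several words can be merged and closed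
  under inverses.\<close>

lemma alpha_finite_product:
  assumes "finite W" "\<forall>w\<in>W. reduced w"
  shows "\<exists>La. finite La \<and>
    (\<forall>La'. finite La' \<longrightarrow> La \<subseteq> La' \<longrightarrow> (\<forall>w\<in>W. alpha f w = finite_product f La' w))"
proof (intro exI conjI allI impI ballI)
  define La where "La = lab f ` (\<Union>w\<in>W. \<Union>x\<in>set w. set (positions f x))"
  show "finite La" using assms(1) by (simp add: La_def)
  fix La' w assume La': "finite La'" "La \<subseteq> La'" "w \<in> W"
  obtain l where l: "set l = label_part f La'" "sorted_wrt (strictly (leq f)) l"
    "finite_product f La' = elem_prod (map (lab f) l)" "set (map (lab f) l) \<subseteq> elems" "set l \<subseteq> dom_of f"
    using label_part_list[OF owords La'(1)] .
  have "set (positions f x) \<subseteq> set l" if "x \<in> set w" for x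
  proof
    fix s assume s: "s \<in> set (positions f x)"
    then have "lab f s \<in> La"
      using that La'(3) unfolding La_def by blast
    then show "s \<in> set l"
      using s positions_sorted(2)[of x] l(1) La'(2) unfolding label_part_def by blast
  qed
  then show "alpha f w = finite_product f La' w"
    using alpha_finite[OF l(5,2)] assms(2)[rule_format, OF La'(3)] l(3) by simp
qed

lemma alpha_hom: "alpha f \<in> hom F_omega F_omega"
proof (rule homI)
  fix u w :: "xletter list"
  assume uw: "u \<in> carrier F_omega" "w \<in> carrier F_omega"
  have W: "finite {u, w, wmul u w}" "\<forall>v\<in>{u, w, wmul u w}. reduced v"
    using uw by simp_all
  obtain La where La: "finite La"
    "\<And>La' v. finite La' \<Longrightarrow> La \<subseteq> La' \<Longrightarrow> v \<in> {u, w, wmul u w} \<Longrightarrow> alpha f v = finite_product f La' v"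
    using alpha_finite_product[OF W] by metis
  have "alpha f v = finite_product f La v" if "v \<in> {u, w, wmul u w}" for v
    by (rule La(2)[OF La(1) subset_refl that])
  then show "alpha f (u \<otimes>\<^bsub>F_omega\<^esub> w) = alpha f u \<otimes>\<^bsub>F_omega\<^esub> alpha f w" "alpha f u \<in> carrier F_omega"
    using iso_word(1,2)[OF finite_product_iso[OF owords La(1)]] uw by simp_all
qed

end

lemma finitary_word_SS: "f \<in> SS \<Longrightarrow> finitary_word f"
  by unfold_locales (simp_all add: SS_def S_1_iff)

lemma oword_bar_bar [simp]: "oword_bar elem_inv (oword_bar elem_inv f) = f"
  by (simp add: oword_bar_def)

lemma oword_bar_sel [simp]:
  "leq (oword_bar elem_inv f) = (leq f)\<inverse>" "lab (oword_bar elem_inv f) s = elem_inv (lab f s)"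
  by (simp_all add: oword_bar_def)

lemma oword_bar_SS:
  assumes "f \<in> SS"
  shows "oword_bar elem_inv f \<in> SS"
  using assms by (auto simp: SS_def S_0_def S_1_iff)

text \<open>As \<open>La\<close> is closed under inverses, the reversed word selects the same
  positions, and its product has the inverse factors in opposite order.\<close>

lemma finite_product_bar:
  assumes f: "f \<in> owords elems" "oword_bar elem_inv f \<in> owords elems"
    and La: "finite La" "\<And>e. e \<in> La \<Longrightarrow> elem_inv e \<in> La" and w: "reduced w"
  shows "finite_product f La (finite_product (oword_bar elem_inv f) La w) = w"
proof -
  obtain l where l: "set l = label_part f La" "sorted_wrt (strictly (leq f)) l"
    "finite_product f La = elem_prod (map (lab f) l)" "set (map (lab f) l) \<subseteq> elems" "set l \<subseteq> dom_of f"
    using label_part_list[OF f(1) La(1)] .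
  have "elem_inv e \<in> La \<longleftrightarrow> e \<in> La" for e
    using La(2)[of e] La(2)[of "elem_inv e"] by auto
  then have "finite_product (oword_bar elem_inv f) La = elem_prod (map (lab (oword_bar elem_inv f)) (rev l))"
    using l(1,2) by (intro finite_product_eq[OF f(2)])
      (auto simp: label_part_def sorted_wrt_rev elim: sorted_wrt_mono_rel[rotated])
  also have "map (lab (oword_bar elem_inv f)) (rev l) = elems_inv (map (lab f) l)"
    by (simp add: elems_inv_def rev_map comp_def)
  finally show ?thesis
    using elem_prod_inverse'[OF l(4) w] l(3) by simp
qed

lemma alpha_bar:
  assumes f: "f \<in> SS" and w: "reduced w"
  shows "alpha f (alpha (oword_bar elem_inv f) w) = w"
proof -
  let ?g = "oword_bar elem_inv f"
  interpret f: finitary_word f using f by (rule finitary_word_SS)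
  interpret g: finitary_word ?g using oword_bar_SS[OF f] by (rule finitary_word_SS)
  have red: "reduced (alpha ?g w)"
    using hom_in_carrier[OF g.alpha_hom, of w] w by simp
  obtain La where La: "finite La"
    "\<And>La'. finite La' \<Longrightarrow> La \<subseteq> La' \<Longrightarrow> alpha ?g w = finite_product ?g La' w"
    using g.alpha_finite_product[of "{w}"] w by auto
  obtain Lb where Lb: "finite Lb"
    "\<And>La'. finite La' \<Longrightarrow> Lb \<subseteq> La' \<Longrightarrow> alpha f (alpha ?g w) = finite_product f La' (alpha ?g w)"
    using f.alpha_finite_product[of "{alpha ?g w}"] red by auto
  obtain La' where "finite La'" "La \<union> Lb \<subseteq> La'" "\<And>e. e \<in> La' \<Longrightarrow> elem_inv e \<in> La'"
    using label_closure[of "La \<union> Lb"] La(1) Lb(1) by auto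
  then show ?thesis
    using La(2)[of La'] Lb(2)[of La'] finite_product_bar[OF f.owords g.owords _ _ w] by simp
qed

text \<open>The inverse comes from the reversed word, whose membership in \<open>SS\<close> uses the
  chain conditions in both directions.\<close>

lemma alpha_auto:
  assumes f: "f \<in> SS"
  shows "alpha f \<in> auto F_omega"
proof -
  let ?g = "oword_bar elem_inv f"
  interpret f: finitary_word f using f by (rule finitary_word_SS)
  interpret g: finitary_word ?g using oword_bar_SS[OF f] by (rule finitary_word_SS)
  have "bij_betw (alpha f) (carrier F_omega) (carrier F_omega)"
    by (rule bij_betwI[where g = "alpha ?g"])
      (use alpha_bar[OF f] alpha_bar[OF oword_bar_SS[OF f]] hom_in_carrier[OF f.alpha_hom]
        hom_in_carrier[OF g.alpha_hom] in auto)
  then show ?thesis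
    using f.alpha_hom by (simp add: auto_def Bij_def alpha_def)
qed

lemma alpha_equiv:
  assumes f: "f \<in> SS" and g: "g \<in> SS" and "(f, g) \<in> oword_equiv elems elem_inv"
  shows "alpha f = alpha g"
proof (rule extensionalityI[where A = "carrier F_omega"])
  interpret f: finitary_word f using f by (rule finitary_word_SS)
  interpret g: finitary_word g using g by (rule finitary_word_SS)
  fix w :: "xletter list" assume "w \<in> carrier F_omega"
  then have w: "reduced w" by simp
  obtain La where La: "finite La"
    "\<And>La'. finite La' \<Longrightarrow> La \<subseteq> La' \<Longrightarrow> alpha f w = finite_product f La' w"
    using f.alpha_finite_product[of "{w}"] w by auto
  obtain Lb where Lb: "finite Lb"
    "\<And>La'. finite La' \<Longrightarrow> Lb \<subseteq> La' \<Longrightarrow> alpha g w = finite_product g La' w"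
    using g.alpha_finite_product[of "{w}"] w by auto
  obtain La' where "finite La'" "La \<union> Lb \<subseteq> La'" "\<And>e. e \<in> La' \<Longrightarrow> elem_inv e \<in> La'"
    using label_closure[of "La \<union> Lb"] La(1) Lb(1) by auto
  then show "alpha f w = alpha g w"
    using La(2)[of La'] Lb(2)[of La'] finite_product_equiv[OF assms(3), of La' w] w by simp
qed (simp_all add: alpha_def)

lemma oword_concat_sel:
  "leq (oword_concat f g) = {(2 * s, 2 * t) | s t. (s, t) \<in> leq f} \<union>
           {(2 * s + 1, 2 * t + 1) | s t. (s, t) \<in> leq g} \<union>
           {(2 * s, 2 * t + 1) | s t. s \<in> dom_of f \<and> t \<in> dom_of g}"
  "lab (oword_concat f g) (2 * s) = lab f s" "lab (oword_concat f g) (Suc (2 * s)) = lab g s"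
  by (simp_all add: oword_concat_def)

lemma leq_oword_concat [simp]:
  "(2 * s, 2 * t) \<in> leq (oword_concat f g) \<longleftrightarrow> (s, t) \<in> leq f"
  "(Suc (2 * s), Suc (2 * t)) \<in> leq (oword_concat f g) \<longleftrightarrow> (s, t) \<in> leq g"
  "(2 * s, Suc (2 * t)) \<in> leq (oword_concat f g) \<longleftrightarrow> s \<in> dom_of f \<and> t \<in> dom_of g"
  "(Suc (2 * s), 2 * t) \<notin> leq (oword_concat f g)"
proof -
  have "Suc (2 * a) \<noteq> 2 * b" "2 * b \<noteq> Suc (2 * a)" for a b :: nat by presburger+
  then show "(2 * s, 2 * t) \<in> leq (oword_concat f g) \<longleftrightarrow> (s, t) \<in> leq f"
    "(Suc (2 * s), Suc (2 * t)) \<in> leq (oword_concat f g) \<longleftrightarrow> (s, t) \<in> leq g"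
    "(2 * s, Suc (2 * t)) \<in> leq (oword_concat f g) \<longleftrightarrow> s \<in> dom_of f \<and> t \<in> dom_of g"
    "(Suc (2 * s), 2 * t) \<notin> leq (oword_concat f g)"
    by (auto simp: oword_concat_sel(1))
qed

lemma dom_oword_concat:
  assumes "Linear_order (leq f)" "Linear_order (leq g)"
  shows "dom_of (oword_concat f g) = (\<lambda>s. 2 * s) ` dom_of f \<union> (\<lambda>s. Suc (2 * s)) ` dom_of g"
proof (intro equalityI subsetI)
  fix s assume "s \<in> dom_of (oword_concat f g)"
  then show "s \<in> (\<lambda>s. 2 * s) ` dom_of f \<union> (\<lambda>s. Suc (2 * s)) ` dom_of g"
    unfolding Field_def Domain_iff Range_iff Un_iff oword_concat_sel(1)
    by (auto intro: FieldI1 FieldI2 simp: Field_def)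
next
  fix s assume "s \<in> (\<lambda>s. 2 * s) ` dom_of f \<union> (\<lambda>s. Suc (2 * s)) ` dom_of g"
  then have "(s, s) \<in> leq (oword_concat f g)"
    using Linear_orderD(3)[OF assms(1)] Linear_orderD(3)[OF assms(2)] by auto
  then show "s \<in> dom_of (oword_concat f g)" by (rule FieldI1)
qed

section \<open>Concatenation and the homomorphism property\<close>

lemma oword_concat_cases:
  assumes "s \<in> dom_of (oword_concat f g)" "Linear_order (leq f)" "Linear_order (leq g)"
  obtains a where "s = 2 * a" "a \<in> dom_of f" | a where "s = Suc (2 * a)" "a \<in> dom_of g"
  using assms dom_oword_concat[OF assms(2,3)] by blast

lemma oword_concat_owords:
  assumes f: "f \<in> owords elems" and g: "g \<in> owords elems"
  shows "oword_concat f g \<in> owords elems"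
proof -
  let ?h = "oword_concat f g"
  note linear = owordsD(1)[OF f] owordsD(1)[OF g]
  note dom = dom_oword_concat[OF linear]
  note elim = oword_concat_cases[OF _ linear]
  have "Refl (leq ?h)"
    unfolding refl_on_def
  proof (intro conjI ballI)
    show "(s, s) \<in> leq ?h" if "s \<in> dom_of ?h" for s
      using that Linear_orderD(3)[OF linear(1)] Linear_orderD(3)[OF linear(2)]
      by (auto elim!: elim)
  qed
  moreover have "trans (leq ?h)"
  proof (rule transI)
    fix s t u assume *: "(s, t) \<in> leq ?h" "(t, u) \<in> leq ?h"
    then have "s \<in> dom_of ?h" "t \<in> dom_of ?h" "u \<in> dom_of ?h"
      by (auto intro: FieldI1 FieldI2)
    with * show "(s, u) \<in> leq ?h"
      using Linear_orderD(2)[OF linear(1)] Linear_orderD(2)[OF linear(2)]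
      by (elim elim) (auto dest: transD)
  qed
  moreover have "antisym (leq ?h)"
  proof (rule antisymI)
    fix s t assume *: "(s, t) \<in> leq ?h" "(t, s) \<in> leq ?h"
    then have "s \<in> dom_of ?h" "t \<in> dom_of ?h"
      by (auto intro: FieldI1 FieldI2)
    with * show "s = t"
      using Linear_orderD(1)[OF linear(1)] Linear_orderD(1)[OF linear(2)]
      by (elim elim) (auto dest: antisymD)
  qed
  moreover have "Total (leq ?h)"
    unfolding total_on_def
  proof (intro ballI impI)
    fix s t assume "s \<in> dom_of ?h" "t \<in> dom_of ?h" "s \<noteq> t"
    then show "(s, t) \<in> leq ?h \<or> (t, s) \<in> leq ?h"
      using Linear_orderD(4)[OF linear(1)] Linear_orderD(4)[OF linear(2)]
      by (elim elim) auto
  qed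
  moreover have "leq ?h \<subseteq> dom_of ?h \<times> dom_of ?h"
    by (auto intro: FieldI1 FieldI2)
  ultimately have "Linear_order (leq ?h)"
    by (simp add: order_on_defs)
  moreover have "lab ?h ` dom_of ?h \<subseteq> elems"
    using owordsD(2)[OF f] owordsD(2)[OF g] by (auto simp: dom oword_concat_sel(2,3))
  moreover have "finite {s \<in> dom_of ?h. lab ?h s = e}" if "e \<in> elems" for e
  proof -
    have "{s \<in> dom_of ?h. lab ?h s = e} \<subseteq> (\<lambda>s. 2 * s) ` {s \<in> dom_of f. lab f s = e} \<union>
        (\<lambda>s. Suc (2 * s)) ` {s \<in> dom_of g. lab g s = e}"
      by (auto simp: dom oword_concat_sel(2,3))
    moreover have "finite {s \<in> dom_of f. lab f s = e}" "finite {s \<in> dom_of g. lab g s = e}"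
      using f g that by (simp_all add: owords_def)
    ultimately show ?thesis
      using finite_subset by (metis (no_types, lifting) finite_UnI finite_imageI)
  qed
  ultimately show ?thesis
    by (simp add: owords_def)
qed

lemma no_chainI:
  assumes "\<And>\<phi> :: nat \<Rightarrow> 's. inj \<phi> \<Longrightarrow> (\<And>n. \<phi> n \<in> dom_of f) \<Longrightarrow>
    (\<And>m n. m \<le> n \<Longrightarrow> (\<phi> m, \<phi> n) \<in> leq f) \<Longrightarrow>
    (\<And>n. lab1 f (\<phi> (Suc n)) \<in> {lab2 f (\<phi> n), linv (lab2 f (\<phi> n))}) \<Longrightarrow> False"
  shows "no_chain f"
  unfolding no_chain_def
proof (rule notI, elim exE conjE)
  fix \<phi> :: "nat \<Rightarrow> 's"
  assume "inj \<phi>" "range \<phi> \<subseteq> dom_of f" "\<forall>m n. m \<le> n \<longrightarrow> (\<phi> m, \<phi> n) \<in> leq f"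
    "\<forall>n. lab1 f (\<phi> (Suc n)) \<in> {lab2 f (\<phi> n), linv (lab2 f (\<phi> n))}"
  then show False
    by (intro assms[of \<phi>]) auto
qed

lemma no_chainD:
  fixes \<phi> :: "nat \<Rightarrow> 's"
  assumes "no_chain f" "inj \<phi>" "\<And>n. \<phi> n \<in> dom_of f" "\<And>m n. m \<le> n \<Longrightarrow> (\<phi> m, \<phi> n) \<in> leq f"
    and "\<And>n. lab1 f (\<phi> (Suc n)) \<in> {lab2 f (\<phi> n), linv (lab2 f (\<phi> n))}"
  shows False
proof -
  have "range \<phi> \<subseteq> dom_of f"
    using assms(3) by auto
  with assms show False
    unfolding no_chain_def by blast
qed

text \<open>The parity of a position tells its factor. A chain can pass only from the factor marked
  \<open>c\<close> to the other one, so some tail lies in a single factor and is a chain there.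
  Reversal exchanges the factors, hence the parameter \<open>c\<close>.\<close>

lemma no_chain_two_parts:
  fixes h :: "(nat, elem) oword" and h' :: "bool \<Rightarrow> (nat, elem) oword"
  assumes parts: "\<And>b. no_chain (h' b)"
    and dom: "\<And>s. s \<in> dom_of h \<Longrightarrow>
      s div 2 \<in> dom_of (h' (even s)) \<and> lab (h' (even s)) (s div 2) = lab h s"
    and leq: "\<And>s t. (s, t) \<in> leq h \<Longrightarrow> even s = even t \<Longrightarrow> (s div 2, t div 2) \<in> leq (h' (even s))"
    and leave: "\<And>s t. (s, t) \<in> leq h \<Longrightarrow> even s \<noteq> c \<Longrightarrow> even t \<noteq> c"
  shows "no_chain h"
proof (rule no_chainI)
  fix \<phi> :: "nat \<Rightarrow> nat"
  assume \<phi>: "inj \<phi>" "\<And>n. \<phi> n \<in> dom_of h" "\<And>m n. m \<le> n \<Longrightarrow> (\<phi> m, \<phi> n) \<in> leq h"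
    "\<And>n. lab1 h (\<phi> (Suc n)) \<in> {lab2 h (\<phi> n), linv (lab2 h (\<phi> n))}"
  have same_parity: False if b: "\<And>m. even (\<phi> (k + m)) = b" for k b
  proof -
    define \<psi> where "\<psi> m = \<phi> (k + m) div 2" for m
    have \<psi>: "\<phi> (k + m) = 2 * \<psi> m + of_bool (\<not> b)" for m
    proof -
      have "2 * \<psi> m + \<phi> (k + m) mod 2 = \<phi> (k + m)"
        by (simp add: \<psi>_def)
      then show ?thesis
        using b[of m] mod_2_eq_odd[of "\<phi> (k + m)"] by simp
    qed
    have inj: "inj \<psi>"
    proof (rule injI)
      fix m n assume "\<psi> m = \<psi> n"
      then have "\<phi> (k + m) = \<phi> (k + n)"
        using \<psi> by simp
      then show "m = n"
        using \<phi>(1) by (simp add: inj_eq)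
    qed
    have part: "\<psi> m \<in> dom_of (h' b)" "lab (h' b) (\<psi> m) = lab h (\<phi> (k + m))" for m
      using dom[OF \<phi>(2)[of "k + m"]] b[of m] by (simp_all add: \<psi>_def)
    have mono: "(\<psi> m, \<psi> n) \<in> leq (h' b)" if "m \<le> n" for m n
      using leq[OF \<phi>(3)[of "k + m" "k + n"]] b[of m] b[of n] that by (simp add: \<psi>_def)
    have link: "lab1 (h' b) (\<psi> (Suc n)) \<in> {lab2 (h' b) (\<psi> n), linv (lab2 (h' b) (\<psi> n))}" for n
      using \<phi>(4)[of "k + n"] part(2) by simp
    show False
      by (rule no_chainD[OF parts inj part(1) mono link])
  qed
  show False
  proof (cases "\<forall>n. even (\<phi> n) = c")
    case True
    then have "even (\<phi> (0 + m)) = c" for m by simp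
    then show False by (rule same_parity)
  next
    case False
    then obtain k where "even (\<phi> k) \<noteq> c" by blast
    then have "even (\<phi> (k + m)) \<noteq> c" for m
      using leave[OF \<phi>(3)[of k "k + m"]] by simp
    then have "even (\<phi> (k + m)) = (\<not> c)" for m
      by (metis (full_types))
    then show False
      by (rule same_parity)
  qed
qed

lemma leq_oword_concat_parity:
  assumes "(s, t) \<in> leq (oword_concat f g)"
  shows "even s = even t \<Longrightarrow> (s div 2, t div 2) \<in> leq (if even s then f else g)"
    and "odd s \<Longrightarrow> odd t"
  using assms by (auto simp: oword_concat_sel(1))

lemma no_chain_oword_concat:
  assumes "f \<in> owords elems" "g \<in> owords elems" "no_chain f" "no_chain g"
  shows "no_chain (oword_concat f g)"
proof (rule no_chain_two_parts[where h' = "\<lambda>b. if b then f else g" and c = True])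
  note linear = owordsD(1)[OF assms(1)] owordsD(1)[OF assms(2)]
  fix s assume "s \<in> dom_of (oword_concat f g)"
  then show "s div 2 \<in> dom_of (if even s then f else g) \<and>
      lab (if even s then f else g) (s div 2) = lab (oword_concat f g) s"
    by (elim oword_concat_cases[OF _ linear]) (simp_all add: oword_concat_sel(2,3))
qed (use assms leq_oword_concat_parity[of _ _ f g] in \<open>auto split: if_splits\<close>)

lemma no_chain_bar_oword_concat:
  assumes "f \<in> owords elems" "g \<in> owords elems"
    "no_chain (oword_bar elem_inv f)" "no_chain (oword_bar elem_inv g)"
  shows "no_chain (oword_bar elem_inv (oword_concat f g))"
proof (rule no_chain_two_parts[where h' = "\<lambda>b. oword_bar elem_inv (if b then f else g)" and c = False])
  note linear = owordsD(1)[OF assms(1)] owordsD(1)[OF assms(2)]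
  fix s assume "s \<in> dom_of (oword_bar elem_inv (oword_concat f g))"
  then have "s \<in> dom_of (oword_concat f g)" by simp
  then show "s div 2 \<in> dom_of (oword_bar elem_inv (if even s then f else g)) \<and>
      lab (oword_bar elem_inv (if even s then f else g)) (s div 2) =
      lab (oword_bar elem_inv (oword_concat f g)) s"
    by (elim oword_concat_cases[OF _ linear]) (simp_all add: oword_concat_sel(2,3))
next
  fix s t assume st: "(s, t) \<in> leq (oword_bar elem_inv (oword_concat f g))"
  then have ts: "(t, s) \<in> leq (oword_concat f g)" by simp
  show "(s div 2, t div 2) \<in> leq (oword_bar elem_inv (if even s then f else g))" if "even s = even t"
    using leq_oword_concat_parity(1)[OF ts] that by simp
  show "even t \<noteq> False" if "even s \<noteq> False"
    using leq_oword_concat_parity(2)[OF ts] that by auto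
qed (use assms in simp)

lemma oword_concat_S_0:
  assumes "f \<in> S_0" "g \<in> S_0"
  shows "oword_concat f g \<in> S_0"
proof -
  let ?h = "oword_concat f g"
  have owords: "f \<in> owords elems" "g \<in> owords elems"
    using assms by (simp_all add: S_0_def)
  have "finite {s \<in> dom_of ?h. lab1 ?h s = x}" for x
  proof -
    have "{s \<in> dom_of ?h. lab1 ?h s = x} \<subseteq> (\<lambda>s. 2 * s) ` {s \<in> dom_of f. lab1 f s = x} \<union>
        (\<lambda>s. Suc (2 * s)) ` {s \<in> dom_of g. lab1 g s = x}"
      by (auto simp: dom_oword_concat[OF owords[THEN owordsD(1)]] oword_concat_sel(2,3))
    moreover have "finite {s \<in> dom_of f. lab1 f s = x}" "finite {s \<in> dom_of g. lab1 g s = x}"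
      using assms unfolding S_0_def by blast+
    ultimately show ?thesis
      using finite_subset by (metis (no_types, lifting) finite_UnI finite_imageI)
  qed
  then show ?thesis
    using oword_concat_owords[OF owords] unfolding S_0_def by blast
qed

lemma oword_concat_SS:
  assumes "f \<in> SS" "g \<in> SS"
  shows "oword_concat f g \<in> SS"
proof -
  have owords: "f \<in> owords elems" "g \<in> owords elems"
    using assms by (simp_all add: SS_def S_1_iff)
  have bar: "oword_bar elem_inv h \<in> owords elems" if "h \<in> owords elems" for h :: "(nat, elem) oword"
  proof -
    have "finite {s \<in> dom_of h. elem_inv (lab h s) = e}" if "e \<in> elems" for e
    proof -
      have "{s \<in> dom_of h. elem_inv (lab h s) = e} = {s \<in> dom_of h. lab h s = elem_inv e}"
        by (metis elem_inv_simps(1))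
      then show ?thesis
        using \<open>h \<in> owords elems\<close> that by (simp add: owords_def)
    qed
    then show ?thesis
      using that by (auto simp: owords_def)
  qed
  show ?thesis
    using assms oword_concat_S_0[of f g] no_chain_oword_concat[OF owords]
      no_chain_bar_oword_concat[OF owords] oword_concat_owords[OF owords] bar
    by (simp add: SS_def S_1_iff)
qed

lemma finite_product_concat:
  assumes f: "f \<in> owords elems" and g: "g \<in> owords elems" and La: "finite La"
  shows "finite_product (oword_concat f g) La w = finite_product g La (finite_product f La w)"
proof -
  let ?h = "oword_concat f g"
  obtain l where l: "set l = label_part f La" "sorted_wrt (strictly (leq f)) l"
    "finite_product f La = elem_prod (map (lab f) l)" "set (map (lab f) l) \<subseteq> elems" "set l \<subseteq> dom_of f"
    using label_part_list[OF f La] .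
  obtain l' where l': "set l' = label_part g La" "sorted_wrt (strictly (leq g)) l'"
    "finite_product g La = elem_prod (map (lab g) l')" "set (map (lab g) l') \<subseteq> elems" "set l' \<subseteq> dom_of g"
    using label_part_list[OF g La] .
  let ?l = "map (\<lambda>s. 2 * s) l @ map (\<lambda>s. Suc (2 * s)) l'"
  have ne: "2 * a \<noteq> Suc (2 * b)" for a b :: nat by presburger
  have "finite_product ?h La = elem_prod (map (lab ?h) ?l)"
  proof (rule finite_product_eq[OF oword_concat_owords[OF f g]])
    show "set ?l = label_part ?h La"
      using l(1) l'(1) by (auto simp: label_part_def oword_concat_sel(2,3)
          dom_oword_concat[OF owordsD(1)[OF f] owordsD(1)[OF g]])
    show "sorted_wrt (strictly (leq ?h)) ?l"
      using l(2,5) l'(2,5) ne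
      by (auto simp: sorted_wrt_append sorted_wrt_map)
  qed
  also have "map (lab ?h) ?l = map (lab f) l @ map (lab g) l'"
    by (simp add: oword_concat_sel(2,3))
  finally show ?thesis
    using l(3) l'(3) by simp
qed

text \<open>The product of classes in \<open>BF\<close> ranges over all representatives
  \<open>f'\<close> and \<open>g'\<close>, also outside \<open>SS\<close>, and a representative
  \<open>h\<close> in \<open>SS\<close> need not be a concatenation. One closed set of labels links
  the three values of \<open>alpha\<close>.\<close>

lemma alpha_concat_equiv:
  assumes f: "f \<in> SS" and g: "g \<in> SS" and h: "h \<in> SS"
    and f': "(f, f') \<in> oword_equiv elems elem_inv" and g': "(g, g') \<in> oword_equiv elems elem_inv"
    and h': "(oword_concat f' g', h) \<in> oword_equiv elems elem_inv"
  shows "alpha h = compose (carrier F_omega) (alpha g) (alpha f)"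
proof (rule extensionalityI[where A = "carrier F_omega"])
  interpret f: finitary_word f using f by (rule finitary_word_SS)
  interpret g: finitary_word g using g by (rule finitary_word_SS)
  interpret h: finitary_word h using h by (rule finitary_word_SS)
  fix w :: "xletter list" assume "w \<in> carrier F_omega"
  then have w: "reduced w" by simp
  have red: "reduced (alpha f w)"
    using hom_in_carrier[OF f.alpha_hom, of w] w by simp
  obtain La where La: "finite La"
    "\<And>La'. finite La' \<Longrightarrow> La \<subseteq> La' \<Longrightarrow> alpha f w = finite_product f La' w"
    using f.alpha_finite_product[of "{w}"] w by auto
  obtain Lb where Lb: "finite Lb"
    "\<And>La'. finite La' \<Longrightarrow> Lb \<subseteq> La' \<Longrightarrow> alpha g (alpha f w) = finite_product g La' (alpha f w)"
    using g.alpha_finite_product[of "{alpha f w}"] red by auto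
  obtain Lc where Lc: "finite Lc"
    "\<And>La'. finite La' \<Longrightarrow> Lc \<subseteq> La' \<Longrightarrow> alpha h w = finite_product h La' w"
    using h.alpha_finite_product[of "{w}"] w by auto
  obtain La' where La': "finite La'" "La \<union> Lb \<union> Lc \<subseteq> La'" "\<And>e. e \<in> La' \<Longrightarrow> elem_inv e \<in> La'"
    using label_closure[of "La \<union> Lb \<union> Lc"] La(1) Lb(1) Lc(1) by auto
  have owords: "f' \<in> owords elems" "g' \<in> owords elems"
    using f' g' by (auto simp: oword_equiv_def Let_def)
  have "alpha h w = finite_product h La' w"
    using Lc(2) La' by simp
  also have "\<dots> = finite_product (oword_concat f' g') La' w"
    using finite_product_equiv[OF h' La'(1,3) w] by simp
  also have "\<dots> = finite_product g' La' (finite_product f' La' w)"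
    by (rule finite_product_concat[OF owords La'(1)])
  also have "finite_product f' La' w = alpha f w"
    using finite_product_equiv[OF f' La'(1,3) w] La(2) La' by simp
  also have "finite_product g' La' (alpha f w) = alpha g (alpha f w)"
    using finite_product_equiv[OF g' La'(1,3) red] Lb(2) La' by simp
  finally show "alpha h w = compose (carrier F_omega) (alpha g) (alpha f) w"
    using w by (simp add: compose_def)
qed (simp_all add: alpha_def compose_def)

section \<open>The map \<open>Psi\<close> on classes\<close>

abbreviation BF_class :: "(nat, elem) oword \<Rightarrow> (nat, elem) oword set" where
  "BF_class f \<equiv> oword_equiv elems elem_inv `` {f}"

lemma BF_class_self:
  assumes "f \<in> SS"
  shows "f \<in> BF_class f"
  using assms by (simp add: oword_equiv_def Let_def SS_def S_1_iff)

lemma Psi_eq: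
  assumes "C \<inter> SS \<noteq> {}" "\<And>f. f \<in> C \<inter> SS \<Longrightarrow> alpha f = \<theta>"
  shows "Psi C = \<theta>"
proof -
  have "alpha ` (C \<inter> SS) = {\<theta>}"
    using assms by blast
  then show ?thesis by (simp add: Psi_def)
qed

lemma Psi_BF_class:
  assumes "f \<in> SS"
  shows "Psi (BF_class f) = alpha f"
proof (rule Psi_eq)
  show "BF_class f \<inter> SS \<noteq> {}"
    using assms BF_class_self by blast
  show "alpha g = alpha f" if "g \<in> BF_class f \<inter> SS" for g
    using alpha_equiv[OF assms, of g] that by simp
qed

lemma Psi_hom: "Psi \<in> hom BF_E (right_Aut F_omega)"
proof (rule homI)
  fix A assume "A \<in> carrier BF_E"
  then obtain f where f: "f \<in> SS" "A = BF_class f"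
    by (auto simp: BF_def)
  then show "Psi A \<in> carrier (right_Aut F_omega)"
    using alpha_auto[OF f(1)] Psi_BF_class[OF f(1)]
    by (simp add: right_Aut_def AutoGroup_def BijGroup_def)
  fix B assume "B \<in> carrier BF_E"
  then obtain g where g: "g \<in> SS" "B = BF_class g"
    by (auto simp: BF_def)
  have mult: "A \<otimes>\<^bsub>BF_E\<^esub> B = (\<Union>f'\<in>A. \<Union>g'\<in>B. BF_class (oword_concat f' g'))"
    by (simp add: BF_def)
  have "Psi (A \<otimes>\<^bsub>BF_E\<^esub> B) = compose (carrier F_omega) (alpha g) (alpha f)"
  proof (rule Psi_eq)
    have "oword_concat f g \<in> A \<otimes>\<^bsub>BF_E\<^esub> B"
      unfolding mult unfolding f(2) g(2) using BF_class_self[OF f(1)] BF_class_self[OF g(1)]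
        BF_class_self[OF oword_concat_SS[OF f(1) g(1)]] by blast
    then show "A \<otimes>\<^bsub>BF_E\<^esub> B \<inter> SS \<noteq> {}"
      using oword_concat_SS[OF f(1) g(1)] by blast
    show "alpha h = compose (carrier F_omega) (alpha g) (alpha f)" if "h \<in> A \<otimes>\<^bsub>BF_E\<^esub> B \<inter> SS" for h
      using that alpha_concat_equiv[OF f(1) g(1), of h] unfolding mult unfolding f(2) g(2) by blast
  qed
  \<comment> \<open>In \<open>right_Aut\<close> the left factor acts first, as in a
    concatenation.\<close>
  also have "\<dots> = Psi A \<otimes>\<^bsub>right_Aut F_omega\<^esub> Psi B"
    using alpha_auto[OF f(1)] alpha_auto[OF g(1)]
    by (simp add: f(2) g(2) Psi_BF_class f(1) g(1) right_Aut_def AutoGroup_def BijGroup_def auto_def)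
  finally show "Psi (A \<otimes>\<^bsub>BF_E\<^esub> B) = Psi A \<otimes>\<^bsub>right_Aut F_omega\<^esub> Psi B" .
qed

section \<open>Surjectivity\<close>

lemma fixed_word:
  assumes "th \<in> hom F_omega F_omega" "reduced w" "\<And>x. x \<in> set w \<Longrightarrow> th [x] = [x]"
  shows "th w = w"
  using word_hom_letters[of th id w] assms by (auto simp: hom_def)

lemma iso_inv_into:
  assumes "th \<in> iso F_omega F_omega"
  shows "inv_into {w. reduced w} th \<in> iso F_omega F_omega"
    and "reduced w \<Longrightarrow> inv_into {w. reduced w} th (th w) = w"
  using group.iso_set_sym[OF group_free_group assms] assms
  by (auto simp: iso_def bij_betw_def inv_into_f_f)

lemma bounded_labels:
  fixes L :: "elem list"
  obtains c where "\<And>e. e \<in> set L \<Longrightarrow> fst (fst e) < c \<and> fst (snd e) < c"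
proof
  fix e assume "e \<in> set L"
  then have "fst (fst e) \<in> insert 0 ((\<lambda>e. fst (fst e)) ` set L \<union> (\<lambda>e. fst (snd e)) ` set L)"
    "fst (snd e) \<in> insert 0 ((\<lambda>e. fst (fst e)) ` set L \<union> (\<lambda>e. fst (snd e)) ` set L)"
    by auto
  then show "fst (fst e) < Suc (Max (insert 0 ((\<lambda>e. fst (fst e)) ` set L \<union> (\<lambda>e. fst (snd e)) ` set L))) \<and>
      fst (snd e) < Suc (Max (insert 0 ((\<lambda>e. fst (fst e)) ` set L \<union> (\<lambda>e. fst (snd e)) ` set L)))"
    unfolding less_Suc_eq_le by (intro conjI Max_ge) simp_all
qed

text \<open>\<open>n\<close> is the bound reached and \<open>N\<close> the next goal, set before
  \<open>L\<close> is known; the letters of \<open>L\<close> are not yet bounded from above.\<close>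

definition stage :: "(xletter list \<Rightarrow> xletter list) \<Rightarrow> nat \<Rightarrow> nat \<Rightarrow> elem list \<Rightarrow> bool" where
  "stage th n N L \<longleftrightarrow> th \<in> iso F_omega F_omega \<and> (\<forall>x. fst x < n \<longrightarrow> th [x] = [x]) \<and> n < N \<and>
    set L \<subseteq> elems \<and> (\<forall>e\<in>set L. n \<le> fst (fst e)) \<and> (\<forall>x. fst x < N \<longrightarrow> th (elem_prod L [x]) = [x])"

lemma stage_exists:
  assumes "th \<in> iso F_omega F_omega" "\<And>x. fst x < n \<Longrightarrow> th [x] = [x]"
  shows "\<exists>N L. c \<le> N \<and> stage th n N L"
  using extend_fixed_letters[of th n "Suc (n + c)"] assms
  by (intro exI[of _ "Suc (n + c)"]) (simp add: stage_def)

text \<open>The bound \<open>n (Suc (Suc k))\<close> is chosen when \<open>L k\<close> is known,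
  whereas \<open>n (Suc k)\<close> was its goal; hence the offset of two. The states of the
  dependent choice carry the next goal for this reason.\<close>

lemma stage_sequence:
  assumes \<theta>: "\<theta> \<in> iso F_omega F_omega"
  shows "\<exists>th n L. th 0 = \<theta> \<and> (\<forall>k. stage (th k) (n k) (n (Suc k)) (L k)) \<and>
    (\<forall>k. \<forall>e\<in>set (L k). fst (fst e) < n (Suc (Suc k)) \<and> fst (snd e) < n (Suc (Suc k))) \<and>
    (\<forall>k w. reduced w \<longrightarrow> th (Suc k) (th k (elem_prod (L k) w)) = w)"
proof -
  define P where "P k s \<longleftrightarrow> (case s of (th, n, N, L) \<Rightarrow> (k = 0 \<longrightarrow> th = \<theta>) \<and> stage th n N L)" for k :: nat and s
  define Q where "Q s s' \<longleftrightarrow> (case s of (th, n, N, L) \<Rightarrow> case s' of (th', n', N', L') \<Rightarrow> n' = N \<and>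
    (\<forall>e\<in>set L. fst (fst e) < N' \<and> fst (snd e) < N') \<and> (\<forall>w. reduced w \<longrightarrow> th' (th (elem_prod L w)) = w))"
    for s s' :: "(xletter list \<Rightarrow> xletter list) \<times> nat \<times> nat \<times> elem list"
  have "\<exists>s. \<forall>k. P k (s k) \<and> Q (s k) (s (Suc k))"
  proof (rule dependent_nat_choice)
    obtain N L where "stage \<theta> 0 N L"
      using stage_exists[OF \<theta>, of 0 0] by blast
    then show "\<exists>s. P 0 s"
      by (intro exI[of _ "(\<theta>, 0, N, L)"]) (simp add: P_def)
    fix s :: "(xletter list \<Rightarrow> xletter list) \<times> nat \<times> nat \<times> elem list" and k
    assume "P k s"
    then obtain th n N L where s: "s = (th, n, N, L)" and stage: "stage th n N L"
      by (auto simp: P_def)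
    \<comment> \<open>The inverse of the improved automorphism fixes the same letters below
      \<open>N\<close>; passing to it lets the next factor be split off on the other side.\<close>
    define th' where "th' = inv_into {w. reduced w} (th \<circ> elem_prod L)"
    have "th \<circ> elem_prod L \<in> iso F_omega F_omega"
      using stage iso_set_trans[OF elem_prod_iso, of L th F_omega] by (simp add: stage_def)
    note th' = iso_inv_into[OF this, folded th'_def]
    have "th' [x] = [x]" if "fst x < N" for x
      using th'(2)[of "[x]"] stage that by (simp add: stage_def del: split_paired_All)
    obtain c where c: "\<And>e. e \<in> set L \<Longrightarrow> fst (fst e) < c \<and> fst (snd e) < c"
      using bounded_labels[of L] by blast
    obtain N' L' where "c \<le> N'" "stage th' N N' L'"
      using stage_exists[OF th'(1), of N c] \<open>\<And>x. fst x < N \<Longrightarrow> th' [x] = [x]\<close> by blast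
    moreover have "fst (fst e) < N' \<and> fst (snd e) < N'" if "e \<in> set L" for e
      using c[OF that] \<open>c \<le> N'\<close> by linarith
    ultimately show "\<exists>s'. P (Suc k) s' \<and> Q s s'"
      using th'(2) by (intro exI[of _ "(th', N, N', L')"]) (simp add: P_def Q_def s del: split_paired_All)
  qed
  then obtain s where s: "\<And>k. P k (s k)" "\<And>k. Q (s k) (s (Suc k))"
    by blast
  define th n N L where "th k = fst (s k)" and "n k = fst (snd (s k))" and "N k = fst (snd (snd (s k)))"
    and "L k = snd (snd (snd (s k)))" for k
  have sk: "s k = (th k, n k, N k, L k)" for k
    by (simp add: th_def n_def N_def L_def)
  have N: "N k = n (Suc k)" for k
    using s(2)[of k] unfolding Q_def sk by simp
  show ?thesis
  proof (intro exI conjI allI ballI impI)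
    show "th 0 = \<theta>" using s(1)[of 0] unfolding P_def sk by simp
    show "stage (th k) (n k) (n (Suc k)) (L k)" for k
      using s(1)[of k] unfolding P_def sk N by simp
    show "fst (fst e) < n (Suc (Suc k))" "fst (snd e) < n (Suc (Suc k))" if "e \<in> set (L k)" for k e
      using s(2)[of k] that unfolding Q_def sk N by auto
    show "th (Suc k) (th k (elem_prod (L k) w)) = w" if "reduced w" for k w
      using s(2)[of k] that unfolding Q_def sk N by auto
  qed
qed

text \<open>The even blocks in increasing order, followed by the odd blocks in decreasing order.\<close>

definition rank :: "nat \<Rightarrow> real" where
  "rank k = (if even k then - (1 / (real k + 1)) else 1 / (real k + 1))"

lemma rank_less_iff:
  "rank k < rank m \<longleftrightarrow> (if even k then odd m \<or> k < m else odd m \<and> m < k)"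
proof -
  have pos: "0 < 1 / (real i + 1)" for i :: nat
    by simp
  have less: "1 / (real i + 1) < 1 / (real j + 1) \<longleftrightarrow> j < i" for i j :: nat
    by (simp add: divide_less_eq less_divide_eq)
  have "- (1 / (real i + 1)) < 1 / (real j + 1)" "\<not> 1 / (real i + 1) < - (1 / (real j + 1))" for i j :: nat
    using pos[of i] pos[of j] by linarith+
  then show ?thesis
    by (cases "even k"; cases "even m") (simp_all add: rank_def less)
qed

lemma rank_eq_iff [simp]: "rank k = rank m \<longleftrightarrow> k = m"
proof -
  have "rank k < rank m \<or> rank m < rank k" if "k \<noteq> m"
    using that by (auto simp: rank_less_iff)
  then show ?thesis by (metis order_less_irrefl)
qed

section \<open>Words assembled from finite blocks\<close>

definition block_index :: "nat \<Rightarrow> nat" where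
  "block_index s = fst (prod_decode s)"

definition offset :: "nat \<Rightarrow> nat" where
  "offset s = snd (prod_decode s)"

lemma block_index_offset [simp]:
  "block_index (prod_encode (k, j)) = k" "offset (prod_encode (k, j)) = j"
  by (simp_all add: block_index_def offset_def)

lemma position_eqI: "block_index s = block_index t \<Longrightarrow> offset s = offset t \<Longrightarrow> s = t"
  unfolding block_index_def offset_def by (metis prod.collapse prod_decode_inverse)

text \<open>Positions are coded pairs of block and offset, which keeps the domain inside
  \<open>nat\<close>; the order between blocks is left to \<open>rank\<close>.\<close>

definition block_word :: "(nat \<Rightarrow> elem list) \<Rightarrow> (nat, elem) oword" where
  "block_word B =
    \<lparr>leq = {(s, t). offset s < length (B (block_index s)) \<and> offset t < length (B (block_index t)) \<and>
       (rank (block_index s) < rank (block_index t) \<or> block_index s = block_index t \<and> offset s \<le> offset t)},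
     lab = (\<lambda>s. B (block_index s) ! offset s)\<rparr>"

lemma dom_block_word: "dom_of (block_word B) = {s. offset s < length (B (block_index s))}"
  by (auto simp: block_word_def Field_def)

lemma lab_block_word [simp]: "lab (block_word B) s = B (block_index s) ! offset s"
  by (simp add: block_word_def)

lemma leq_block_word:
  "(s, t) \<in> leq (block_word B) \<longleftrightarrow> s \<in> dom_of (block_word B) \<and> t \<in> dom_of (block_word B) \<and>
    (rank (block_index s) < rank (block_index t) \<or> block_index s = block_index t \<and> offset s \<le> offset t)"
  unfolding dom_block_word by (simp add: block_word_def)

lemma linear_block_word: "Linear_order (leq (block_word B))"
proof -
  let ?f = "block_word B"
  have "Refl (leq ?f)"
    unfolding refl_on_def using leq_block_word by auto
  moreover have "trans (leq ?f)"
    by (rule transI) (auto simp: leq_block_word)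
  moreover have "antisym (leq ?f)"
    by (rule antisymI) (auto simp: leq_block_word intro: position_eqI)
  moreover have "Total (leq ?f)"
    unfolding total_on_def leq_block_word using rank_eq_iff by (metis linorder_cases nat_le_linear)
  moreover have "leq ?f \<subseteq> dom_of ?f \<times> dom_of ?f"
    by (auto intro: FieldI1 FieldI2)
  ultimately show ?thesis
    by (simp add: order_on_defs)
qed

lemma finite_blocks: "finite {s \<in> dom_of (block_word B). block_index s \<le> M}"
proof -
  have "{s \<in> dom_of (block_word B). block_index s \<le> M} \<subseteq>
      (\<Union>k\<le>M. (\<lambda>j. prod_encode (k, j)) ` {..<length (B k)})"
  proof
    fix s assume "s \<in> {s \<in> dom_of (block_word B). block_index s \<le> M}"
    then have "s = prod_encode (block_index s, offset s)" "offset s < length (B (block_index s))"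
      "block_index s \<le> M"
      by (auto simp: dom_block_word intro: position_eqI)
    then show "s \<in> (\<Union>k\<le>M. (\<lambda>j. prod_encode (k, j)) ` {..<length (B k)})"
      by blast
  qed
  then show ?thesis
    by (rule finite_subset) simp
qed

definition block :: "(nat \<Rightarrow> elem list) \<Rightarrow> nat \<Rightarrow> nat list" where
  "block B k = map (\<lambda>j. prod_encode (k, j)) [0..<length (B k)]"

lemma set_block: "set (block B k) = {s \<in> dom_of (block_word B). block_index s = k}"
proof (intro equalityI subsetI)
  fix s assume "s \<in> {s \<in> dom_of (block_word B). block_index s = k}"
  then have "s = prod_encode (k, offset s)" "offset s < length (B k)"
    by (auto simp: dom_block_word intro: position_eqI)
  then show "s \<in> set (block B k)"
    unfolding block_def by (simp only: set_map set_upt) (rule image_eqI[of _ _ "offset s"], auto)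
qed (auto simp: block_def dom_block_word)

lemma lab_block: "map (lab (block_word B)) (block B k) = B k"
  by (simp add: block_def comp_def map_nth)

lemma sorted_block: "sorted_wrt (strictly (leq (block_word B))) (block B k)"
  by (auto simp: block_def sorted_wrt_map sorted_wrt_iff_nth_less leq_block_word dom_block_word)

lemma sorted_wrt_concat:
  assumes "\<And>xs. xs \<in> set xss \<Longrightarrow> sorted_wrt R xs"
    and "sorted_wrt (\<lambda>xs ys. \<forall>x\<in>set xs. \<forall>y\<in>set ys. R x y) xss"
  shows "sorted_wrt R (concat xss)"
  using assms by (induction xss) (auto simp: sorted_wrt_append)

lemma sorted_blocks:
  assumes "sorted_wrt (\<lambda>k m. rank k < rank m) ks"
  shows "sorted_wrt (strictly (leq (block_word B))) (concat (map (block B) ks))"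
proof (rule sorted_wrt_concat)
  show "sorted_wrt (\<lambda>xs ys. \<forall>x\<in>set xs. \<forall>y\<in>set ys. strictly (leq (block_word B)) x y) (map (block B) ks)"
    unfolding sorted_wrt_map
    by (rule sorted_wrt_mono_rel[OF _ assms]) (auto simp: set_block leq_block_word)
qed (auto simp: sorted_block)

text \<open>Only the single transition out of parity \<open>p\<close> can raise the value; before
  and after it the sequence does not increase.\<close>

lemma bounded_parity_sequence:
  fixes k :: "nat \<Rightarrow> nat"
  assumes stay: "\<And>i. even (k i) \<noteq> p \<Longrightarrow> even (k (Suc i)) \<noteq> p \<and> k (Suc i) \<le> k i"
    and same: "\<And>i. even (k i) = p \<Longrightarrow> even (k (Suc i)) = p \<Longrightarrow> k (Suc i) \<le> k i"
  shows "\<exists>M. \<forall>i. k i \<le> M"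
proof (cases "\<forall>i. even (k i) = p")
  case True
  then have "k (Suc i) \<le> k i" for i
    using same by blast
  then have "k i \<le> k 0" for i
    by (induction i) (auto intro: order_trans)
  then show ?thesis by blast
next
  case False
  then obtain m where m: "even (k m) \<noteq> p" by blast
  have "even (k (m + i)) \<noteq> p \<and> k (m + i) \<le> k m" for i
  proof (induction i)
    case (Suc i)
    with stay[of "m + i"] show ?case by (auto intro: order_trans)
  qed (simp add: m)
  then have after: "k i \<le> k m" if "m \<le> i" for i
    using that by (metis le_add_diff_inverse)
  have "k i \<le> Max (k ` {..m})" for i
  proof (cases "m \<le> i")
    case True
    then have "k i \<le> k m" by (rule after)
    also have "\<dots> \<le> Max (k ` {..m})" by simp
    finally show ?thesis .
  qed simp
  then show ?thesis by blast
qed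

text \<open>Second labels of block \<open>k\<close> lie below all first labels from block
  \<open>k + 2\<close> on; between blocks \<open>k\<close> and \<open>k + 1\<close> nothing of the
  kind is assumed.\<close>

locale stages =
  fixes B :: "nat \<Rightarrow> elem list" and n :: "nat \<Rightarrow> nat"
  assumes elems: "set (B k) \<subseteq> elems"
    and strict: "n k < n (Suc k)"
    and lower: "e \<in> set (B k) \<Longrightarrow> n k \<le> fst (fst e)"
    and upper: "e \<in> set (B k) \<Longrightarrow> fst (snd e) < n (Suc (Suc k))"
begin

lemma strict_mono_n: "strict_mono n"
  by (simp add: strict_mono_Suc_iff strict)

lemma lab_in_block: "s \<in> dom_of (block_word B) \<Longrightarrow> lab (block_word B) s \<in> set (B (block_index s))"
  by (simp add: dom_block_word)

text \<open>As \<open>n\<close> grows strictly, first labels in block \<open>k\<close> have index at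
  least \<open>k\<close>, so a given one occurs in finitely many blocks.\<close>

lemma block_word_S_0: "block_word B \<in> S_0"
proof -
  let ?f = "block_word B"
  have finite: "finite {s \<in> dom_of ?f. lab1 ?f s = x}" for x
  proof (rule finite_subset)
    show "{s \<in> dom_of ?f. lab1 ?f s = x} \<subseteq> {s \<in> dom_of ?f. block_index s \<le> fst x}"
    proof safe
      fix s assume s: "s \<in> dom_of ?f"
      have "block_index s \<le> n (block_index s)"
        by (rule strict_mono_imp_increasing[OF strict_mono_n])
      also have "\<dots> \<le> fst (lab1 ?f s)"
        using lower[OF lab_in_block[OF s]] .
      finally show "block_index s \<le> fst (lab1 ?f s)" .
    qed
  qed (rule finite_blocks)
  have "finite {s \<in> dom_of ?f. lab ?f s = e}" for e
    by (rule finite_subset[OF _ finite[of "fst e"]]) auto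
  moreover have "lab ?f ` dom_of ?f \<subseteq> elems"
    using lab_in_block elems by blast
  ultimately have "?f \<in> owords elems"
    unfolding owords_def using linear_block_word by blast
  then show ?thesis
    unfolding S_0_def using finite by blast
qed

lemma link_block_index:
  assumes "s \<in> dom_of (block_word B)" "t \<in> dom_of (block_word B)"
    and "fst (lab1 (block_word B) t) = fst (lab2 (block_word B) s)"
  shows "block_index t \<le> Suc (block_index s)"
proof -
  have "n (block_index t) < n (Suc (Suc (block_index s)))"
    using lower[OF lab_in_block[OF assms(2)]] upper[OF lab_in_block[OF assms(1)]] assms(3) by simp
  then show ?thesis
    using strict_mono_less[OF strict_mono_n] by (simp add: less_Suc_eq_le)
qed

lemma no_chain_bounded:
  fixes \<phi> :: "nat \<Rightarrow> nat"
  assumes "inj \<phi>" "\<And>i. \<phi> i \<in> dom_of (block_word B)" "\<And>i. block_index (\<phi> i) \<le> M"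
  shows False
proof -
  have "range \<phi> \<subseteq> {s \<in> dom_of (block_word B). block_index s \<le> M}"
    using assms by auto
  then have "finite (range \<phi>)"
    using finite_blocks by (rule finite_subset)
  then show False
    using assms(1) by (simp add: finite_image_iff)
qed

text \<open>Here the alternation pays off: a link within one end of the word climbs by at most one
  block, hence not at all.\<close>

lemma le_Suc_same_parity: "(m::nat) \<le> Suc k \<Longrightarrow> even m = even k \<Longrightarrow> m \<le> k"
  by (cases "m = Suc k") auto

text \<open>Among even blocks the links forbid a larger index, and among odd blocks the order does.
  So a chain meets finitely many blocks, which contradicts injectivity.\<close>

lemma block_word_no_chain: "no_chain (block_word B)"
proof (rule no_chainI)
  let ?f = "block_word B"
  fix \<phi> :: "nat \<Rightarrow> nat"
  assume \<phi>: "inj \<phi>" "\<And>i. \<phi> i \<in> dom_of ?f" "\<And>i j. i \<le> j \<Longrightarrow> (\<phi> i, \<phi> j) \<in> leq ?f"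
    "\<And>i. lab1 ?f (\<phi> (Suc i)) \<in> {lab2 ?f (\<phi> i), linv (lab2 ?f (\<phi> i))}"
  define k where "k i = block_index (\<phi> i)" for i
  have "fst (lab1 ?f (\<phi> (Suc i))) = fst (lab2 ?f (\<phi> i))" for i
    using \<phi>(4)[of i] by auto
  then have Suc: "k (Suc i) \<le> Suc (k i)" for i
    unfolding k_def using \<phi>(2) by (intro link_block_index)
  have rank: "rank (k i) < rank (k (Suc i)) \<or> k i = k (Suc i)" for i
    using \<phi>(3)[of i "Suc i"] unfolding leq_block_word k_def by auto
  have "\<exists>M. \<forall>i. k i \<le> M"
  proof (rule bounded_parity_sequence[where p = True])
    show "even (k (Suc i)) \<noteq> True \<and> k (Suc i) \<le> k i" if "even (k i) \<noteq> True" for i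
      using rank[of i] that by (auto simp: rank_less_iff)
    show "k (Suc i) \<le> k i" if "even (k i) = True" "even (k (Suc i)) = True" for i
      using le_Suc_same_parity[OF Suc] that by simp
  qed
  then obtain M where "\<And>i. block_index (\<phi> i) \<le> M"
    by (auto simp: k_def)
  with \<phi>(1,2) show False
    by (rule no_chain_bounded)
qed

text \<open>Reversal exchanges the ends: the odd blocks now come first with rising index and are
  controlled by the links, the even ones by the order. Inverting second labels keeps their
  indices.\<close>

lemma block_word_bar_no_chain: "no_chain (oword_bar elem_inv (block_word B))"
proof (rule no_chainI)
  let ?f = "block_word B" and ?g = "oword_bar elem_inv (block_word B)"
  fix \<phi> :: "nat \<Rightarrow> nat"
  assume \<phi>: "inj \<phi>" "\<And>i. \<phi> i \<in> dom_of ?g" "\<And>i j. i \<le> j \<Longrightarrow> (\<phi> i, \<phi> j) \<in> leq ?g"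
    "\<And>i. lab1 ?g (\<phi> (Suc i)) \<in> {lab2 ?g (\<phi> i), linv (lab2 ?g (\<phi> i))}"
  have dom: "\<phi> i \<in> dom_of ?f" for i
    using \<phi>(2)[of i] by simp
  define k where "k i = block_index (\<phi> i)" for i
  have "fst (lab1 ?f (\<phi> (Suc i))) = fst (lab2 ?f (\<phi> i))" for i
    using \<phi>(4)[of i] by auto
  then have Suc: "k (Suc i) \<le> Suc (k i)" for i
    unfolding k_def using dom by (intro link_block_index)
  have rank: "rank (k (Suc i)) < rank (k i) \<or> k i = k (Suc i)" for i
    using \<phi>(3)[of i "Suc i"] by (auto simp: leq_block_word k_def)
  have "\<exists>M. \<forall>i. k i \<le> M"
  proof (rule bounded_parity_sequence[where p = False])
    show "even (k (Suc i)) \<noteq> False \<and> k (Suc i) \<le> k i" if "even (k i) \<noteq> False" for i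
      using rank[of i] that by (auto simp: rank_less_iff split: if_splits)
    show "k (Suc i) \<le> k i" if "even (k i) = False" "even (k (Suc i)) = False" for i
      using le_Suc_same_parity[OF Suc] that by simp
  qed
  then obtain M where "\<And>i. block_index (\<phi> i) \<le> M"
    by (auto simp: k_def)
  with \<phi>(1) dom show False
    by (rule no_chain_bounded)
qed

lemma block_word_SS: "block_word B \<in> SS"
proof -
  interpret finitary_word "block_word B"
    by unfold_locales (rule block_word_S_0, rule block_word_no_chain)
  let ?g = "oword_bar elem_inv (block_word B)"
  have "finite {s \<in> dom_of ?g. lab ?g s = e}" for e
    using finite_lab1[of "{fst e}"] by (rule rev_finite_subset) auto
  moreover have "lab ?g ` dom_of ?g \<subseteq> elems"
    using lab_elems by (auto simp del: lab_block_word)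
  ultimately have "?g \<in> owords elems"
    unfolding owords_def using linear by simp
  then show ?thesis
    using block_word_S_0 block_word_no_chain block_word_bar_no_chain owords
    by (simp add: SS_def S_1_iff)
qed

text \<open>The blocks at the two ends of the word; what is missing is the middle, where the
  remainder \<open>th (2 * K)\<close> will stand.\<close>

definition block_order :: "nat \<Rightarrow> nat list" where
  "block_order K = map (\<lambda>i. 2 * i) [0..<K] @ map (\<lambda>i. 2 * i + 1) (rev [0..<K])"

lemma block_order_sorted: "sorted_wrt (\<lambda>k m. rank k < rank m) (block_order K)"
  by (auto simp: block_order_def sorted_wrt_append sorted_wrt_map sorted_wrt_rev rank_less_iff
      simp flip: rev_map intro: sorted_wrt_mono_rel[OF _ sorted_wrt_upt])

lemma set_block_order: "set (block_order K) = {..<2 * K}"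
proof -
  have "k \<in> (\<lambda>i. 2 * i) ` {0..<K} \<or> k \<in> (\<lambda>i. 2 * i + 1) ` {0..<K}" if "k < 2 * K" for k
    using that by (cases "even k") (auto elim!: evenE oddE)
  then show ?thesis
    by (auto simp: block_order_def)
qed

text \<open>Convergence: the positions of the letters of \<open>w\<close> lie in finitely many
  blocks, so further blocks inserted in the middle leave the value unchanged.\<close>

lemma alpha_block_word:
  assumes "reduced w"
  shows "\<exists>K0. \<forall>K\<ge>K0. alpha (block_word B) w = elem_prod (concat (map B (block_order K))) w"
proof (intro exI allI impI)
  interpret finitary_word "block_word B"
    by unfold_locales (rule block_word_S_0, rule block_word_no_chain)
  let ?f = "block_word B"
  define P where "P = (\<Union>x\<in>set w. set (positions ?f x))"
  define K0 where "K0 = Suc (Max (insert 0 (block_index ` P)))"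
  have K0: "block_index s < K0" if "s \<in> P" for s
    unfolding K0_def less_Suc_eq_le by (rule Max_ge) (use that in \<open>auto simp: P_def\<close>)
  fix K assume "K0 \<le> K"
  let ?l = "concat (map (block B) (block_order K))"
  have set_l: "set ?l = {s \<in> dom_of ?f. block_index s < 2 * K}"
    by (auto simp: set_block set_block_order)
  have "alpha ?f w = elem_prod (map (lab ?f) ?l) w"
  proof (rule alpha_finite[OF _ sorted_blocks[OF block_order_sorted] assms])
    show "set (positions ?f x) \<subseteq> set ?l" if "x \<in> set w" for x
    proof
      fix s assume s: "s \<in> set (positions ?f x)"
      with that have "s \<in> P"
        unfolding P_def by blast
      then have "block_index s < 2 * K"
        using K0[of s] \<open>K0 \<le> K\<close> by simp
      then show "s \<in> set ?l"
        unfolding set_l using s positions_sorted(2)[of x] by blast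
    qed
  qed (auto simp: set_block)
  also have "map (lab ?f) ?l = concat (map B (block_order K))"
    by (simp add: map_concat comp_def lab_block del: lab_block_word)
  finally show "alpha ?f w = elem_prod (concat (map B (block_order K))) w" .
qed

end

lemma alpha_surj:
  assumes \<theta>: "\<theta> \<in> auto F_omega"
  shows "\<exists>f \<in> (SS :: (nat, elem) oword set). alpha f = \<theta>"
proof -
  have iso: "\<theta> \<in> iso F_omega F_omega"
    using \<theta> by (simp add: iso_def auto_def Bij_def)
  obtain th n L where *: "th 0 = \<theta>" "\<forall>k. stage (th k) (n k) (n (Suc k)) (L k)"
    "\<forall>k. \<forall>e\<in>set (L k). fst (fst e) < n (Suc (Suc k)) \<and> fst (snd e) < n (Suc (Suc k))"
    "\<forall>k w. reduced w \<longrightarrow> th (Suc k) (th k (elem_prod (L k) w)) = w"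
    using stage_sequence[OF iso] by blast
  note th = *(1) and stage = *(2)[rule_format] and bound = *(3)[rule_format] and step = *(4)[rule_format]
  \<comment> \<open>Even blocks are split off on the left and return inverted; odd blocks are split
    off from an inverse, so two inversions cancel.\<close>
  define B where "B k = (if even k then elems_inv (L k) else L k)" for k
  have L: "set (L k) \<subseteq> elems" "th k \<in> iso F_omega F_omega" for k
    using stage[of k] by (simp_all add: stage_def)
  have B_L: "\<exists>e'\<in>set (L k). fst e = fst e' \<and> fst (snd e) = fst (snd e')" if "e \<in> set (B k)" for e k
  proof (cases "even k")
    case True
    then have "elem_inv e \<in> set (L k)"
      using that by (auto simp: B_def elems_inv_def)
    then show ?thesis
      by (intro bexI[of _ "elem_inv e"]) simp_all
  qed (use that in \<open>auto simp: B_def\<close>)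
  interpret stages B n
  proof
    show "set (B k) \<subseteq> elems" for k
      using L(1)[of k] by (simp add: B_def)
    show "n k < n (Suc k)" for k
      using stage[of k] by (simp add: stage_def)
    show "n k \<le> fst (fst e)" if e: "e \<in> set (B k)" for k e
    proof -
      obtain e' where "e' \<in> set (L k)" "fst e = fst e'"
        using B_L[OF e] by blast
      then show ?thesis
        using stage[of k] by (simp add: stage_def)
    qed
    show "fst (snd e) < n (Suc (Suc k))" if e: "e \<in> set (B k)" for k e
    proof -
      obtain e' where "e' \<in> set (L k)" "fst (snd e) = fst (snd e')"
        using B_L[OF e] by blast
      then show ?thesis
        using bound[of e' k] by simp
    qed
  qed
  define E where "E K = concat (map (\<lambda>i. B (2 * i)) [0..<K])" for K
  define R where "R K = concat (map (\<lambda>i. B (2 * i + 1)) (rev [0..<K]))" for K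
  have E_elems: "set (E K) \<subseteq> elems" for K
    using elems by (auto simp: E_def)
  have split_order: "concat (map B (block_order K)) = E K @ R K" for K
    by (simp add: block_order_def E_def R_def comp_def)
  \<comment> \<open>Each step of the induction inserts one even and one odd block around the
    remainder in the middle.\<close>
  have factor: "\<theta> w = elem_prod (R K) (th (2 * K) (elem_prod (E K) w))" if w: "reduced w" for K w
  proof (induction K)
    case (Suc K)
    define u where "u = elem_prod (E K) w"
    have u: "reduced u"
      unfolding u_def by (rule elem_prod_word(1)[OF E_elems w])
    define v where "v = elem_prod (B (2 * K)) u"
    have v: "reduced v" "elem_prod (L (2 * K)) v = u"
      unfolding v_def using elem_prod_word(1)[OF elems u, of "2 * K"] elem_prod_inverse'[OF L(1) u] by (simp_all add: B_def)
    define y where "y = th (2 * K) u"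
    have y: "reduced y" "th (Suc (2 * K)) y = v"
      unfolding y_def using iso_word(1)[OF L(2) u] step[OF v(1), of "2 * K"] v(2) by simp_all
    let ?L = "L (Suc (2 * K))"
    have red: "reduced (elem_prod (elems_inv ?L) y)"
      using elem_prod_word(1)[of "elems_inv ?L"] L(1) y(1) by simp
    \<comment> \<open>The recursion at \<open>2 * K + 1\<close> is applied to the word that
      \<open>?L\<close> carries to \<open>y\<close>.\<close>
    have "th (Suc (Suc (2 * K))) v = elem_prod (elems_inv ?L) y"
      using step[OF red, of "Suc (2 * K)"] elem_prod_inverse'[OF L(1) y(1)] y(2) by simp
    then have "elem_prod (B (Suc (2 * K))) (th (Suc (Suc (2 * K))) v) = y"
      using elem_prod_inverse'[OF L(1) y(1)] by (simp add: B_def)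
    moreover have "elem_prod (E (Suc K)) w = v" "R (Suc K) = B (Suc (2 * K)) @ R K"
      by (simp_all add: E_def R_def v_def u_def)
    ultimately show ?case
      using Suc by (simp add: y_def u_def)
  qed (simp add: E_def R_def th)
  have "alpha (block_word B) = \<theta>"
  proof (rule extensionalityI[where A = "carrier F_omega"])
    fix w :: "xletter list" assume "w \<in> carrier F_omega"
    then have w: "reduced w" by simp
    obtain K0 where K0: "\<forall>K\<ge>K0. alpha (block_word B) w = elem_prod (concat (map B (block_order K))) w"
      using alpha_block_word[OF w] by blast
    \<comment> \<open>Large enough for the stable value of \<open>alpha\<close> and, as
      \<open>2 * K \<le> n (2 * K)\<close>, for all letters of \<open>w\<close> to lie below
      \<open>n (2 * K)\<close>.\<close>
    define K where "K = K0 + Suc (Max (insert 0 (fst ` set w)))"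
    have letters: "fst x < n (2 * K)" if "x \<in> set w" for x
    proof -
      have "fst x \<le> Max (insert 0 (fst ` set w))"
        by (rule Max_ge) (use that in auto)
      moreover have "Suc (Max (insert 0 (fst ` set w))) \<le> K"
        by (simp only: K_def le_add2)
      ultimately have "fst x < 2 * K" by linarith
      also have "\<dots> \<le> n (2 * K)"
        by (rule strict_mono_imp_increasing[OF strict_mono_n])
      finally show ?thesis .
    qed
    \<comment> \<open>Even blocks below \<open>2 * K\<close> insert only letters of index below
      \<open>n (2 * K)\<close>, so the remainder meets only letters that it fixes.\<close>
    have "fst x < n (2 * K)" if "x \<in> set (elem_prod (E K) w)" for x
    proof (rule elem_prod_bounded[OF E_elems w _ letters that])
      fix e assume "e \<in> set (E K)"
      then obtain i where i: "i < K" "e \<in> set (B (2 * i))"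
        by (auto simp: E_def)
      have "fst (snd e) < n (Suc (Suc (2 * i)))"
        by (rule upper[OF i(2)])
      also have "\<dots> \<le> n (2 * K)"
        using i(1) strict_mono_less_eq[OF strict_mono_n] by simp
      finally show "fst (snd e) < n (2 * K)" .
    qed
    then have letter: "th (2 * K) [x] = [x]" if "x \<in> set (elem_prod (E K) w)" for x
      using stage[of "2 * K"] that unfolding stage_def by blast
    have "th (2 * K) \<in> hom F_omega F_omega"
      using L(2)[of "2 * K"] by (simp add: iso_def)
    then have "th (2 * K) (elem_prod (E K) w) = elem_prod (E K) w"
      by (rule fixed_word[OF _ elem_prod_word(1)[OF E_elems w] letter])
    moreover have "alpha (block_word B) w = elem_prod (E K @ R K) w"
      using K0[rule_format, of K] unfolding split_order by (simp add: K_def)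
    ultimately show "alpha (block_word B) w = \<theta> w"
      using factor[OF w, of K] by simp
  qed (use \<theta> in \<open>simp_all add: alpha_def auto_def Bij_def\<close>)
  with block_word_SS show ?thesis by blast
qed

text \<open>\<open>epi\<close> also asserts the homomorphism property. Surjectivity then needs only
  that \<open>Psi\<close> takes the value \<open>alpha f\<close> on the class of any
  \<open>f\<close> in \<open>SS\<close>.\<close>

theorem theorem4p6p2:
  shows "Psi \<in> epi BF_E (right_Aut F_omega)"
proof -
  have "Psi ` carrier BF_E = carrier (right_Aut F_omega)"
  proof (intro equalityI subsetI)
    fix \<theta> assume "\<theta> \<in> carrier (right_Aut F_omega)"
    then have "\<theta> \<in> auto F_omega"
      by (simp add: right_Aut_def AutoGroup_def)
    then obtain f :: "(nat, elem) oword" where "f \<in> SS" "alpha f = \<theta>"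
      using alpha_surj by blast
    then have "Psi (BF_class f) = \<theta>" "BF_class f \<in> carrier BF_E"
      by (simp_all add: Psi_BF_class BF_def)
    then show "\<theta> \<in> Psi ` carrier BF_E"
      by blast
  qed (use Psi_hom in \<open>auto simp: hom_def\<close>)
  with Psi_hom show ?thesis
    by (simp add: epi_def)
qed

end
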